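(* Let $(M,F)$ be a complete Finsler Banach manifold and let $X$ be a vector field on $M$ which is primarily bounded, i.e. there exists a primarily complete function $\alpha:[0,\infty)\to\mathbb{R}$ such that $F(X_p)<\alpha(|p|)$ for all $p\in M$. Then $X$ is complete, i.e. every integral curve of $X$ can be extended to an integral curve of $X$ defined on all of $\mathbb{R}$.
   Context: Banach manifolds $M$ (modelled on a real Banach space $B$ with norm $\|\cdot\|$, possibly infinite-dimensional) are of class at least $C^2$, connected, Hausdorff and paracompact; vector fields are of class at least $C^1$. A Finsler metric $F$ on $M$ (only $C^0$ regularity is required) is a choice of a norm $F_p:T_pM\to\mathbb{R}$ on each tangent space (so $F(v)=F(-v)$) such that each $p\in M$ admits a chart $(U,\varphi)$, $p\in U$, $\varphi:U\to B$, for which the norms on $B$ given by $\|u\|_q:=F_q(d(\varphi^{-1})_{\varphi(q)}(u))$, $q\in U$, satisfy: (a) each $\|\cdot\|_q$ is equivalent to $\|\cdot\|$; (b) they vary continuously at $p$: for each $0<\epsilon<1$ there is a neighborhood $U_\epsilon\subset U$ of $p$ with $\epsilon\|\cdot\|_q\le\|\cdot\|_p\le\epsilon^{-1}\|\cdot\|_q$ for all $q\in U_\epsilon$. The pair $(M,F)$ is called a Finsler Banach manifold. The distance $d$ associated with $F$ is the infimum of the $F$-lengths of curves joining two points. $(M,F)$ is complete if the metric space $(M,d)$ is complete. A base point $p_0\in M$ is fixed and $|p|:=d(p,p_0)$ for $p\in M$. A function $\alpha:[0,\infty)\to\mathbb{R}$ is primarily complete if it is locally Lipschitz, positive, non-decreasing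 and satisfies $\int_0^\infty \frac{dx}{\alpha(x)}=\infty$. *)

theory Defs
  imports "HOL-Analysis.Analysis"
begin

section \<open>Maps of class $C^1$ and $C^2$ on open subsets of normed spaces\<close>

definition C1_on :: "('a::real_normed_vector \<Rightarrow> 'c::real_normed_vector) \<Rightarrow> 'a set \<Rightarrow> bool" where
  "C1_on f S \<longleftrightarrow>
    (\<exists>f' :: 'a \<Rightarrow> 'a \<Rightarrow>\<^sub>L 'c.
       (\<forall>x\<in>S. (f has_derivative blinfun_apply (f' x)) (at x)) \<and> continuous_on S f')"

definition C2_on :: "('a::real_normed_vector \<Rightarrow> 'c::real_normed_vector) \<Rightarrow> 'a set \<Rightarrow> bool" where
  "C2_on f S \<longleftrightarrow>
    (\<exists>f' :: 'a \<Rightarrow> 'a \<Rightarrow>\<^sub>L 'c.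
       (\<forall>x\<in>S. (f has_derivative blinfun_apply (f' x)) (at x)) \<and> C1_on f' S)"


section \<open>Banach manifolds\<close>

definition paracompact_space :: "'m topology \<Rightarrow> bool" where
  "paracompact_space T \<longleftrightarrow>
    (\<forall>\<U>. (\<forall>U\<in>\<U>. openin T U) \<and> \<Union>\<U> = topspace T \<longrightarrow>
      (\<exists>\<V>. (\<forall>V\<in>\<V>. openin T V) \<and> \<Union>\<V> = topspace T \<and>
           (\<forall>V\<in>\<V>. \<exists>U\<in>\<U>. V \<subseteq> U) \<and> locally_finite_in T \<V>))"

text \<open>
  A chart is a pair of its domain and a map into the model space; the values of the map outside
  the domain are irrelevant.
\<close>

type_synonym ('m, 'b) chart = "'m set \<times> ('m \<Rightarrow> 'b)"

definition is_chart :: "'m topology \<Rightarrow> ('m, 'b::real_normed_vector) chart \<Rightarrow> bool" where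
  "is_chart T c \<longleftrightarrow>
    openin T (fst c) \<and> open (snd c ` fst c) \<and>
    homeomorphic_map (subtopology T (fst c)) (top_of_set (snd c ` fst c)) (snd c)"

definition chart_inv :: "('m, 'b) chart \<Rightarrow> 'b \<Rightarrow> 'm" where
  "chart_inv c = inv_into (fst c) (snd c)"

definition transition :: "('m, 'b) chart \<Rightarrow> ('m, 'b) chart \<Rightarrow> 'b \<Rightarrow> 'b" where
  "transition c c' = snd c' \<circ> chart_inv c"

definition C2_compatible ::
  "('m, 'b::real_normed_vector) chart \<Rightarrow> ('m, 'b) chart \<Rightarrow> bool" where
  "C2_compatible c c' \<longleftrightarrow>
    C2_on (transition c c') (snd c ` (fst c \<inter> fst c')) \<and>
    C2_on (transition c' c) (snd c' ` (fst c \<inter> fst c'))"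

definition banach_manifold :: "'m topology \<Rightarrow> ('m, 'b::banach) chart set \<Rightarrow> bool" where
  "banach_manifold T A \<longleftrightarrow>
    connected_space T \<and> Hausdorff_space T \<and> paracompact_space T \<and>
    (\<forall>c\<in>A. is_chart T c) \<and> (\<Union>c\<in>A. fst c) = topspace T \<and>
    (\<forall>c\<in>A. \<forall>c'\<in>A. C2_compatible c c')"

text \<open>The charts of the manifold are the members of the maximal atlas generated by \<open>A\<close>.\<close>

definition charts :: "'m topology \<Rightarrow> ('m, 'b::banach) chart set \<Rightarrow> ('m, 'b) chart set" where
  "charts T A = {c. is_chart T c \<and> (\<forall>c'\<in>A. C2_compatible c c')}"

definition charts_at ::
  "'m topology \<Rightarrow> ('m, 'b::banach) chart set \<Rightarrow> 'm \<Rightarrow> ('m, 'b) chart set" where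
  "charts_at T A p = {c \<in> charts T A. p \<in> fst c}"


section \<open>Tangent vectors and vector fields\<close>

text \<open>
  A tangent vector at \<open>p\<close> is the family of its representatives in all charts around \<open>p\<close>, related
  to each other by the derivatives of the transition maps. It is set to \<open>0\<close> on all other charts,
  so that it is determined by these representatives. The linear structure of the tangent space is
  the pointwise one.
\<close>

type_synonym ('m, 'b) tangent = "('m, 'b) chart \<Rightarrow> 'b"

definition tangent_space ::
  "'m topology \<Rightarrow> ('m, 'b::banach) chart set \<Rightarrow> 'm \<Rightarrow> ('m, 'b) tangent set" where
  "tangent_space T A p =
    {v. (\<forall>c \<in> charts_at T A p. \<forall>c' \<in> charts_at T A p.
           v c' = frechet_derivative (transition c c') (at (snd c p)) (v c)) \<and>
        (\<forall>c. c \<notin> charts_at T A p \<longrightarrow> v c = 0)}"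

text \<open>The image of \<open>u\<close> under the differential at \<open>snd c p\<close> of the inverse of the chart \<open>c\<close>.\<close>

definition tangent_of_chart ::
  "'m topology \<Rightarrow> ('m, 'b::banach) chart set \<Rightarrow> ('m, 'b) chart \<Rightarrow> 'm \<Rightarrow> 'b \<Rightarrow> ('m, 'b) tangent" where
  "tangent_of_chart T A c p u =
    (\<lambda>c'. if c' \<in> charts_at T A p
          then frechet_derivative (transition c c') (at (snd c p)) u else 0)"

definition C1_vector_field ::
  "'m topology \<Rightarrow> ('m, 'b::banach) chart set \<Rightarrow> ('m \<Rightarrow> ('m, 'b) tangent) \<Rightarrow> bool" where
  "C1_vector_field T A X \<longleftrightarrow>
    (\<forall>p \<in> topspace T. X p \<in> tangent_space T A p) \<and>
    (\<forall>c \<in> charts T A. C1_on (\<lambda>x. X (chart_inv c x) c) (snd c ` fst c))"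


section \<open>Curves\<close>

text \<open>
  The set \<open>J\<close> is meant to be a non-degenerate interval; at an endpoint belonging to \<open>J\<close> the
  derivatives are one-sided.
\<close>

definition C1_curve ::
  "'m topology \<Rightarrow> ('m, 'b::banach) chart set \<Rightarrow> real set \<Rightarrow> (real \<Rightarrow> 'm) \<Rightarrow> bool" where
  "C1_curve T A J \<gamma> \<longleftrightarrow>
    continuous_map (top_of_set J) T \<gamma> \<and>
    (\<forall>c \<in> charts T A. \<exists>D :: real \<Rightarrow> 'b.
       (\<forall>t \<in> J \<inter> \<gamma> -` fst c. ((\<lambda>s. snd c (\<gamma> s)) has_vector_derivative D t) (at t within J)) \<and>
       continuous_on (J \<inter> \<gamma> -` fst c) D)"

definition velocity ::
  "'m topology \<Rightarrow> ('m, 'b::banach) chart set \<Rightarrow> real set \<Rightarrow> (real \<Rightarrow> 'm) \<Rightarrow> real \<Rightarrow> ('m, 'b) tangent" where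
  "velocity T A J \<gamma> t =
    (\<lambda>c. if c \<in> charts_at T A (\<gamma> t)
         then vector_derivative (\<lambda>s. snd c (\<gamma> s)) (at t within J) else 0)"

text \<open>
  Each piece is of class \<open>C\<^sup>1\<close> up to and including its endpoints. The condition used in
  \<^const>\<open>piecewise_C1_differentiable_on\<close> would allow unbounded derivatives near the break points.
\<close>

definition piecewise_C1_curve ::
  "'m topology \<Rightarrow> ('m, 'b::banach) chart set \<Rightarrow> real \<Rightarrow> real \<Rightarrow> (real \<Rightarrow> 'm) \<Rightarrow> bool" where
  "piecewise_C1_curve T A a b \<gamma> \<longleftrightarrow>
    a < b \<and>
    (\<exists>(n::nat) (\<tau>::nat \<Rightarrow> real). \<tau> 0 = a \<and> \<tau> n = b \<and>
       (\<forall>i<n. \<tau> i < \<tau> (Suc i) \<and> C1_curve T A {\<tau> i..\<tau> (Suc i)} \<gamma>))"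

definition integral_curve ::
  "'m topology \<Rightarrow> ('m, 'b::banach) chart set \<Rightarrow> ('m \<Rightarrow> ('m, 'b) tangent) \<Rightarrow>
   real set \<Rightarrow> (real \<Rightarrow> 'm) \<Rightarrow> bool" where
  "integral_curve T A X J \<gamma> \<longleftrightarrow>
    is_interval J \<and> interior J \<noteq> {} \<and>
    C1_curve T A J \<gamma> \<and> (\<forall>t\<in>J. velocity T A J \<gamma> t = X (\<gamma> t))"

definition complete_vector_field ::
  "'m topology \<Rightarrow> ('m, 'b::banach) chart set \<Rightarrow> ('m \<Rightarrow> ('m, 'b) tangent) \<Rightarrow> bool" where
  "complete_vector_field T A X \<longleftrightarrow>
    (\<forall>J \<gamma>. integral_curve T A X J \<gamma> \<longrightarrow>
       (\<exists>\<Gamma>. integral_curve T A X UNIV \<Gamma> \<and> (\<forall>t\<in>J. \<Gamma> t = \<gamma> t)))"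


section \<open>Finsler metrics\<close>

definition norm_on_tangent_space ::
  "'m topology \<Rightarrow> ('m, 'b::banach) chart set \<Rightarrow> 'm \<Rightarrow> (('m, 'b) tangent \<Rightarrow> real) \<Rightarrow> bool" where
  "norm_on_tangent_space T A p N \<longleftrightarrow>
    (\<forall>v \<in> tangent_space T A p. 0 \<le> N v \<and> (N v = 0 \<longleftrightarrow> v = (\<lambda>_. 0))) \<and>
    (\<forall>v \<in> tangent_space T A p. \<forall>r::real. N (\<lambda>c. r *\<^sub>R v c) = \<bar>r\<bar> * N v) \<and>
    (\<forall>v \<in> tangent_space T A p. \<forall>w \<in> tangent_space T A p. N (\<lambda>c. v c + w c) \<le> N v + N w)"

definition finsler_metric ::
  "'m topology \<Rightarrow> ('m, 'b::banach) chart set \<Rightarrow> ('m \<Rightarrow> ('m, 'b) tangent \<Rightarrow> real) \<Rightarrow> bool" where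
  "finsler_metric T A F \<longleftrightarrow>
    (\<forall>p \<in> topspace T. norm_on_tangent_space T A p (F p)) \<and>
    (\<forall>p \<in> topspace T. \<exists>c \<in> charts_at T A p.
       let N = (\<lambda>q u. F q (tangent_of_chart T A c q u)) in
         (\<forall>q \<in> fst c. \<exists>k>0. \<exists>K>0. \<forall>u. k * norm u \<le> N q u \<and> N q u \<le> K * norm u) \<and>
         (\<forall>\<epsilon>. 0 < \<epsilon> \<and> \<epsilon> < 1 \<longrightarrow>
            (\<exists>V. openin T V \<and> p \<in> V \<and> V \<subseteq> fst c \<and>
               (\<forall>q\<in>V. \<forall>u. \<epsilon> * N q u \<le> N p u \<and> N p u \<le> inverse \<epsilon> * N q u))))"

definition finsler_length ::
  "'m topology \<Rightarrow> ('m, 'b::banach) chart set \<Rightarrow> ('m \<Rightarrow> ('m, 'b) tangent \<Rightarrow> real) \<Rightarrow>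
   real \<Rightarrow> real \<Rightarrow> (real \<Rightarrow> 'm) \<Rightarrow> real" where
  "finsler_length T A F a b \<gamma> = integral {a..b} (\<lambda>t. F (\<gamma> t) (velocity T A {a..b} \<gamma> t))"

text \<open>
  The value \<open>0\<close> off the carrier only serves to satisfy the locale \<^locale>\<open>Metric_space\<close>, which
  asks for a nonnegative function on the whole type.
\<close>

definition finsler_dist ::
  "'m topology \<Rightarrow> ('m, 'b::banach) chart set \<Rightarrow> ('m \<Rightarrow> ('m, 'b) tangent \<Rightarrow> real) \<Rightarrow>
   'm \<Rightarrow> 'm \<Rightarrow> real" where
  "finsler_dist T A F p q =
    (if p \<in> topspace T \<and> q \<in> topspace T
     then Inf {finsler_length T A F a b \<gamma> | a b \<gamma>.
                 piecewise_C1_curve T A a b \<gamma> \<and> \<gamma> a = p \<and> \<gamma> b = q}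
     else 0)"

definition finsler_complete ::
  "'m topology \<Rightarrow> ('m, 'b::banach) chart set \<Rightarrow> ('m \<Rightarrow> ('m, 'b) tangent \<Rightarrow> real) \<Rightarrow> bool" where
  "finsler_complete T A F \<longleftrightarrow> Metric_space.mcomplete (topspace T) (finsler_dist T A F)"


section \<open>Primarily complete functions and primarily bounded vector fields\<close>

text \<open>Only the values of \<open>\<alpha>\<close> on \<open>{0..}\<close> are relevant.\<close>

definition primarily_complete :: "(real \<Rightarrow> real) \<Rightarrow> bool" where
  "primarily_complete \<alpha> \<longleftrightarrow>
    (\<forall>x\<ge>0. \<exists>\<delta>>0. \<exists>L. L-lipschitz_on (cball x \<delta> \<inter> {0..}) \<alpha>) \<and>
    (\<forall>x\<ge>0. 0 < \<alpha> x) \<and>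
    mono_on {0..} \<alpha> \<and>
    filterlim (\<lambda>R. integral {0..R} (\<lambda>x. 1 / \<alpha> x)) at_top at_top"

definition primarily_bounded ::
  "'m topology \<Rightarrow> ('m, 'b::banach) chart set \<Rightarrow> ('m \<Rightarrow> ('m, 'b) tangent \<Rightarrow> real) \<Rightarrow> 'm \<Rightarrow>
   ('m \<Rightarrow> ('m, 'b) tangent) \<Rightarrow> bool" where
  "primarily_bounded T A F p\<^sub>0 X \<longleftrightarrow>
    (\<exists>\<alpha>. primarily_complete \<alpha> \<and>
       (\<forall>p \<in> topspace T. F p (X p) < \<alpha> (finsler_dist T A F p p\<^sub>0)))"

end

theory Submission
  imports Defs
begin

text \<open>
  An integral curve stops at a finite time \<open>b\<close> only if it does not converge in the manifold as
  time tends to \<open>b\<close>, and the growth condition on \<open>X\<close> makes it converge. Let \<open>\<gamma>\<close> be a maximal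
  integral curve on \<open>J\<close>, let \<open>J\<close> be bounded above with supremum \<open>b\<close>, and let \<open>a \<in> J\<close>. If
  \<open>b \<in> J\<close>, a local solution through \<open>\<gamma> b\<close> prolongs \<open>\<gamma>\<close> (\<open>extend_beyond_maximum\<close>). Otherwise put
  \<open>u t = d (\<gamma> a) p\<^sub>0 + \<integral> F (X (\<gamma> x)) dx\<close>, the integral taken from \<open>a\<close> to \<open>t\<close>. A distance is at
  most the length of a curve, so \<open>d (\<gamma> t) p\<^sub>0 \<le> u t\<close>, and as \<open>\<alpha>\<close> is non-decreasing,
  \<open>u' t = F (X (\<gamma> t)) \<le> \<alpha> (u t)\<close>. The primitive of \<open>1 / \<alpha>\<close> therefore grows along \<open>u\<close> with slope
  at most one, and since it is unbounded, \<open>u\<close> is bounded before \<open>b\<close>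
  (\<open>primarily_complete_bound\<close>). Hence the speed of \<open>\<gamma>\<close> is bounded and \<open>\<gamma>\<close> is Lipschitz for \<open>d\<close>
  (\<open>integral_curve_Lipschitz\<close>). Completeness provides a limit point \<open>p\<close>
  (\<open>limit_at_finite_endpoint\<close>), and \<open>\<gamma>\<close> together with the value \<open>p\<close> at \<open>b\<close> is an integral curve
  (\<open>extend_to_limit\<close>), against maximality. An interval bounded below is treated by running the
  curve backwards along \<open>-X\<close>. Maximal integral curves come from Zorn's lemma
  (\<open>maximal_integral_curve_exists\<close>).

  Two facts carry this argument. Solutions exist locally, by Picard iteration in a chart
  (\<open>local_flow_exists\<close>). And \<open>d\<close> is a metric whose convergence implies convergence in
  the manifold (\<open>Metric_space_finsler\<close>, \<open>dist_tendsto_imp_limitin\<close>). The latter rests on a lower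
  bound for lengths: near \<open>p\<close> all norms dominate a multiple \<open>k\<close> of the norm of the model space,
  so a curve of length less than \<open>k * r\<close> starting at \<open>p\<close> stays in the chart ball of radius \<open>r\<close>
  (\<open>short_curve_stays_in_chart_ball\<close>). In infinite dimension closed chart balls are neither compact nor
  obviously closed in the manifold; the bound comes from the completeness of the model space and the
  Hausdorff property.
\<close>

section \<open>Maps of class \<open>C\<^sup>1\<close>\<close>

lemma C1_on_subset: "C1_on f S \<Longrightarrow> R \<subseteq> S \<Longrightarrow> C1_on f R"
  unfolding C1_on_def by (meson continuous_on_subset subset_iff)

lemma C1_on_imp_continuous_on:
  assumes "C1_on f S" shows "continuous_on S f"
  using assms unfolding C1_on_def
  by (metis has_derivative_continuous continuous_at_imp_continuous_at_within
      continuous_on_eq_continuous_within)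

lemma C1_on_imp_has_derivative:
  assumes "C1_on f S" "x \<in> S"
  shows "(f has_derivative frechet_derivative f (at x)) (at x)"
  using assms unfolding C1_on_def
  by (metis differentiableI frechet_derivative_works)

lemma C2_on_imp_C1_on:
  assumes "C2_on f S" shows "C1_on f S"
  using assms C1_on_imp_continuous_on unfolding C2_on_def C1_on_def by blast

text \<open>
  The derivative at a point is unique, so the derivatives given on the various neighbourhoods are
  restrictions of one function.
\<close>
lemma C1_on_locally:
  assumes "\<And>x. x \<in> S \<Longrightarrow> \<exists>U. open U \<and> x \<in> U \<and> C1_on f U"
  shows "C1_on f S"
proof -
  define f' where "f' x = Blinfun (frechet_derivative f (at x))" for x
  have loc: "(f has_derivative blinfun_apply (f' x)) (at x) \<and> isCont f' x" if xS: "x \<in> S" for x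
  proof -
    obtain U g where U: "open U" "x \<in> U" "continuous_on U g"
      and g: "\<And>y. y \<in> U \<Longrightarrow> (f has_derivative blinfun_apply (g y)) (at y)"
      using assms[OF xS] unfolding C1_on_def by blast
    have eq: "f' y = g y" if "y \<in> U" for y
    proof -
      have "frechet_derivative f (at y) = blinfun_apply (g y)"
        using frechet_derivative_at[OF g[OF that]] by simp
      then show ?thesis by (simp add: f'_def blinfun_apply_inverse)
    qed
    have "isCont g x"
      using U by (simp add: continuous_on_eq_continuous_at)
    moreover have "eventually (\<lambda>y. g y = f' y) (nhds x)"
      using U eq by (auto simp: eventually_nhds)
    ultimately have "isCont f' x"
      using isCont_cong by blast
    then show ?thesis using g[OF U(2)] eq[OF U(2)] by simp
  qed
  then show ?thesis
    unfolding C1_on_def by (auto intro!: exI[of _ f'] continuous_at_imp_continuous_on)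
qed

lemma C1_on_compose:
  assumes "C1_on f S" "C1_on g R" "f ` S \<subseteq> R"
  shows "C1_on (g \<circ> f) S"
proof -
  obtain f' where f': "\<And>x. x \<in> S \<Longrightarrow> (f has_derivative blinfun_apply (f' x)) (at x)" "continuous_on S f'"
    using assms(1) unfolding C1_on_def by blast
  obtain g' where g': "\<And>x. x \<in> R \<Longrightarrow> (g has_derivative blinfun_apply (g' x)) (at x)" "continuous_on R g'"
    using assms(2) unfolding C1_on_def by blast
  have "continuous_on S (\<lambda>x. g' (f x) o\<^sub>L f' x)"
    using C1_on_imp_continuous_on[OF assms(1)] f'(2) g'(2) assms(3)
    by (intro bounded_bilinear.continuous_on[OF bounded_bilinear_blinfun_compose])
       (auto intro: continuous_on_compose2)
  moreover have "(g \<circ> f has_derivative blinfun_apply (g' (f x) o\<^sub>L f' x)) (at x)" if "x \<in> S" for x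
  proof -
    have "(g \<circ> f has_derivative blinfun_apply (g' (f x)) \<circ> blinfun_apply (f' x)) (at x)"
      using f'(1)[OF that] g'(1)[of "f x"] assms(3) that by (intro diff_chain_at) auto
    moreover have "blinfun_apply (g' (f x)) \<circ> blinfun_apply (f' x) = blinfun_apply (g' (f x) o\<^sub>L f' x)"
      by (simp add: fun_eq_iff)
    ultimately show ?thesis by simp
  qed
  ultimately show ?thesis unfolding C1_on_def by (intro exI[of _ "\<lambda>x. g' (f x) o\<^sub>L f' x"]) blast
qed

lemma C1_on_cong_open:
  assumes "C1_on f S" "open S" "\<And>x. x \<in> S \<Longrightarrow> f x = g x"
  shows "C1_on g S"
  using assms unfolding C1_on_def by (meson has_derivative_transform_within_open)

text \<open>
  A continuous derivative is bounded near \<open>x\<close>, and the mean value inequality holds on the convex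
  ball.
\<close>
lemma C1_on_locally_Lipschitz:
  assumes "C1_on f S" "open S" "x \<in> S"
  obtains r L where "0 < r" "0 \<le> L" "cball x r \<subseteq> S" "L-lipschitz_on (cball x r) f"
proof -
  obtain f' where f': "\<And>x. x \<in> S \<Longrightarrow> (f has_derivative blinfun_apply (f' x)) (at x)" "continuous_on S f'"
    using assms(1) unfolding C1_on_def by blast
  obtain r0 where r0: "r0 > 0" "cball x r0 \<subseteq> S"
    using assms open_contains_cball by blast
  have "isCont f' x" using f'(2) assms by (simp add: continuous_on_eq_continuous_at)
  then obtain d where d: "d > 0" "\<And>y. dist y x < d \<Longrightarrow> dist (f' y) (f' x) < 1"
    unfolding continuous_at_eps_delta by (meson zero_less_one)
  define r where "r = min r0 (d / 2)"
  have r: "r > 0" "cball x r \<subseteq> S" using r0 d by (auto simp: r_def)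
  have bound: "norm (f' y) \<le> norm (f' x) + 1" if "y \<in> cball x r" for y
  proof -
    have "dist y x < d" using that d by (auto simp: r_def dist_commute)
    from d(2)[OF this] show ?thesis
      by (smt (verit, best) dist_norm norm_triangle_ineq2)
  qed
  have "norm (f y - f z) \<le> (norm (f' x) + 1) * norm (y - z)"
    if "y \<in> cball x r" "z \<in> cball x r" for y z
  proof (rule differentiable_bound[of "cball x r" f "\<lambda>y. blinfun_apply (f' y)"])
    show "\<And>y. y \<in> cball x r \<Longrightarrow> (f has_derivative blinfun_apply (f' y)) (at y within cball x r)"
      using f'(1) r(2) has_derivative_at_withinI by blast
  qed (use that bound in \<open>auto simp: norm_blinfun.rep_eq[symmetric]\<close>)
  then have "(norm (f' x) + 1)-lipschitz_on (cball x r) f"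
    by (intro lipschitz_onI) (auto simp: dist_norm)
  then show thesis using r by (intro that[of r "norm (f' x) + 1"]) auto
qed

section \<open>Local solutions of ordinary differential equations in Banach spaces\<close>

text \<open>
  Picard iteration. The integral operator is a contraction on the continuous functions from the
  whole line into a closed ball on which \<open>f\<close> is bounded and Lipschitz. Clamping the time to
  \<open>{0..\<delta>}\<close> turns solutions on that interval into bounded continuous functions on the line, which
  form a complete metric space.
\<close>
lemma local_flow_exists:
  fixes f :: "'b::banach \<Rightarrow> 'b"
  assumes "C1_on f S" "open S" "x0 \<in> S"
  obtains \<delta> x where "0 < \<delta>" "x 0 = x0" "\<And>t. t \<in> {0..\<delta>} \<Longrightarrow> x t \<in> S"
    "\<And>t. t \<in> {0..\<delta>} \<Longrightarrow> (x has_vector_derivative f (x t)) (at t within {0..\<delta>})"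
proof -
  obtain r L where rL: "0 < r" "0 \<le> L" "cball x0 r \<subseteq> S" "L-lipschitz_on (cball x0 r) f"
    using C1_on_locally_Lipschitz[OF assms] .
  define K where "K = norm (f x0) + L * r"
  have K: "norm (f y) \<le> K" if "y \<in> cball x0 r" for y
  proof -
    have "dist (f y) (f x0) \<le> L * dist y x0"
      using lipschitz_onD[OF rL(4)] that rL(1) by auto
    also have "\<dots> \<le> L * r" using that rL by (intro mult_left_mono) (auto simp: dist_commute)
    finally show ?thesis unfolding K_def dist_norm
      by (smt (verit, best) norm_triangle_ineq2)
  qed
  have K0: "K \<ge> 0" unfolding K_def using rL by simp
  \<comment> \<open>The first term keeps the iterates in the ball, the second makes the operator contract by \<open>1/2\<close>.\<close>
  define \<delta> where "\<delta> = min (r / (K + 1)) (1 / (2 * (L + 1)))"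
  have \<delta>: "0 < \<delta>" using rL K0 by (simp add: \<delta>_def)
  have \<delta>K: "K * \<delta> \<le> r"
  proof -
    have "K * \<delta> \<le> (K + 1) * (r / (K + 1))"
      using \<delta> K0 rL by (intro mult_mono) (auto simp: \<delta>_def)
    also have "\<dots> = r" using K0 by simp
    finally show ?thesis .
  qed
  have \<delta>L: "L * \<delta> \<le> 1 / 2"
  proof -
    have "L * \<delta> \<le> (L + 1) * (1 / (2 * (L + 1)))"
      using \<delta> rL by (intro mult_mono) (auto simp: \<delta>_def)
    also have "\<dots> = 1 / 2" using rL by simp
    finally show ?thesis .
  qed
  have fcont: "continuous_on (cball x0 r) f"
    using lipschitz_on_continuous_on rL(4) by blast
  define P where "P = PiC (UNIV::real set) (\<lambda>_. cball x0 r)"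
  have Pmem: "apply_bcontfun y t \<in> cball x0 r" if "y \<in> P" for y t
    using mem_PiCD[OF that[unfolded P_def]] by auto
  have Pcont: "continuous_on A (\<lambda>s. f (apply_bcontfun y s))" if "y \<in> P" for y A
    using fcont by (rule continuous_on_compose2) (use Pmem[OF that] in auto)
  define cl where "cl t = max 0 (min \<delta> t)" for t :: real
  have cl: "cl t \<in> {0..\<delta>}" "\<And>t. t \<in> {0..\<delta>} \<Longrightarrow> cl t = t" for t using \<delta> by (auto simp: cl_def)
  define \<Psi> where "\<Psi> y t = x0 + integral {0..cl t} (\<lambda>s. f (apply_bcontfun y s))" for y :: "real \<Rightarrow>\<^sub>C 'b" and t
  have \<Psi>in: "\<Psi> y t \<in> cball x0 r" if "y \<in> P" for y t
  proof -
    have "norm (integral {0..cl t} (\<lambda>s. f (apply_bcontfun y s))) \<le> K * (cl t - 0)"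
      using cl(1)[of t] Pcont[OF that] K Pmem[OF that] by (intro integral_bound) auto
    also have "\<dots> \<le> K * \<delta>" using cl(1)[of t] K0 by (intro mult_left_mono) auto
    finally show ?thesis using \<delta>K by (simp add: \<Psi>_def dist_norm)
  qed
  have \<Psi>b: "\<Psi> y \<in> bcontfun" if "y \<in> P" for y
  proof -
    have "continuous_on {0..\<delta>} (\<lambda>u. integral {0..u} (\<lambda>s. f (apply_bcontfun y s)))"
      using integrable_continuous_real[OF Pcont[OF that]] by (intro indefinite_integral_continuous_1)
    then have "continuous_on UNIV (\<lambda>t. integral {0..cl t} (\<lambda>s. f (apply_bcontfun y s)))"
      by (rule continuous_on_compose2) (use cl in \<open>auto simp: cl_def intro!: continuous_intros\<close>)
    then have "continuous_on UNIV (\<Psi> y)" unfolding \<Psi>_def by (intro continuous_intros)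
    moreover have "bounded (range (\<Psi> y))"
      using \<Psi>in[OF that] by (intro bounded_subset[OF bounded_cball[of x0 r]]) auto
    ultimately show ?thesis by (simp add: bcontfun_def)
  qed
  define \<Phi> where "\<Phi> y = Bcontfun (\<Psi> y)" for y
  have \<Phi>: "apply_bcontfun (\<Phi> y) = \<Psi> y" if "y \<in> P" for y
    using \<Psi>b[OF that] by (simp add: \<Phi>_def Bcontfun_inverse)
  have "\<exists>!y\<in>P. \<Phi> y = y"
  proof (rule Banach_fix[where c = "1/2"])
    show "complete P" unfolding P_def
      by (intro closed_PiC[THEN complete_eq_closed[THEN iffD2]]) auto
    have "const_bcontfun x0 \<in> P"
      unfolding P_def by (rule mem_PiCI) (use rL in \<open>auto simp: const_bcontfun.rep_eq\<close>)
    then show "P \<noteq> {}" by blast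
    show "\<Phi> ` P \<subseteq> P"
    proof
      fix z assume "z \<in> \<Phi> ` P"
      then obtain y where y: "y \<in> P" "z = \<Phi> y" by blast
      then have "apply_bcontfun z \<in> Pi UNIV (\<lambda>_. cball x0 r)" using \<Psi>in \<Phi> by auto
      then show "z \<in> P" unfolding P_def by (rule mem_PiCI)
    qed
    show "dist (\<Phi> y) (\<Phi> z) \<le> 1 / 2 * dist y z" if yz: "y \<in> P" "z \<in> P" for y z
    proof (rule dist_bound)
      fix t
      have "dist (\<Psi> y t) (\<Psi> z t)
        = norm (integral {0..cl t} (\<lambda>s. f (apply_bcontfun y s) - f (apply_bcontfun z s)))"
        using yz by (simp add: \<Psi>_def dist_norm integral_diff integrable_continuous_real Pcont)
      also have "\<dots> \<le> (L * dist y z) * (cl t - 0)"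
      proof (rule integral_bound)
        show "\<And>s. s \<in> {0..cl t} \<Longrightarrow> norm (f (apply_bcontfun y s) - f (apply_bcontfun z s)) \<le> L * dist y z"
          using order_trans[OF lipschitz_onD[OF rL(4) Pmem[OF yz(1)] Pmem[OF yz(2)]]
              mult_left_mono[OF dist_bounded[of y _ z] rL(2)]]
          by (simp add: dist_norm)
      qed (use cl(1)[of t] yz Pcont in \<open>auto intro!: continuous_intros\<close>)
      also have "\<dots> \<le> (L * dist y z) * \<delta>"
        using cl(1)[of t] rL by (intro mult_left_mono) auto
      also have "\<dots> \<le> 1 / 2 * dist y z"
        using mult_right_mono[OF \<delta>L, of "dist y z"] by (simp add: ac_simps)
      finally show "dist (apply_bcontfun (\<Phi> y) t) (apply_bcontfun (\<Phi> z) t) \<le> 1 / 2 * dist y z"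
        using yz by (simp add: \<Phi>)
    qed
  qed auto
  then obtain y where y: "y \<in> P" "\<Phi> y = y" by blast
  have yeq: "apply_bcontfun y t = x0 + integral {0..t} (\<lambda>s. f (apply_bcontfun y s))" if "t \<in> {0..\<delta>}" for t
    using fun_cong[OF \<Phi>[OF y(1)], of t] unfolding y(2) \<Psi>_def cl(2)[OF that] .
  show thesis
  proof (rule that[of \<delta> "apply_bcontfun y"])
    show "apply_bcontfun y 0 = x0" using yeq[of 0] \<delta> by simp
    show "apply_bcontfun y t \<in> S" for t using Pmem[OF y(1)] rL(3) by blast
    fix t assume t: "t \<in> {0..\<delta>}"
    have "((\<lambda>t. x0 + integral {0..t} (\<lambda>s. f (apply_bcontfun y s))) has_vector_derivative
        (0 + f (apply_bcontfun y t))) (at t within {0..\<delta>})"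
      by (intro has_vector_derivative_add has_vector_derivative_const
          integral_has_vector_derivative Pcont y t)
    then show "(apply_bcontfun y has_vector_derivative f (apply_bcontfun y t)) (at t within {0..\<delta>})"
      using t yeq by (auto intro: has_vector_derivative_transform[of t "{0..\<delta>}"])
  qed (rule \<delta>)
qed

section \<open>Growth controlled by a primarily complete function\<close>

lemma locally_Lipschitz_imp_continuous_on:
  assumes "\<And>x. x \<in> S \<Longrightarrow> \<exists>\<delta>>0. \<exists>L. L-lipschitz_on (cball x \<delta> \<inter> S) f"
  shows "continuous_on S f"
  unfolding continuous_on_eq_continuous_within
proof
  fix x assume x: "x \<in> S"
  then obtain \<delta> L where d: "\<delta> > 0" "L-lipschitz_on (cball x \<delta> \<inter> S) f" using assms by blast
  then have "continuous (at x within cball x \<delta> \<inter> S) f"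
    using lipschitz_on_continuous_on x continuous_on_eq_continuous_within
    by (metis IntI centre_in_cball less_imp_le)
  moreover have "at x within cball x \<delta> \<inter> S = at x within S"
    using d(1) by (intro at_within_nhd[of _ "ball x \<delta>"]) auto
  ultimately show "continuous (at x within S) f" by simp
qed

text \<open>
  Here \<open>u x = \<rho> + integral {s..x} g\<close> satisfies \<open>u' = g \<le> \<alpha> (u x)\<close>, so a primitive \<open>\<Theta>\<close> of
  \<open>1 / \<alpha>\<close> increases along \<open>u\<close> by at most \<open>t - s \<le> \<tau>\<close>. As \<open>\<Theta>\<close> tends to infinity, this bounds \<open>u\<close>
  by a number that depends only on \<open>\<alpha>\<close>, \<open>\<rho>\<close> and \<open>\<tau>\<close>.
\<close>
lemma primarily_complete_bound:
  fixes \<tau> :: real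
  assumes \<alpha>: "primarily_complete \<alpha>" and \<rho>: "0 \<le> \<rho>"
  obtains R where "\<And>s t g. \<lbrakk>s \<le> t; t \<le> s + \<tau>; continuous_on {s..t} g;
      \<And>x. x \<in> {s..t} \<Longrightarrow> 0 \<le> g x; \<And>x. x \<in> {s..t} \<Longrightarrow> g x \<le> \<alpha> (\<rho> + integral {s..x} g)\<rbrakk>
    \<Longrightarrow> \<rho> + integral {s..t} g \<le> R"
proof -
  have pos: "\<And>x. x \<ge> 0 \<Longrightarrow> 0 < \<alpha> x"
    and lim: "filterlim (\<lambda>R. integral {0..R} (\<lambda>x. 1 / \<alpha> x)) at_top at_top"
    using \<alpha> by (auto simp: primarily_complete_def)
  have "continuous_on {0..} \<alpha>"
    using \<alpha> unfolding primarily_complete_def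
    by (intro locally_Lipschitz_imp_continuous_on) auto
  then have cont: "continuous_on {0..} (\<lambda>x. 1 / \<alpha> x)"
    using pos by (intro continuous_intros) (auto simp: less_imp_neq[OF pos, symmetric])
  define \<Theta> where "\<Theta> R = integral {0..R} (\<lambda>x. 1 / \<alpha> x)" for R
  \<comment> \<open>Beyond \<open>N\<close> the primitive exceeds every value that it can attain along \<open>u\<close>.\<close>
  obtain N where N: "\<And>R. R \<ge> N \<Longrightarrow> \<Theta> R > \<Theta> \<rho> + \<tau>"
    using lim unfolding filterlim_at_top_dense eventually_at_top_linorder \<Theta>_def by blast
  show thesis
  proof (rule that[of N])
    fix s t :: real and g
    assume st: "s \<le> t" "t \<le> s + \<tau>" and gc: "continuous_on {s..t} g"
      and g0: "\<And>x. x \<in> {s..t} \<Longrightarrow> 0 \<le> g x"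
      and g\<alpha>: "\<And>x. x \<in> {s..t} \<Longrightarrow> g x \<le> \<alpha> (\<rho> + integral {s..x} g)"
    define u where "u x = \<rho> + integral {s..x} g" for x
    have gi: "g integrable_on {s..x}" if "x \<in> {s..t}" for x
      using gc that by (intro integrable_continuous_real) (auto elim: continuous_on_subset)
    have u: "0 \<le> u x" "u x \<le> u t" if x: "x \<in> {s..t}" for x
    proof -
      show "0 \<le> u x" unfolding u_def using \<rho> x g0 gi[OF x]
        by (intro add_nonneg_nonneg integral_nonneg) auto
      have "integral {s..x} g \<le> integral {s..t} g"
        using x g0 gi[OF x] gi[of t] st by (intro integral_subset_le) auto
      then show "u x \<le> u t" by (simp add: u_def)
    qed
    have du: "(u has_real_derivative g x) (at x within {s..t})" if "x \<in> {s..t}" for x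
      unfolding u_def by (auto intro!: derivative_eq_intros integral_has_real_derivative gc that)
    have dA: "(\<Theta> has_real_derivative 1 / \<alpha> y) (at y within {0..u t})" if "y \<in> {0..u t}" for y
      unfolding \<Theta>_def using cont that
      by (intro integral_has_real_derivative) (auto elim: continuous_on_subset)
    have dAu: "((\<lambda>x. x - \<Theta> (u x)) has_real_derivative (1 - 1 / \<alpha> (u x) * g x)) (at x within {s..t})"
      if x: "x \<in> {s..t}" for x
    proof -
      have "(\<Theta> has_real_derivative 1 / \<alpha> (u x)) (at (u x) within u ` {s..t})"
        by (rule DERIV_subset[OF dA]) (use u x in auto)
      from DERIV_image_chain[OF this du[OF x]] show ?thesis
        by (auto intro!: derivative_eq_intros simp: o_def)
    qed
    have "s - \<Theta> (u s) \<le> t - \<Theta> (u t)"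
    proof (rule DERIV_nonneg_imp_increasing_open[OF st(1)])
      show "continuous_on {s..t} (\<lambda>x. x - \<Theta> (u x))"
        by (rule DERIV_continuous_on) (rule dAu)
      fix x assume x: "s < x" "x < t"
      then have "g x \<le> \<alpha> (u x)" using g\<alpha>[of x] by (simp add: u_def)
      then have "0 \<le> 1 - 1 / \<alpha> (u x) * g x"
        using pos[OF u(1)[of x]] x by (simp add: field_simps)
      then show "\<exists>y. ((\<lambda>x. x - \<Theta> (u x)) has_real_derivative y) (at x) \<and> 0 \<le> y"
        using dAu[of x] x by (auto simp: at_within_Icc_at)
    qed
    then have "\<Theta> (u t) \<le> \<Theta> \<rho> + \<tau>" using st by (simp add: u_def)
    then show "\<rho> + integral {s..t} g \<le> N" using N[of "u t"] by (fold u_def) linarith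
  qed
qed

section \<open>Limits along subsets of the real line\<close>

text \<open>
  Phrased through the filter \<open>at t within J\<close>, continuity of a curve can be combined with
  derivatives within \<open>J\<close>, and both can be restricted and glued in the same way.
\<close>
lemma continuous_map_iff_limitin_at_within:
  "continuous_map (top_of_set J) T \<gamma> \<longleftrightarrow> (\<forall>t\<in>J. limitin T \<gamma> (\<gamma> t) (at t within J))"
proof -
  have "atin (top_of_set J) t = at t within J" if t: "t \<in> J" for t
    unfolding filter_eq_iff atin_subtopology_within[OF t] eventually_atin_within eventually_at_topological
  proof
    fix P
    have "(\<forall>x\<in>U. x \<in> J \<and> x \<noteq> t \<longrightarrow> P x) = (\<forall>x\<in>U. x \<noteq> t \<longrightarrow> x \<in> J \<longrightarrow> P x)" for U by blast
    then show "(t \<notin> topspace euclidean \<or> (\<exists>U. openin euclidean U \<and> t \<in> U \<and> (\<forall>x\<in>U. x \<in> J \<and> x \<noteq> t \<longrightarrow> P x)))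
      = (\<exists>S. open S \<and> t \<in> S \<and> (\<forall>x\<in>S. x \<noteq> t \<longrightarrow> x \<in> J \<longrightarrow> P x))"
      by (simp only: open_openin topspace_euclidean UNIV_I not_True_eq_False simp_thms)
  qed
  then show ?thesis by (simp add: continuous_map_atin)
qed

lemma limitin_eventually_in:
  "limitin T f l F \<Longrightarrow> openin T U \<Longrightarrow> l \<in> U \<Longrightarrow> eventually (\<lambda>x. f x \<in> U) F"
  by (simp add: limitin_def)

lemma at_within_interval_nontrivial:
  fixes J :: "real set"
  assumes "is_interval J" "interior J \<noteq> {}" "t \<in> J"
  shows "at t within J \<noteq> bot"
proof -
  have "J \<noteq> {x}" for x using assms(2) by auto
  then have "t islimpt J"
    using assms is_interval_connected connected_imp_perfect by metis
  then show ?thesis by (simp add: trivial_limit_within)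
qed

lemma at_within_Icc_nontrivial: "(a::real) < b \<Longrightarrow> t \<in> {a..b} \<Longrightarrow> at t within {a..b} \<noteq> bot"
  by (rule at_within_interval_nontrivial) auto

lemma limitin_mono: "limitin T f l G \<Longrightarrow> H \<le> G \<Longrightarrow> limitin T f l H"
  unfolding limitin_def by (blast intro: filter_leD)

lemma limitin_within_Un:
  assumes "limitin T f l (at t within J)" "limitin T f l (at t within K)"
  shows "limitin T f l (at t within J \<union> K)"
  unfolding limitin_def
proof (intro conjI allI impI)
  show "l \<in> topspace T" using assms(1) by (simp add: limitin_def)
  fix U assume U: "openin T U \<and> l \<in> U"
  from limitin_eventually_in[OF assms(1)] limitin_eventually_in[OF assms(2)] U
  have "eventually (\<lambda>x. f x \<in> U) (at t within J)" "eventually (\<lambda>x. f x \<in> U) (at t within K)" by auto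
  then show "eventually (\<lambda>x. f x \<in> U) (at t within J \<union> K)"
    unfolding eventually_at_filter by eventually_elim auto
qed

lemma has_vector_derivative_within_Un:
  assumes "(f has_vector_derivative v) (at t within J)" "(f has_vector_derivative v) (at t within K)"
  shows "(f has_vector_derivative v) (at t within J \<union> K)"
  using assms unfolding has_vector_derivative_def has_derivative_within
  by (simp only: Lim_within_Un simp_thms)

text \<open>
  A Finsler metric varies continuously in the sense of ratios of norms; this turns such ratio bounds
  into an ordinary limit.
\<close>
lemma tendsto_of_ratio_bounds:
  fixes g h :: "'a \<Rightarrow> real"
  assumes h: "(h \<longlongrightarrow> n) Fl"
    and ev: "\<And>\<epsilon>. 0 < \<epsilon> \<Longrightarrow> \<epsilon> < 1 \<Longrightarrow> eventually (\<lambda>t. \<epsilon> * h t \<le> g t \<and> \<epsilon> * g t \<le> h t) Fl"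
  shows "(g \<longlongrightarrow> n) Fl"
proof (rule order_tendstoI)
  \<comment> \<open>A ratio sufficiently close to one has any property that holds in the limit.\<close>
  have pick: "\<exists>\<epsilon>. 0 < \<epsilon> \<and> \<epsilon> < 1 \<and> P \<epsilon>" if "eventually P (at_left 1)" for P :: "real \<Rightarrow> bool"
  proof -
    have "eventually (\<lambda>\<epsilon>::real. \<epsilon> \<in> {0<..<1}) (at_left 1)"
      by (rule eventually_at_left_real) simp
    with that have "eventually (\<lambda>\<epsilon>. \<epsilon> \<in> {0<..<1} \<and> P \<epsilon>) (at_left 1)"
      by eventually_elim simp
    from eventually_happens'[OF trivial_limit_at_left_real this] show ?thesis by simp
  qed
  have lim: "((\<lambda>\<epsilon>. \<epsilon> * y) \<longlongrightarrow> 1 * y) (at_left 1)" for y :: real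
    by (intro tendsto_intros)
  fix a
  {
    assume "a < n"
    then have "eventually (\<lambda>\<epsilon>. a < \<epsilon> * n) (at_left 1)"
      using order_tendstoD(1)[OF lim[of n]] by simp
    then obtain \<epsilon> where e: "0 < \<epsilon>" "\<epsilon> < 1" "a < \<epsilon> * n" using pick by blast
    have "((\<lambda>t. \<epsilon> * h t) \<longlongrightarrow> \<epsilon> * n) Fl" by (intro tendsto_intros h)
    from order_tendstoD(1)[OF this e(3)] ev[OF e(1,2)]
    show "eventually (\<lambda>t. a < g t) Fl" by eventually_elim linarith
  next
    assume "n < a"
    then have "eventually (\<lambda>\<epsilon>. n < \<epsilon> * a) (at_left 1)"
      using order_tendstoD(1)[OF lim[of a]] by simp
    then obtain \<epsilon> where e: "0 < \<epsilon>" "\<epsilon> < 1" "n < \<epsilon> * a" using pick by blast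
    from order_tendstoD(2)[OF h e(3)] ev[OF e(1,2)]
    show "eventually (\<lambda>t. g t < a) Fl"
    proof eventually_elim
      case (elim t)
      then have "\<epsilon> * g t < \<epsilon> * a" by linarith
      then show ?case using e(1) by simp
    qed
  }
qed

section \<open>Charts, transition maps and tangent vectors\<close>

lemma is_chart_homeo:
  assumes "is_chart T c"
  shows "inj_on (snd c) (fst c)"
    and "continuous_map (subtopology T (fst c)) euclidean (snd c)"
    and "continuous_map (top_of_set (snd c ` fst c)) T (chart_inv c)"
    and "\<And>U. openin T U \<Longrightarrow> U \<subseteq> fst c \<Longrightarrow> open (snd c ` U)"
proof -
  let ?X = "subtopology T (fst c)" and ?Y = "top_of_set (snd c ` fst c)"
  note o = assms[unfolded is_chart_def, THEN conjunct1]
    assms[unfolded is_chart_def, THEN conjunct2, THEN conjunct1]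
  note h = assms[unfolded is_chart_def, THEN conjunct2, THEN conjunct2]
  have top: "topspace ?X = fst c" using o(1) openin_subset by auto
  show inj: "inj_on (snd c) (fst c)"
    using homeomorphic_imp_injective_map[OF h] unfolding top .
  have "continuous_map ?X ?Y (snd c)" by (rule homeomorphic_imp_continuous_map[OF h])
  then show "continuous_map ?X euclidean (snd c)" by (rule continuous_map_into_fulltopology)
  obtain g where g: "homeomorphic_maps ?X ?Y (snd c) g"
    using h homeomorphic_map_maps by blast
  have "continuous_map ?Y T g"
    using g unfolding homeomorphic_maps_def by (blast intro: continuous_map_into_fulltopology)
  moreover have "g x = chart_inv c x" if "x \<in> topspace ?Y" for x
    using g that inj top unfolding homeomorphic_maps_def chart_inv_def
    by (auto simp: inv_into_f_f)
  ultimately show "continuous_map ?Y T (chart_inv c)"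
    using continuous_map_eq by blast
  show "open (snd c ` U)" if "openin T U" "U \<subseteq> fst c" for U
  proof -
    have "openin ?X U" using that by (metis inf.absorb_iff2 openin_subtopology_Int2)
    then have "openin ?Y (snd c ` U)"
      using homeomorphic_imp_open_map[OF h] unfolding open_map_def by blast
    then show ?thesis using o(2) openin_open_trans by blast
  qed
qed

lemma chart_inv_left [simp]: "is_chart T c \<Longrightarrow> p \<in> fst c \<Longrightarrow> chart_inv c (snd c p) = p"
  unfolding chart_inv_def by (simp add: inv_into_f_f is_chart_homeo(1))

lemma chart_inv_right: "x \<in> snd c ` fst c \<Longrightarrow> snd c (chart_inv c x) = x"
  and chart_inv_in: "x \<in> snd c ` fst c \<Longrightarrow> chart_inv c x \<in> fst c"
  unfolding chart_inv_def by (simp_all add: f_inv_into_f inv_into_into)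

lemma chart_vimage_open:
  assumes "is_chart T c" "open W"
  shows "openin T {p \<in> fst c. snd c p \<in> W}"
proof -
  have o: "openin T (fst c)" using assms by (auto simp: is_chart_def)
  have "openin (subtopology T (fst c)) {p \<in> topspace (subtopology T (fst c)). snd c p \<in> W}"
    by (rule openin_continuous_map_preimage[OF is_chart_homeo(2)[OF assms(1)]]) (use assms in simp)
  moreover have "topspace (subtopology T (fst c)) = fst c" using o openin_subset by auto
  ultimately show ?thesis using openin_trans_full[OF _ o] by metis
qed

definition transition_deriv :: "('m, 'b::real_normed_vector) chart \<Rightarrow> ('m, 'b) chart \<Rightarrow> 'm \<Rightarrow> 'b \<Rightarrow> 'b" where
  "transition_deriv c c' p = frechet_derivative (transition c c') (at (snd c p))"

locale banach_mfd =
  fixes T :: "'m topology" and A :: "('m, 'b::banach) chart set"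
  assumes mfd: "banach_manifold T A"
begin

lemma charts_is_chart: "c \<in> charts T A \<Longrightarrow> is_chart T c"
  by (simp add: charts_def)

lemma charts_openin: "c \<in> charts T A \<Longrightarrow> openin T (fst c)"
  by (simp add: charts_def is_chart_def)

lemma charts_open: "c \<in> charts T A \<Longrightarrow> open (snd c ` fst c)"
  by (simp add: charts_def is_chart_def)

lemma charts_atD:
  assumes "c \<in> charts_at T A p"
  shows "c \<in> charts T A" "p \<in> fst c" "is_chart T c" "p \<in> topspace T"
proof -
  show c: "c \<in> charts T A" "p \<in> fst c" using assms by (simp_all add: charts_at_def)
  show "is_chart T c" by (rule charts_is_chart[OF c(1)])
  show "p \<in> topspace T" using openin_subset[OF charts_openin[OF c(1)]] c(2) by blast
qed

lemma charts_at_nonempty: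
  assumes "p \<in> topspace T" obtains c where "c \<in> charts_at T A p"
proof -
  obtain c where "c \<in> A" "p \<in> fst c" using assms mfd unfolding banach_manifold_def by blast
  then have "c \<in> charts_at T A p"
    using mfd unfolding banach_manifold_def charts_at_def charts_def by blast
  then show thesis by (rule that)
qed

text \<open>
  Two charts of the maximal atlas are compared with a chart of the given atlas near each point: on
  a small set the transition map is a composition of two maps that are \<open>C\<^sup>1\<close> by definition.
\<close>
lemma transition_C1_on:
  assumes c: "c \<in> charts T A" and c': "c' \<in> charts T A"
  shows "C1_on (transition c c') (snd c ` (fst c \<inter> fst c'))"
proof (rule C1_on_locally)
  fix x assume "x \<in> snd c ` (fst c \<inter> fst c')"
  then obtain p where p: "p \<in> fst c" "p \<in> fst c'" "x = snd c p" by blast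
  have "p \<in> topspace T" using p(1) charts_openin[OF c] openin_subset by blast
  then obtain a where a: "a \<in> A" "p \<in> fst a" "is_chart T a"
    using mfd unfolding banach_manifold_def by blast
  define W where "W = fst c \<inter> fst c' \<inter> fst a"
  have oW: "openin T W" unfolding W_def using charts_openin[OF c] charts_openin[OF c'] a(3)
    unfolding is_chart_def by blast
  have o: "open (snd c ` W)"
    using is_chart_homeo(4)[OF charts_is_chart[OF c] oW] by (auto simp: W_def)
  have "C1_on (transition c a) (snd c ` (fst c \<inter> fst a))"
    using c a(1) C2_on_imp_C1_on unfolding charts_def C2_compatible_def by blast
  then have 1: "C1_on (transition c a) (snd c ` W)"
    by (rule C1_on_subset) (auto simp: W_def)
  have 2: "C1_on (transition a c') (snd a ` (fst c' \<inter> fst a))"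
    using c' a(1) C2_on_imp_C1_on unfolding charts_def C2_compatible_def
    by (auto simp: Int_commute)
  have "C1_on (transition a c' \<circ> transition c a) (snd c ` W)"
    by (rule C1_on_compose[OF 1 2])
      (auto simp: W_def transition_def charts_is_chart[OF c, THEN chart_inv_left])
  then have "C1_on (transition c c') (snd c ` W)"
    by (rule C1_on_cong_open[OF _ o])
      (auto simp: W_def transition_def charts_is_chart[OF c, THEN chart_inv_left] a(3)[THEN chart_inv_left])
  then show "\<exists>U. open U \<and> x \<in> U \<and> C1_on (transition c c') U"
    using o p a(2) by (auto simp: W_def)
qed

lemma transition_has_derivative:
  assumes "c \<in> charts_at T A p" "c' \<in> charts_at T A p"
  shows "(transition c c' has_derivative transition_deriv c c' p) (at (snd c p))"
  unfolding transition_deriv_def using assms charts_atD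
  by (intro C1_on_imp_has_derivative[OF transition_C1_on]) blast+

lemma bounded_linear_transition_deriv:
  "c \<in> charts_at T A p \<Longrightarrow> c' \<in> charts_at T A p \<Longrightarrow> bounded_linear (transition_deriv c c' p)"
  using transition_has_derivative has_derivative_bounded_linear by blast

lemma linear_transition_deriv:
  "c \<in> charts_at T A p \<Longrightarrow> c' \<in> charts_at T A p \<Longrightarrow> linear (transition_deriv c c' p)"
  using bounded_linear_transition_deriv bounded_linear.linear by blast

text \<open>
  The chain rule for transition maps. It makes a single chart sufficient to describe tangent
  vectors.
\<close>
lemma transition_deriv_compose:
  assumes c: "c \<in> charts_at T A p" and c': "c' \<in> charts_at T A p" and c'': "c'' \<in> charts_at T A p"
  shows "transition_deriv c' c'' p (transition_deriv c c' p u) = transition_deriv c c'' p u"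
proof -
  note cc = charts_atD[OF c] and cc' = charts_atD[OF c'] and cc'' = charts_atD[OF c'']
  define W where "W = fst c \<inter> fst c'"
  have oW: "openin T W" unfolding W_def using cc cc' charts_openin by blast
  have "snd c' p = transition c c' (snd c p)"
    using cc by (simp add: transition_def)
  then have "(transition c' c'' \<circ> transition c c' has_derivative transition_deriv c' c'' p \<circ> transition_deriv c c' p) (at (snd c p))"
    using transition_has_derivative[OF c c'] transition_has_derivative[OF c' c'']
    by (intro diff_chain_at) auto
  then have "(transition c c'' has_derivative transition_deriv c' c'' p \<circ> transition_deriv c c' p) (at (snd c p))"
  proof (rule has_derivative_transform_within_open)
    show "open (snd c ` W)"
      using is_chart_homeo(4)[OF cc(3) oW] by (simp add: W_def)
  qed (use cc cc' in \<open>auto simp: W_def transition_def chart_inv_left[OF cc(3)] chart_inv_left[OF cc'(3)]\<close>)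
  from has_derivative_unique[OF this transition_has_derivative[OF c c'']]
  show ?thesis by (simp add: fun_eq_iff)
qed

lemma transition_deriv_refl:
  assumes c: "c \<in> charts_at T A p"
  shows "transition_deriv c c p u = u"
proof -
  note cc = charts_atD[OF c]
  have "((\<lambda>x. x) has_derivative (\<lambda>u. u)) (at (snd c p))" by (rule has_derivative_ident)
  then have "(transition c c has_derivative (\<lambda>u. u)) (at (snd c p))"
    by (rule has_derivative_transform_within_open[OF _ charts_open[OF cc(1)]])
      (use cc in \<open>auto simp: transition_def chart_inv_left[OF cc(3)]\<close>)
  from has_derivative_unique[OF this transition_has_derivative[OF c c]]
  show ?thesis by (simp add: fun_eq_iff)
qed

lemma tangent_spaceD:
  "v \<in> tangent_space T A p \<Longrightarrow> c \<in> charts_at T A p \<Longrightarrow> c' \<in> charts_at T A p \<Longrightarrow> v c' = transition_deriv c c' p (v c)"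
  unfolding tangent_space_def transition_deriv_def by blast

lemma tangent_space_off: "v \<in> tangent_space T A p \<Longrightarrow> c \<notin> charts_at T A p \<Longrightarrow> v c = 0"
  unfolding tangent_space_def by blast

lemma tangent_of_chart_eq:
  "tangent_of_chart T A c p u = (\<lambda>c'. if c' \<in> charts_at T A p then transition_deriv c c' p u else 0)"
  unfolding tangent_of_chart_def transition_deriv_def ..

lemma tangent_of_chart_in:
  "c \<in> charts_at T A p \<Longrightarrow> tangent_of_chart T A c p u \<in> tangent_space T A p"
  unfolding tangent_space_def
  by (auto simp: tangent_of_chart_eq transition_deriv_def[symmetric] transition_deriv_compose)

text \<open>
  The compatibility of the representatives in different charts leaves only the one in \<open>c\<close> free.
\<close>
lemma tangent_of_chart_rep:
  assumes "v \<in> tangent_space T A p" "c \<in> charts_at T A p"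
  shows "tangent_of_chart T A c p (v c) = v"
proof
  fix c'
  show "tangent_of_chart T A c p (v c) c' = v c'"
  proof (cases "c' \<in> charts_at T A p")
    case True
    then show ?thesis
      using tangent_spaceD[OF assms True] by (simp only: tangent_of_chart_eq if_True)
  next
    case False
    then have "v c' = 0" by (rule tangent_space_off[OF assms(1)])
    then show ?thesis using False by (simp only: tangent_of_chart_eq if_False)
  qed
qed

lemma tangent_of_chart_add:
  assumes "c \<in> charts_at T A p"
  shows "tangent_of_chart T A c p (u + w) = (\<lambda>c'. tangent_of_chart T A c p u c' + tangent_of_chart T A c p w c')"
  unfolding tangent_of_chart_eq by (rule ext) (simp add: assms linear_add[OF linear_transition_deriv])

lemma tangent_of_chart_scale:
  assumes "c \<in> charts_at T A p"
  shows "tangent_of_chart T A c p (r *\<^sub>R u) = (\<lambda>c'. r *\<^sub>R tangent_of_chart T A c p u c')"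
  unfolding tangent_of_chart_eq by (rule ext) (simp add: assms linear_scale[OF linear_transition_deriv])

lemma tangent_space_scale:
  assumes "v \<in> tangent_space T A p"
  shows "(\<lambda>c. r *\<^sub>R v c) \<in> tangent_space T A p"
proof (cases "p \<in> topspace T")
  case True
  then obtain c where c: "c \<in> charts_at T A p" by (rule charts_at_nonempty)
  show ?thesis
    using tangent_of_chart_in[OF c, of "r *\<^sub>R v c"]
    by (simp add: tangent_of_chart_scale[OF c] tangent_of_chart_rep[OF assms c])
next
  case False
  then have "charts_at T A p = {}" using charts_atD(4) by blast
  then show ?thesis using assms by (simp add: tangent_space_def)
qed

lemma limitin_chart_inv:
  assumes c: "c \<in> charts T A" and f: "(f \<longlongrightarrow> x) Fl" and x: "x \<in> snd c ` fst c"
  shows "limitin T (\<lambda>s. chart_inv c (f s)) (chart_inv c x) Fl"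
  unfolding limitin_def
proof (intro conjI allI impI)
  note cc = charts_is_chart[OF c]
  show "chart_inv c x \<in> topspace T"
    using chart_inv_in[OF x] openin_subset[OF charts_openin[OF c]] by blast
  fix U assume U: "openin T U \<and> chart_inv c x \<in> U"
  let ?W = "snd c ` (U \<inter> fst c)"
  have "open ?W" using is_chart_homeo(4)[OF cc, of "U \<inter> fst c"] U charts_openin[OF c] by blast
  moreover have "x \<in> ?W"
    using chart_inv_right[OF x] chart_inv_in[OF x] U by (metis IntI imageI)
  ultimately have "eventually (\<lambda>s. f s \<in> ?W) Fl" using f topological_tendstoD by blast
  then show "eventually (\<lambda>s. chart_inv c (f s) \<in> U) Fl"
    by eventually_elim (auto simp: chart_inv_left[OF cc])
qed

section \<open>Curves and their velocities\<close>

text \<open>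
  Near \<open>t\<close> the curve stays in the domain of \<open>c\<close>, where its representative in \<open>c'\<close> is the transition
  map applied to its representative in \<open>c\<close>. Derivatives of curves hence need to be known in one chart
  only.
\<close>
lemma has_vector_derivative_chart_change:
  assumes lim: "limitin T \<gamma> (\<gamma> t) (at t within J)" and t: "t \<in> J"
    and c: "c \<in> charts_at T A (\<gamma> t)" and c': "c' \<in> charts_at T A (\<gamma> t)"
    and d: "((\<lambda>s. snd c (\<gamma> s)) has_vector_derivative v) (at t within J)"
  shows "((\<lambda>s. snd c' (\<gamma> s)) has_vector_derivative transition_deriv c c' (\<gamma> t) v) (at t within J)"
proof -
  note cc = charts_atD[OF c] and cc' = charts_atD[OF c']
  have lin: "linear (transition_deriv c c' (\<gamma> t))"
    by (rule linear_transition_deriv[OF c c'])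
  have "(transition c c' \<circ> (\<lambda>s. snd c (\<gamma> s)) has_derivative transition_deriv c c' (\<gamma> t) \<circ> (\<lambda>h. h *\<^sub>R v)) (at t within J)"
    using d transition_has_derivative[OF c c'] unfolding has_vector_derivative_def
    by (intro diff_chain_within) (auto intro: has_derivative_at_withinI)
  then have "((\<lambda>s. snd c' (\<gamma> s)) has_derivative transition_deriv c c' (\<gamma> t) \<circ> (\<lambda>h. h *\<^sub>R v)) (at t within J)"
  proof (rule has_derivative_transform_eventually)
    have "eventually (\<lambda>s. \<gamma> s \<in> fst c) (at t within J)"
      using limitin_eventually_in[OF lim charts_openin[OF cc(1)] cc(2)] .
    then show "eventually (\<lambda>s. (transition c c' \<circ> (\<lambda>s. snd c (\<gamma> s))) s = snd c' (\<gamma> s)) (at t within J)"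
      by eventually_elim (simp add: transition_def chart_inv_left[OF cc(3)])
  qed (use cc t in \<open>auto simp: transition_def chart_inv_left[OF cc(3)]\<close>)
  moreover have "transition_deriv c c' (\<gamma> t) \<circ> (\<lambda>h. h *\<^sub>R v) = (\<lambda>h. h *\<^sub>R transition_deriv c c' (\<gamma> t) v)"
    by (auto simp: fun_eq_iff linear_scale[OF lin])
  ultimately show ?thesis unfolding has_vector_derivative_def by simp
qed

lemma C1_curve_limitin: "C1_curve T A J \<gamma> \<Longrightarrow> t \<in> J \<Longrightarrow> limitin T \<gamma> (\<gamma> t) (at t within J)"
  by (simp add: C1_curve_def continuous_map_iff_limitin_at_within)

lemma C1_curve_in_topspace: "C1_curve T A J \<gamma> \<Longrightarrow> t \<in> J \<Longrightarrow> \<gamma> t \<in> topspace T"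
  using C1_curve_limitin by (auto simp: limitin_def)

text \<open>
  The compatibility of \<open>v\<close> with the transition maps carries the condition from \<open>c\<close> to all
  charts.
\<close>
lemma velocity_eqI:
  assumes "limitin T \<gamma> (\<gamma> t) (at t within J)" "t \<in> J" "at t within J \<noteq> bot"
    and c: "c \<in> charts_at T A (\<gamma> t)"
    and v: "v \<in> tangent_space T A (\<gamma> t)"
    and d: "((\<lambda>s. snd c (\<gamma> s)) has_vector_derivative v c) (at t within J)"
  shows "velocity T A J \<gamma> t = v"
proof
  fix c'
  show "velocity T A J \<gamma> t c' = v c'"
  proof (cases "c' \<in> charts_at T A (\<gamma> t)")
    case True
    have "((\<lambda>s. snd c' (\<gamma> s)) has_vector_derivative v c') (at t within J)"
      using has_vector_derivative_chart_change[OF assms(1,2) c True d] tangent_spaceD[OF v c True] by simp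
    then show ?thesis using True assms(3) by (simp add: velocity_def vector_derivative_within)
  next
    case False
    then show ?thesis using tangent_space_off[OF v False] by (simp add: velocity_def)
  qed
qed

lemma velocity_in_chart:
  assumes \<gamma>: "C1_curve T A J \<gamma>" and t: "t \<in> J" "at t within J \<noteq> bot"
    and c: "c \<in> charts_at T A (\<gamma> t)"
  shows "((\<lambda>s. snd c (\<gamma> s)) has_vector_derivative velocity T A J \<gamma> t c) (at t within J)"
proof -
  obtain D where "((\<lambda>s. snd c (\<gamma> s)) has_vector_derivative D) (at t within J)"
    using \<gamma> t charts_atD[OF c] unfolding C1_curve_def by blast
  then show ?thesis using c t(2) by (simp add: velocity_def vector_derivative_within)
qed

lemma velocity_in_tangent_space:
  assumes \<gamma>: "C1_curve T A J \<gamma>" and t: "t \<in> J" "at t within J \<noteq> bot"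
  shows "velocity T A J \<gamma> t \<in> tangent_space T A (\<gamma> t)"
proof -
  obtain c where c: "c \<in> charts_at T A (\<gamma> t)"
    using charts_at_nonempty[OF C1_curve_in_topspace[OF \<gamma> t(1)]] .
  let ?v = "tangent_of_chart T A c (\<gamma> t) (velocity T A J \<gamma> t c)"
  have "velocity T A J \<gamma> t = ?v"
    using velocity_in_chart[OF \<gamma> t c]
    by (intro velocity_eqI[OF C1_curve_limitin[OF \<gamma> t(1)] t c tangent_of_chart_in[OF c]])
       (simp add: tangent_of_chart_eq c transition_deriv_refl)
  then show ?thesis using tangent_of_chart_in[OF c] by metis
qed

lemma velocity_continuous_in_chart:
  assumes \<gamma>: "C1_curve T A J \<gamma>" and J: "\<And>t. t \<in> J \<Longrightarrow> at t within J \<noteq> bot"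
    and c: "c \<in> charts T A"
  shows "continuous_on (J \<inter> \<gamma> -` fst c) (\<lambda>t. velocity T A J \<gamma> t c)"
proof -
  obtain D where D: "\<And>t. t \<in> J \<inter> \<gamma> -` fst c \<Longrightarrow> ((\<lambda>s. snd c (\<gamma> s)) has_vector_derivative D t) (at t within J)"
    "continuous_on (J \<inter> \<gamma> -` fst c) D"
    using \<gamma> c unfolding C1_curve_def by blast
  have "velocity T A J \<gamma> t c = D t" if "t \<in> J \<inter> \<gamma> -` fst c" for t
    using that D(1)[OF that] J c by (simp add: velocity_def vector_derivative_within charts_at_def)
  then show ?thesis using continuous_on_eq[OF D(2)] by metis
qed

text \<open>
  In another chart the derivative is \<open>D\<close> transformed by the derivative of the transition map, which
  depends continuously on the base point.
\<close>
lemma C1_curve_in_chart: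
  assumes c: "c \<in> charts T A" and \<gamma>c: "\<And>t. t \<in> J \<Longrightarrow> \<gamma> t \<in> fst c"
    and lim: "\<And>t. t \<in> J \<Longrightarrow> limitin T \<gamma> (\<gamma> t) (at t within J)"
    and D: "\<And>t. t \<in> J \<Longrightarrow> ((\<lambda>s. snd c (\<gamma> s)) has_vector_derivative D t) (at t within J)"
    and Dc: "continuous_on J D"
  shows "C1_curve T A J \<gamma>"
  unfolding C1_curve_def
proof (intro conjI ballI)
  show "continuous_map (top_of_set J) T \<gamma>"
    using lim by (simp add: continuous_map_iff_limitin_at_within)
  fix c' assume c': "c' \<in> charts T A"
  let ?S = "snd c ` (fst c \<inter> fst c')"
  obtain f' where f': "\<And>x. x \<in> ?S \<Longrightarrow> (transition c c' has_derivative blinfun_apply (f' x)) (at x)"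
      "continuous_on ?S f'"
    using transition_C1_on[OF c c'] unfolding C1_on_def by blast
  have "transition_deriv c c' p = blinfun_apply (f' (snd c p))" if "p \<in> fst c" "p \<in> fst c'" for p
    unfolding transition_deriv_def using that by (intro frechet_derivative_at[symmetric] f'(1)) auto
  then have "((\<lambda>s. snd c' (\<gamma> s)) has_vector_derivative blinfun_apply (f' (snd c (\<gamma> t))) (D t)) (at t within J)"
    if "t \<in> J \<inter> \<gamma> -` fst c'" for t
    using has_vector_derivative_chart_change[OF lim _ _ _ D, of t c'] that c c' \<gamma>c
    by (auto simp: charts_at_def)
  moreover have "continuous_on J (\<lambda>s. snd c (\<gamma> s))"
    using D has_vector_derivative_continuous continuous_on_eq_continuous_within by blast
  then have "continuous_on (J \<inter> \<gamma> -` fst c') (\<lambda>t. blinfun_apply (f' (snd c (\<gamma> t))) (D t))"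
    using \<gamma>c Dc by (intro bounded_bilinear.continuous_on[OF bounded_bilinear_blinfun_apply]
        continuous_on_compose2[OF f'(2)]) (auto elim: continuous_on_subset)
  ultimately show "\<exists>D. (\<forall>t\<in>J \<inter> \<gamma> -` fst c'.
      ((\<lambda>s. snd c' (\<gamma> s)) has_vector_derivative D t) (at t within J)) \<and>
      continuous_on (J \<inter> \<gamma> -` fst c') D"
    by (intro exI[of _ "\<lambda>t. blinfun_apply (f' (snd c (\<gamma> t))) (D t)"]) blast
qed

text \<open>
  As \<open>K\<close> is only required to be mapped into \<open>J\<close>, this covers translations, reversals and
  restrictions to smaller sets.
\<close>
lemma C1_curve_affine:
  assumes \<gamma>: "C1_curve T A J \<gamma>" and K: "\<And>s. s \<in> K \<Longrightarrow> m * s + h \<in> J"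
  shows "C1_curve T A K (\<lambda>s. \<gamma> (m * s + h))"
  unfolding C1_curve_def
proof (intro conjI ballI)
  have a: "continuous_map (top_of_set K) (top_of_set J) (\<lambda>s. m * s + h)"
    using K by (auto intro!: continuous_intros)
  show "continuous_map (top_of_set K) T (\<lambda>s. \<gamma> (m * s + h))"
    using continuous_map_compose[OF a] \<gamma> unfolding C1_curve_def by (auto simp: o_def)
  fix c assume "c \<in> charts T A"
  then obtain D where D: "\<And>t. t \<in> J \<inter> \<gamma> -` fst c \<Longrightarrow> ((\<lambda>s. snd c (\<gamma> s)) has_vector_derivative D t) (at t within J)"
    "continuous_on (J \<inter> \<gamma> -` fst c) D"
    using \<gamma> unfolding C1_curve_def by blast
  let ?K = "K \<inter> (\<lambda>s. \<gamma> (m * s + h)) -` fst c"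
  have "((\<lambda>s. snd c (\<gamma> (m * s + h))) has_vector_derivative m *\<^sub>R D (m * t + h)) (at t within K)"
    if t: "t \<in> ?K" for t
  proof -
    have 1: "((\<lambda>s. m * s + h) has_vector_derivative m) (at t within K)"
      by (auto intro!: derivative_eq_intros)
    have "((\<lambda>s. snd c (\<gamma> s)) has_vector_derivative D (m * t + h)) (at (m * t + h) within (\<lambda>s. m * s + h) ` K)"
      by (rule has_vector_derivative_within_subset[OF D(1)]) (use t K in auto)
    from vector_diff_chain_within[OF 1 this] show ?thesis by (simp add: o_def)
  qed
  moreover have "continuous_on ?K (\<lambda>t. m *\<^sub>R D (m * t + h))"
    by (intro continuous_intros continuous_on_compose2[OF D(2)]) (use K in auto)
  ultimately show "\<exists>D. (\<forall>t\<in>?K. ((\<lambda>s. snd c (\<gamma> (m * s + h))) has_vector_derivative D t) (at t within K))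
       \<and> continuous_on ?K D"
    by (intro exI[of _ "\<lambda>t. m *\<^sub>R D (m * t + h)"]) blast
qed

lemma velocity_affine:
  assumes \<gamma>: "C1_curve T A J \<gamma>" and K: "\<And>s. s \<in> K \<Longrightarrow> m * s + h \<in> J"
    and t: "t \<in> K" "at t within K \<noteq> bot" "at (m * t + h) within J \<noteq> bot"
  shows "velocity T A K (\<lambda>s. \<gamma> (m * s + h)) t = (\<lambda>c. m *\<^sub>R velocity T A J \<gamma> (m * t + h) c)"
proof -
  obtain c where c: "c \<in> charts_at T A (\<gamma> (m * t + h))"
    using charts_at_nonempty[OF C1_curve_in_topspace[OF \<gamma> K[OF t(1)]]] .
  have 1: "((\<lambda>s. m * s + h) has_vector_derivative m) (at t within K)"
    by (auto intro!: derivative_eq_intros)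
  have "((\<lambda>s. snd c (\<gamma> s)) has_vector_derivative velocity T A J \<gamma> (m * t + h) c)
      (at (m * t + h) within (\<lambda>s. m * s + h) ` K)"
    by (rule has_vector_derivative_within_subset[OF velocity_in_chart[OF \<gamma> K[OF t(1)] t(3) c]]) (use K in auto)
  from vector_diff_chain_within[OF 1 this]
  have "((\<lambda>s. snd c (\<gamma> (m * s + h))) has_vector_derivative m *\<^sub>R velocity T A J \<gamma> (m * t + h) c) (at t within K)"
    by (simp add: o_def)
  then show ?thesis
    using velocity_eqI[OF C1_curve_limitin[OF C1_curve_affine[OF \<gamma> K] t(1)] t(1,2) c
        tangent_space_scale[OF velocity_in_tangent_space[OF \<gamma> K[OF t(1)] t(3)]]] by blast
qed

lemma C1_curve_subset: "C1_curve T A J \<gamma> \<Longrightarrow> K \<subseteq> J \<Longrightarrow> C1_curve T A K \<gamma>"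
  using C1_curve_affine[of J \<gamma> K 1 0] by auto

lemma velocity_subset:
  assumes "C1_curve T A J \<gamma>" "K \<subseteq> J" "t \<in> K" "at t within K \<noteq> bot"
  shows "velocity T A K \<gamma> t = velocity T A J \<gamma> t"
proof -
  have "at t within J \<noteq> bot" using at_le[OF assms(2), of t] assms(4) by (auto simp: le_bot)
  then show ?thesis using velocity_affine[of J \<gamma> K 1 0 t] assms by auto
qed

lemma C1_curve_cong:
  assumes "C1_curve T A J \<gamma>" and eq: "\<And>t. t \<in> J \<Longrightarrow> \<eta> t = \<gamma> t"
  shows "C1_curve T A J \<eta>"
  unfolding C1_curve_def
proof (intro conjI ballI)
  show "continuous_map (top_of_set J) T \<eta>"
    using assms by (auto simp: C1_curve_def intro: continuous_map_eq)
  fix c assume "c \<in> charts T A"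
  then obtain D where D: "\<forall>t \<in> J \<inter> \<gamma> -` fst c. ((\<lambda>s. snd c (\<gamma> s)) has_vector_derivative D t) (at t within J)"
    "continuous_on (J \<inter> \<gamma> -` fst c) D"
    using assms(1) unfolding C1_curve_def by blast
  moreover have "J \<inter> \<eta> -` fst c = J \<inter> \<gamma> -` fst c" using eq by auto
  moreover have "((\<lambda>s. snd c (\<eta> s)) has_vector_derivative D t) (at t within J)"
    if "t \<in> J \<inter> \<gamma> -` fst c" for t
    by (rule has_vector_derivative_transform[OF _ _ D(1)[rule_format, OF that]]) (use that eq in auto)
  ultimately show "\<exists>D. (\<forall>t\<in>J \<inter> \<eta> -` fst c. ((\<lambda>s. snd c (\<eta> s)) has_vector_derivative D t) (at t within J))
       \<and> continuous_on (J \<inter> \<eta> -` fst c) D" by auto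
qed

lemma velocity_cong:
  assumes \<gamma>: "C1_curve T A J \<gamma>" and eq: "\<And>t. t \<in> J \<Longrightarrow> \<eta> t = \<gamma> t" and t: "t \<in> J" "at t within J \<noteq> bot"
  shows "velocity T A J \<eta> t = velocity T A J \<gamma> t"
proof -
  obtain c where c: "c \<in> charts_at T A (\<gamma> t)"
    using charts_at_nonempty[OF C1_curve_in_topspace[OF \<gamma> t(1)]] .
  show ?thesis
  proof (rule velocity_eqI)
    show "limitin T \<eta> (\<eta> t) (at t within J)"
      by (rule C1_curve_limitin[OF C1_curve_cong[OF \<gamma> eq] t(1)])
    show "((\<lambda>s. snd c (\<eta> s)) has_vector_derivative velocity T A J \<gamma> t c) (at t within J)"
      by (rule has_vector_derivative_transform[OF t(1) _ velocity_in_chart[OF \<gamma> t c]]) (simp add: eq)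
  qed (use t c eq velocity_in_tangent_space[OF \<gamma> t] in auto)
qed

lemma C1_curve_segment:
  assumes c: "c \<in> charts T A" and seg: "\<And>t. t \<in> {0..1} \<Longrightarrow> x + t *\<^sub>R (y - x) \<in> snd c ` fst c"
  shows "C1_curve T A {0..1} (\<lambda>t. chart_inv c (x + t *\<^sub>R (y - x)))"
proof (rule C1_curve_in_chart[OF c, where D = "\<lambda>_. y - x"])
  fix t :: real assume t: "t \<in> {0..1}"
  show "chart_inv c (x + t *\<^sub>R (y - x)) \<in> fst c" by (rule chart_inv_in[OF seg[OF t]])
  show "limitin T (\<lambda>t. chart_inv c (x + t *\<^sub>R (y - x))) (chart_inv c (x + t *\<^sub>R (y - x))) (at t within {0..1})"
    by (rule limitin_chart_inv[OF c _ seg[OF t]]) (intro tendsto_intros)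
  have "((\<lambda>t. x + t *\<^sub>R (y - x)) has_vector_derivative y - x) (at t within {0..1})"
    by (auto intro!: derivative_eq_intros simp: has_vector_derivative_def)
  then show "((\<lambda>s. snd c (chart_inv c (x + s *\<^sub>R (y - x)))) has_vector_derivative y - x) (at t within {0..1})"
    by (rule has_vector_derivative_transform[OF t _, rotated]) (simp add: chart_inv_right[OF seg])
qed simp

section \<open>Integral curves: pointwise description, extension and maximality\<close>

text \<open>
  The differential equation at one time. It depends on \<open>J\<close> only through the filter
  \<open>at t within J\<close>, so that restricting, extending and gluing solutions are statements about single
  times. One chart is enough, because derivatives can be moved from chart to chart.
\<close>
definition solves_at :: "('m \<Rightarrow> ('m, 'b) tangent) \<Rightarrow> (real \<Rightarrow> 'm) \<Rightarrow> real set \<Rightarrow> real \<Rightarrow> bool" where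
  "solves_at X \<gamma> J t \<longleftrightarrow> limitin T \<gamma> (\<gamma> t) (at t within J) \<and>
    (\<exists>c\<in>charts_at T A (\<gamma> t). ((\<lambda>s. snd c (\<gamma> s)) has_vector_derivative X (\<gamma> t) c) (at t within J))"

lemma vector_field_tangent: "C1_vector_field T A X \<Longrightarrow> p \<in> topspace T \<Longrightarrow> X p \<in> tangent_space T A p"
  by (simp add: C1_vector_field_def)

lemma vector_field_C1: "C1_vector_field T A X \<Longrightarrow> c \<in> charts T A \<Longrightarrow> C1_on (\<lambda>x. X (chart_inv c x) c) (snd c ` fst c)"
  unfolding C1_vector_field_def by blast

lemma solves_at_in_topspace: "solves_at X \<gamma> J t \<Longrightarrow> \<gamma> t \<in> topspace T"
  by (auto simp: solves_at_def limitin_def)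

lemma solves_at_all_charts:
  assumes X: "C1_vector_field T A X" and s: "solves_at X \<gamma> J t" and t: "t \<in> J"
    and c: "c \<in> charts_at T A (\<gamma> t)"
  shows "((\<lambda>s. snd c (\<gamma> s)) has_vector_derivative X (\<gamma> t) c) (at t within J)"
proof -
  obtain c' where c': "c' \<in> charts_at T A (\<gamma> t)"
    and d: "((\<lambda>s. snd c' (\<gamma> s)) has_vector_derivative X (\<gamma> t) c') (at t within J)"
    and l: "limitin T \<gamma> (\<gamma> t) (at t within J)"
    using s unfolding solves_at_def by blast
  show ?thesis
    using has_vector_derivative_chart_change[OF l t c' c d]
      tangent_spaceD[OF vector_field_tangent[OF X charts_atD(4)[OF c]] c' c] by simp
qed

text \<open>
  The velocity of a solution is, in a chart, the continuous representative of \<open>X\<close> evaluated along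
  the curve; this is why a solution is of class \<open>C\<^sup>1\<close>.
\<close>
lemma integral_curve_iff:
  assumes X: "C1_vector_field T A X"
  shows "integral_curve T A X J \<gamma> \<longleftrightarrow> is_interval J \<and> interior J \<noteq> {} \<and> (\<forall>t\<in>J. solves_at X \<gamma> J t)"
proof
  assume L: "integral_curve T A X J \<gamma>"
  then have J: "is_interval J" "interior J \<noteq> {}" and C: "C1_curve T A J \<gamma>"
    and v: "\<And>t. t \<in> J \<Longrightarrow> velocity T A J \<gamma> t = X (\<gamma> t)"
    by (auto simp: integral_curve_def)
  have "solves_at X \<gamma> J t" if t: "t \<in> J" for t
  proof -
    obtain c where c: "c \<in> charts_at T A (\<gamma> t)" using charts_at_nonempty[OF C1_curve_in_topspace[OF C t]] .
    show ?thesis unfolding solves_at_def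
      using C1_curve_limitin[OF C t] c velocity_in_chart[OF C t at_within_interval_nontrivial[OF J t] c] v[OF t]
      by auto
  qed
  with J show "is_interval J \<and> interior J \<noteq> {} \<and> (\<forall>t\<in>J. solves_at X \<gamma> J t)" by blast
next
  assume R: "is_interval J \<and> interior J \<noteq> {} \<and> (\<forall>t\<in>J. solves_at X \<gamma> J t)"
  then have J: "is_interval J" "interior J \<noteq> {}" and s: "\<And>t. t \<in> J \<Longrightarrow> solves_at X \<gamma> J t" by auto
  have lim: "limitin T \<gamma> (\<gamma> t) (at t within J)" if "t \<in> J" for t
    using s[OF that] by (simp add: solves_at_def)
  have C: "C1_curve T A J \<gamma>"
    unfolding C1_curve_def
  proof (intro conjI ballI)
    show "continuous_map (top_of_set J) T \<gamma>" using lim by (simp add: continuous_map_iff_limitin_at_within)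
    fix c assume c: "c \<in> charts T A"
    let ?K = "J \<inter> \<gamma> -` fst c"
    have d: "((\<lambda>s. snd c (\<gamma> s)) has_vector_derivative X (\<gamma> t) c) (at t within J)" if "t \<in> ?K" for t
      using solves_at_all_charts[OF X s, of t c] that c by (auto simp: charts_at_def)
    have "continuous_on ?K (\<lambda>s. snd c (\<gamma> s))"
      unfolding continuous_on_eq_continuous_within
      using has_vector_derivative_continuous[OF has_vector_derivative_within_subset[OF d]] by blast
    then have "continuous_on ?K (\<lambda>t. X (chart_inv c (snd c (\<gamma> t))) c)"
      by (rule continuous_on_compose2[OF C1_on_imp_continuous_on[OF vector_field_C1[OF X c]]]) auto
    then have "continuous_on ?K (\<lambda>t. X (\<gamma> t) c)"
      by (rule continuous_on_eq) (auto simp: chart_inv_left[OF charts_is_chart[OF c]])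
    with d show "\<exists>D. (\<forall>t\<in>?K. ((\<lambda>s. snd c (\<gamma> s)) has_vector_derivative D t) (at t within J)) \<and> continuous_on ?K D"
      by (intro exI[of _ "\<lambda>t. X (\<gamma> t) c"] conjI ballI)
  qed
  have "velocity T A J \<gamma> t = X (\<gamma> t)" if t: "t \<in> J" for t
  proof -
    have top: "\<gamma> t \<in> topspace T" by (rule C1_curve_in_topspace[OF C t])
    obtain c where c: "c \<in> charts_at T A (\<gamma> t)" using charts_at_nonempty[OF top] .
    show ?thesis
      by (rule velocity_eqI[OF lim[OF t] t at_within_interval_nontrivial[OF J t] c vector_field_tangent[OF X top]
            solves_at_all_charts[OF X s[OF t] t c]])
  qed
  with J C show "integral_curve T A X J \<gamma>" by (simp add: integral_curve_def)
qed

text \<open>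
  Limits and derivatives at \<open>t\<close> only see a neighbourhood of \<open>t\<close>.
\<close>
lemma solves_at_local:
  assumes s: "solves_at X \<gamma> J t" and U: "open U" "t \<in> U" "J \<inter> U = K \<inter> U" and t: "t \<in> K"
    and eq: "\<And>s. s \<in> K \<inter> U \<Longrightarrow> \<eta> s = \<gamma> s"
  shows "solves_at X \<eta> K t"
proof -
  have at: "at t within K = at t within J"
    by (rule at_within_nhd[OF U(2,1)]) (use U(3) in auto)
  have \<eta>t: "\<eta> t = \<gamma> t" using eq t U(2) by blast
  have ev: "eventually (\<lambda>s. \<gamma> s = \<eta> s) (at t within K)"
    unfolding eventually_at_topological using U eq by (metis IntI)
  obtain c where l: "limitin T \<gamma> (\<gamma> t) (at t within K)" and c: "c \<in> charts_at T A (\<gamma> t)"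
    and d: "((\<lambda>s. snd c (\<gamma> s)) has_vector_derivative X (\<gamma> t) c) (at t within K)"
    using s unfolding solves_at_def at by blast
  have "limitin T \<eta> (\<eta> t) (at t within K)"
    unfolding \<eta>t by (rule limitin_transform_eventually[OF ev l])
  moreover have "((\<lambda>s. snd c (\<eta> s)) has_vector_derivative X (\<gamma> t) c) (at t within K)"
    unfolding has_vector_derivative_def
  proof (rule has_derivative_transform_eventually[OF d[unfolded has_vector_derivative_def]])
    show "eventually (\<lambda>s. snd c (\<gamma> s) = snd c (\<eta> s)) (at t within K)"
      using ev by eventually_elim simp
  qed (use \<eta>t t in auto)
  ultimately show ?thesis using c unfolding solves_at_def \<eta>t by blast
qed

text \<open>
  The solution of the differential equation in a chart, carried back to the manifold.
\<close>
lemma local_solution: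
  assumes X: "C1_vector_field T A X" and p: "p \<in> topspace T"
  obtains \<delta> y where "0 < \<delta>" "y b = p" "\<And>t. t \<in> {b..b + \<delta>} \<Longrightarrow> solves_at X y {b..b + \<delta>} t"
proof -
  obtain c where c: "c \<in> charts_at T A p" using charts_at_nonempty[OF p] .
  note cc = charts_atD[OF c]
  obtain \<delta> x where \<delta>: "0 < \<delta>" "x 0 = snd c p" and xi: "\<And>t. t \<in> {0..\<delta>} \<Longrightarrow> x t \<in> snd c ` fst c"
    and dx: "\<And>t. t \<in> {0..\<delta>} \<Longrightarrow> (x has_vector_derivative X (chart_inv c (x t)) c) (at t within {0..\<delta>})"
    by (rule local_flow_exists[OF vector_field_C1[OF X cc(1)] charts_open[OF cc(1)]]) (use cc in auto)
  define y where "y t = chart_inv c (x (t - b))" for t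
  show thesis
  proof (rule that[OF \<delta>(1)])
    show "y b = p" using \<delta>(2) cc by (simp add: y_def)
    fix t assume t: "t \<in> {b..b + \<delta>}"
    have tb: "t - b \<in> {0..\<delta>}" using t by auto
    have 1: "((\<lambda>s. s - b) has_vector_derivative 1) (at t within {b..b + \<delta>})"
      by (auto intro!: derivative_eq_intros)
    have "(x has_vector_derivative X (y t) c) (at (t - b) within (\<lambda>s. s - b) ` {b..b + \<delta>})"
      unfolding y_def by (rule has_vector_derivative_within_subset[OF dx[OF tb]]) auto
    from vector_diff_chain_within[OF 1 this]
    have d: "((\<lambda>s. x (s - b)) has_vector_derivative X (y t) c) (at t within {b..b + \<delta>})" by (simp add: o_def)
    have "((\<lambda>s. x (s - b)) \<longlongrightarrow> x (t - b)) (at t within {b..b + \<delta>})"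
      using has_vector_derivative_continuous[OF d] by (simp add: continuous_within)
    then have "limitin T y (y t) (at t within {b..b + \<delta>})"
      unfolding y_def by (rule limitin_chart_inv[OF cc(1) _ xi[OF tb]])
    moreover have "c \<in> charts_at T A (y t)"
      using chart_inv_in[OF xi[OF tb]] cc(1) by (simp add: charts_at_def y_def)
    moreover have "((\<lambda>s. snd c (y s)) has_vector_derivative X (y t) c) (at t within {b..b + \<delta>})"
      by (rule has_vector_derivative_transform[OF t _ d]) (auto simp: y_def intro!: chart_inv_right xi)
    ultimately show "solves_at X y {b..b + \<delta>} t" unfolding solves_at_def by blast
  qed
qed

text \<open>
  The derivatives within \<open>J\<close> and within \<open>K\<close> agree, because both equal the value of the vector
  field.
\<close>
lemma solves_at_Un:
  assumes X: "C1_vector_field T A X" and J: "solves_at X \<gamma> J t" "t \<in> J" and K: "solves_at X \<gamma> K t" "t \<in> K"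
  shows "solves_at X \<gamma> (J \<union> K) t"
proof -
  obtain c where c: "c \<in> charts_at T A (\<gamma> t)" using J(1) unfolding solves_at_def by blast
  show ?thesis unfolding solves_at_def
    using c solves_at_all_charts[OF X J c] solves_at_all_charts[OF X K c] J(1) K(1)
    by (auto simp: solves_at_def intro!: limitin_within_Un has_vector_derivative_within_Un)
qed

lemma extend_beyond_maximum:
  assumes X: "C1_vector_field T A X" and \<gamma>: "integral_curve T A X J \<gamma>"
    and b: "b \<in> J" "J \<subseteq> {..b}"
  shows "\<exists>K \<eta>. integral_curve T A X K \<eta> \<and> J \<subset> K \<and> (\<forall>t\<in>J. \<eta> t = \<gamma> t)"
proof -
  have J: "is_interval J" "interior J \<noteq> {}" and s: "\<And>t. t \<in> J \<Longrightarrow> solves_at X \<gamma> J t"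
    using \<gamma> unfolding integral_curve_iff[OF X] by auto
  obtain \<delta> y where \<delta>: "0 < \<delta>" and yb: "y b = \<gamma> b"
    and y: "\<And>t. t \<in> {b..b + \<delta>} \<Longrightarrow> solves_at X y {b..b + \<delta>} t"
    using local_solution[OF X solves_at_in_topspace[OF s[OF b(1)]], of b] by blast
  define K where "K = J \<union> {b..b + \<delta>}"
  define \<eta> where "\<eta> t = (if t \<le> b then \<gamma> t else y t)" for t
  have \<eta>J: "\<eta> t = \<gamma> t" if "t \<in> J" for t using that b(2) by (auto simp: \<eta>_def)
  have \<eta>y: "\<eta> t = y t" if "t \<in> {b..b + \<delta>}" for t using that yb by (auto simp: \<eta>_def)
  have "solves_at X \<eta> K t" if t: "t \<in> K" for t
  proof -
    consider "t < b" "t \<in> J" | "t = b" | "b < t" "t \<in> {b..b + \<delta>}"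
      using t b(2) unfolding K_def by force
    then show ?thesis
    proof cases
      case 1
      show ?thesis
        by (rule solves_at_local[OF s[OF 1(2)], of "{..<b}"]) (use 1 \<eta>J in \<open>auto simp: K_def\<close>)
    next
      case 2
      have "solves_at X \<eta> J b" by (rule solves_at_local[OF s[OF b(1)], of UNIV]) (use b \<eta>J in auto)
      moreover have "solves_at X \<eta> {b..b + \<delta>} b"
        by (rule solves_at_local[OF y, of b UNIV]) (use \<delta> \<eta>y in auto)
      ultimately show ?thesis unfolding 2 K_def by (rule solves_at_Un[OF X _ b(1)]) (use \<delta> in auto)
    next
      case 3
      show ?thesis
        by (rule solves_at_local[OF y[OF 3(2)], of "{b<..}"]) (use 3 \<eta>y b(2) in \<open>auto simp: K_def\<close>)
    qed
  qed
  moreover have "is_interval K"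
    using J(1) b \<delta> unfolding is_interval_connected_1 K_def by (intro connected_Un) auto
  moreover have "interior K \<noteq> {}" using J(2) interior_mono[of J K] by (auto simp: K_def)
  moreover have "b + \<delta> \<in> K - J" using b(2) \<delta> by (auto simp: K_def)
  ultimately show ?thesis using \<eta>J unfolding integral_curve_iff[OF X]
    by (intro exI[of _ K] exI[of _ \<eta>]) (auto simp: K_def)
qed

text \<open>
  In a chart at \<open>p\<close> the extended curve is the integral of a function that is continuous up to and
  including \<open>b\<close>, namely of the representative of \<open>X\<close> along the curve. So it has the one-sided
  derivative \<open>X p\<close> at \<open>b\<close>.
\<close>
lemma extend_to_limit:
  assumes X: "C1_vector_field T A X" and \<gamma>: "integral_curve T A X J \<gamma>"
    and b: "b \<notin> J" "J \<subseteq> {..b}" "b = Sup J" and lim: "limitin T \<gamma> p (at b within J)"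
  shows "\<exists>K \<eta>. integral_curve T A X K \<eta> \<and> J \<subset> K \<and> (\<forall>t\<in>J. \<eta> t = \<gamma> t)"
proof -
  have J: "is_interval J" "interior J \<noteq> {}" and s: "\<And>t. t \<in> J \<Longrightarrow> solves_at X \<gamma> J t"
    using \<gamma> unfolding integral_curve_iff[OF X] by auto
  have lt: "t < b" if "t \<in> J" for t using that b(1,2) by (metis atMost_iff order_le_less subsetD)
  have Jne: "J \<noteq> {}" "bdd_above J" using J(2) b(2) by (auto intro: bdd_above.I2)
  have p: "p \<in> topspace T" using lim by (simp add: limitin_def)
  define K where "K = insert b J"
  define \<eta> where "\<eta> = \<gamma>(b := p)"
  have \<eta>J: "\<eta> t = \<gamma> t" if "t \<in> J" for t using that b(1) by (auto simp: \<eta>_def)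
  have above: "\<exists>t\<in>J. x < t" if "x < b" for x using that less_cSupD[OF Jne(1)] b(3) by blast
  have fillJ: "t \<in> J" if "s \<in> J" "s \<le> t" "t < b" for s t
    using above[OF that(3)] that(1,2) J(1) unfolding is_interval_1 by (metis less_imp_le)
  have sJ: "solves_at X \<eta> K t" if "t \<in> J" for t
    by (rule solves_at_local[OF s[OF that], of "{..<b}"]) (use that lt \<eta>J in \<open>auto simp: K_def\<close>)
  have "solves_at X \<eta> K b"
  proof -
    have atK: "at b within K = at b within J" unfolding K_def by (rule at_within_nhd[of _ UNIV]) auto
    have ev: "eventually (\<lambda>s. \<gamma> s = \<eta> s) (at b within J)"
      by (auto simp: eventually_at_filter \<eta>_def)
    have limb: "limitin T \<eta> (\<eta> b) (at b within K)"
    proof -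
      have "\<eta> b = p" by (simp add: \<eta>_def)
      then show ?thesis unfolding atK using limitin_transform_eventually[OF ev lim] by (simp only:)
    qed
    obtain c where c: "c \<in> charts_at T A p" using charts_at_nonempty[OF p] .
    note cc = charts_atD[OF c]
    have "eventually (\<lambda>t. \<eta> t \<in> fst c) (at b within K)"
      using limitin_eventually_in[OF limb charts_openin[OF cc(1)]] cc(2) by (simp add: \<eta>_def)
    then obtain d where d: "0 < d" "\<And>t. t \<in> K \<Longrightarrow> t \<noteq> b \<Longrightarrow> dist t b < d \<Longrightarrow> \<eta> t \<in> fst c"
      unfolding eventually_at by blast
    \<comment> \<open>From time \<open>a\<close> on, the extended curve stays in the chart at \<open>p\<close>.\<close>
    obtain a where a: "a \<in> J" "b - d < a" using above[of "b - d"] d(1) by auto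
    have ab: "a < b" by (rule lt[OF a(1)])
    have in_c: "\<eta> t \<in> fst c" if "t \<in> {a..b}" for t
    proof (cases "t = b")
      case True
      then show ?thesis using cc(2) by (simp add: \<eta>_def)
    next
      case False
      then show ?thesis using that a(2) fillJ[OF a(1), of t] by (intro d(2)) (auto simp: K_def dist_real_def)
    qed
    have abJ: "t \<in> J" if "a \<le> t" "t < b" for t by (rule fillJ[OF a(1) that])
    let ?f = "\<lambda>t. snd c (\<eta> t)"
    have cat: "c \<in> charts_at T A (\<eta> t)" if "t \<in> {a..b}" for t
      using in_c[OF that] cc(1) by (simp add: charts_at_def)
    have der: "(?f has_vector_derivative X (\<eta> t) c) (at t within K)" if "a \<le> t" "t < b" for t
      by (rule solves_at_all_charts[OF X sJ[OF abJ[OF that]] _ cat]) (use that abJ in \<open>auto simp: K_def\<close>)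
    have subK: "{a..b} \<subseteq> K" using abJ by (force simp: K_def)
    have fc: "continuous_on {a..b} ?f"
      unfolding continuous_on_eq_continuous_within
    proof
      fix t assume t: "t \<in> {a..b}"
      show "continuous (at t within {a..b}) ?f"
      proof (cases "t = b")
        case False
        then have "continuous (at t within K) ?f"
          using has_vector_derivative_continuous[OF der] t by auto
        then show ?thesis by (rule continuous_within_subset[OF _ subK])
      next
        case True
        have "(?f \<longlongrightarrow> ?f b) (at b within K)"
        proof (rule topological_tendstoI)
          fix W assume W: "open W" "?f b \<in> W"
          have "eventually (\<lambda>t. \<eta> t \<in> {q \<in> fst c. snd c q \<in> W}) (at b within K)"
            by (rule limitin_eventually_in[OF limb chart_vimage_open[OF cc(3) W(1)]])
              (use W(2) in_c[of b] ab in auto)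
          then show "eventually (\<lambda>t. ?f t \<in> W) (at b within K)" by eventually_elim simp
        qed
        then have "continuous (at b within K) ?f" by (simp add: continuous_within)
        then show ?thesis unfolding True by (rule continuous_within_subset[OF _ subK])
      qed
    qed
    let ?g = "\<lambda>t. X (\<eta> t) c"
    have "continuous_on {a..b} (\<lambda>t. X (chart_inv c (?f t)) c)"
      by (rule continuous_on_compose2[OF C1_on_imp_continuous_on[OF vector_field_C1[OF X cc(1)]] fc])
        (use in_c in auto)
    then have gc: "continuous_on {a..b} ?g"
      by (rule continuous_on_eq) (use in_c in \<open>auto simp: chart_inv_left[OF cc(3)]\<close>)
    have f_eq: "?f t = ?f a + integral {a..t} ?g" if t: "t \<in> {a..b}" for t
    proof -
      have "(?g has_integral (?f t - ?f a)) {a..t}"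
      proof (rule fundamental_theorem_of_calculus_interior)
        show "continuous_on {a..t} ?f" using t by (auto intro: continuous_on_subset[OF fc])
        fix x assume x: "x \<in> {a<..<t}"
        have "(?f has_vector_derivative ?g x) (at x within {a..b})"
          by (rule has_vector_derivative_within_subset[OF der subK]) (use x t in auto)
        moreover have "at x within {a..b} = at x" by (rule at_within_interior) (use x t in auto)
        ultimately show "(?f has_vector_derivative ?g x) (at x)" by simp
      qed (use t in auto)
      from integral_unique[OF this] show ?thesis by simp
    qed
    have bb: "b \<in> {a..b}" using ab by simp
    have "((\<lambda>t. ?f a + integral {a..t} ?g) has_vector_derivative (0 + ?g b)) (at b within {a..b})"
      using ab by (intro has_vector_derivative_add has_vector_derivative_const integral_has_vector_derivative[OF gc]) auto
    then have "(?f has_vector_derivative ?g b) (at b within {a..b})"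
      unfolding add_0 by (rule has_vector_derivative_transform[OF bb, rotated]) (rule f_eq)
    moreover have "at b within {a..b} = at b within K"
    proof (rule at_within_nhd)
      show "b \<in> {a<..}" "open {a<..}" using ab by auto
      show "{a..b} \<inter> {a<..} - {b} = K \<inter> {a<..} - {b}"
      proof (intro set_eqI iffI)
        fix x assume "x \<in> {a..b} \<inter> {a<..} - {b}"
        then show "x \<in> K \<inter> {a<..} - {b}" using abJ[of x] by (simp add: K_def)
      next
        fix x assume "x \<in> K \<inter> {a<..} - {b}"
        then show "x \<in> {a..b} \<inter> {a<..} - {b}" using lt[of x] by (auto simp: K_def)
      qed
    qed
    ultimately have "(?f has_vector_derivative ?g b) (at b within K)" by simp
    then show ?thesis unfolding solves_at_def using limb cat[of b] ab by auto
  qed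
  then have "\<forall>t\<in>K. solves_at X \<eta> K t" using sJ by (auto simp: K_def)
  moreover have "is_interval K"
    unfolding is_interval_1
  proof (intro ballI allI impI)
    fix x y z assume xy: "x \<in> K" "y \<in> K" and "x \<le> z \<and> z \<le> y"
    then have xyz: "x \<in> K" "y \<in> K" "x \<le> z" "z \<le> y" by auto
    show "z \<in> K"
    proof (cases "z = b \<or> x = b")
      case True
      then have "z = b" using xyz lt[of y] by (auto simp: K_def)
      then show ?thesis by (simp add: K_def)
    next
      case False
      then have xJ: "x \<in> J" using xyz by (simp add: K_def)
      have "y \<le> b" using xyz(2) lt[of y] by (auto simp: K_def)
      then have "z < b" using False xyz(4) by simp
      from fillJ[OF xJ xyz(3) this] show ?thesis by (simp add: K_def)
    qed
  qed
  moreover have "interior K \<noteq> {}" using J(2) interior_mono[of J K] by (auto simp: K_def)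
  ultimately show ?thesis using \<eta>J b(1) unfolding integral_curve_iff[OF X]
    by (intro exI[of _ K] exI[of _ \<eta>]) (auto simp: K_def)
qed

lemma vector_field_uminus:
  assumes X: "C1_vector_field T A X"
  shows "C1_vector_field T A (\<lambda>p c. - X p c)"
  unfolding C1_vector_field_def
proof (intro conjI ballI)
  show "(\<lambda>c. - X p c) \<in> tangent_space T A p" if "p \<in> topspace T" for p
    using tangent_space_scale[OF vector_field_tangent[OF X that], of "-1"] by simp
  fix c assume c: "c \<in> charts T A"
  have "C1_on uminus (UNIV::'b set)"
    unfolding C1_on_def
  proof (intro exI[of _ "\<lambda>_. - id_blinfun"] conjI ballI)
    show "(uminus has_derivative blinfun_apply (- id_blinfun)) (at x)" for x :: 'b
      by (auto intro!: derivative_eq_intros simp: uminus_blinfun.rep_eq)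
  qed simp
  from C1_on_compose[OF vector_field_C1[OF X c] this]
  show "C1_on (\<lambda>x. - X (chart_inv c x) c) (snd c ` fst c)" by (simp add: o_def)
qed

lemma integral_curve_reverse:
  assumes \<gamma>: "integral_curve T A X J \<gamma>"
  shows "integral_curve T A (\<lambda>p c. - X p c) (uminus ` J) (\<lambda>t. \<gamma> (- t))"
proof -
  have J: "is_interval J" "interior J \<noteq> {}" and C: "C1_curve T A J \<gamma>"
    and v: "\<And>t. t \<in> J \<Longrightarrow> velocity T A J \<gamma> t = X (\<gamma> t)"
    using \<gamma> by (auto simp: integral_curve_def)
  have K: "-1 * s + 0 \<in> J" if "s \<in> uminus ` J" for s using that by auto
  have iv: "is_interval (uminus ` J)" using J(1) by (simp add: is_interval_neg_translationI is_interval_uminus)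
  have int: "interior (uminus ` J) \<noteq> {}" using J(2) by (simp add: interior_negations)
  have C': "C1_curve T A (uminus ` J) (\<lambda>t. \<gamma> (- t))" using C1_curve_affine[OF C K] by simp
  moreover have "velocity T A (uminus ` J) (\<lambda>t. \<gamma> (- t)) t = (\<lambda>c. - X (\<gamma> (- t)) c)" if t: "t \<in> uminus ` J" for t
    using velocity_affine[OF C K t at_within_interval_nontrivial[OF iv int t]
        at_within_interval_nontrivial[OF J K[OF t]]] v[OF K[OF t]] by simp
  ultimately show ?thesis using iv int by (simp add: integral_curve_def)
qed

lemma integral_curve_cong:
  assumes X: "C1_vector_field T A X" and \<gamma>: "integral_curve T A X J \<gamma>"
    and eq: "\<And>t. t \<in> J \<Longrightarrow> \<eta> t = \<gamma> t"
  shows "integral_curve T A X J \<eta>"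
proof -
  have "solves_at X \<eta> J t" if t: "t \<in> J" for t
  proof (rule solves_at_local[of X \<gamma> J t UNIV])
    show "solves_at X \<gamma> J t" using \<gamma> t unfolding integral_curve_iff[OF X] by blast
  qed (use t eq in auto)
  then show ?thesis using \<gamma> unfolding integral_curve_iff[OF X] by blast
qed

text \<open>
  Near each of its points the union agrees with a single member of the chain: a member that contains
  points of the union on either side of \<open>t\<close>, as far as there are any.
\<close>
lemma integral_curve_Union_chain:
  assumes X: "C1_vector_field T A X" and ne: "\<K> \<noteq> {}"
    and chain: "\<And>K L. K \<in> \<K> \<Longrightarrow> L \<in> \<K> \<Longrightarrow> K \<subseteq> L \<or> L \<subseteq> K"
    and ic: "\<And>K. K \<in> \<K> \<Longrightarrow> integral_curve T A X K \<eta>"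
  shows "integral_curve T A X (\<Union>\<K>) \<eta>"
proof -
  have iv: "\<And>x. s \<in> K \<Longrightarrow> t \<in> K \<Longrightarrow> s \<le> x \<Longrightarrow> x \<le> t \<Longrightarrow> x \<in> K" if "K \<in> \<K>" for K s t
    using ic[OF that] unfolding integral_curve_def is_interval_1 by blast
  have common: "\<exists>K\<in>\<K>. s \<in> K \<and> t \<in> K" if st: "s \<in> \<Union>\<K>" "t \<in> \<Union>\<K>" for s t
  proof -
    obtain K L where KL: "K \<in> \<K>" "s \<in> K" "L \<in> \<K>" "t \<in> L" using st by (elim UnionE) (rule that)
    from chain[OF KL(1,3)] show ?thesis
    proof
      assume "K \<subseteq> L"
      then show ?thesis using KL by (intro bexI[of _ L]) auto
    next
      assume "L \<subseteq> K"
      then show ?thesis using KL by (intro bexI[of _ K]) auto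
    qed
  qed
  have "solves_at X \<eta> (\<Union>\<K>) t" if t: "t \<in> \<Union>\<K>" for t
  proof -
    \<comment> \<open>The points \<open>l\<close> and \<open>u\<close> enclose \<open>t\<close> within the union, strictly on each side
      unless \<open>t\<close> is an endpoint of the union there.\<close>
    obtain l where l: "l \<in> \<Union>\<K>" "l < t \<or> (l = t \<and> (\<forall>a\<in>\<Union>\<K>. t \<le> a))"
    proof (cases "\<exists>l\<in>\<Union>\<K>. l < t")
      case True
      then show ?thesis by (elim bexE) (rule that, assumption, rule disjI1)
    next
      case False
      then show ?thesis using t by (intro that[of t]) (auto simp: not_less)
    qed
    obtain u where u: "u \<in> \<Union>\<K>" "t < u \<or> (u = t \<and> (\<forall>a\<in>\<Union>\<K>. a \<le> t))"
    proof (cases "\<exists>u\<in>\<Union>\<K>. t < u")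
      case True
      then show ?thesis by (elim bexE) (rule that, assumption, rule disjI1)
    next
      case False
      then show ?thesis using t by (intro that[of t]) (auto simp: not_less)
    qed
    obtain K where K: "K \<in> \<K>" "l \<in> K" "u \<in> K" using common[OF l(1) u(1)] by (elim bexE conjE) (rule that)
    have tK: "t \<in> K" by (rule iv[OF K]) (use l(2) u(2) in auto)
    define U where "U = (if l < t then {l<..} else UNIV) \<inter> (if t < u then {..<u} else UNIV)"
    have U: "open U" "t \<in> U" by (auto simp: U_def intro!: open_Int)
    have "x \<in> K" if x: "x \<in> \<Union>\<K>" "x \<in> U" for x
    proof (rule iv[OF K])
      show "l \<le> x" using l(2) x by (cases "l < t") (auto simp: U_def)
      show "x \<le> u" using u(2) x by (cases "t < u") (auto simp: U_def)
    qed
    then have KU: "K \<inter> U = \<Union>\<K> \<inter> U" using K(1) by blast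
    have "solves_at X \<eta> K t" using ic[OF K(1)] tK unfolding integral_curve_iff[OF X] by blast
    then show ?thesis by (rule solves_at_local[OF _ U KU t]) (rule refl)
  qed
  moreover have "is_interval (\<Union>\<K>)"
    unfolding is_interval_1
  proof (intro ballI allI impI)
    fix s t x assume st: "s \<in> \<Union>\<K>" "t \<in> \<Union>\<K>" and x: "s \<le> x \<and> x \<le> t"
    obtain K where "K \<in> \<K>" "s \<in> K" "t \<in> K" using common[OF st] by (elim bexE conjE) (rule that)
    then show "x \<in> \<Union>\<K>" using iv[of K s t x] x by blast
  qed
  moreover have "interior (\<Union>\<K>) \<noteq> {}"
  proof -
    obtain K where K: "K \<in> \<K>" using ne by blast
    then show ?thesis using ic[OF K] interior_mono[of K "\<Union>\<K>"] unfolding integral_curve_def by blast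
  qed
  ultimately show ?thesis unfolding integral_curve_iff[OF X] by simp
qed

text \<open>
  Zorn's lemma for the graphs of the integral curves that extend \<open>\<gamma>\<close>. With graphs in place of
  functions, extension is inclusion and the values of a curve off its domain do not interfere.
\<close>
lemma maximal_integral_curve_exists:
  assumes X: "C1_vector_field T A X" and \<gamma>: "integral_curve T A X J \<gamma>"
  obtains K \<eta> where "integral_curve T A X K \<eta>" "J \<subseteq> K" "\<And>t. t \<in> J \<Longrightarrow> \<eta> t = \<gamma> t"
    "\<And>K' \<eta>'. integral_curve T A X K' \<eta>' \<Longrightarrow> K \<subseteq> K' \<Longrightarrow> (\<And>t. t \<in> K \<Longrightarrow> \<eta>' t = \<eta> t) \<Longrightarrow> K' = K"
proof -
  define graph :: "real set \<Rightarrow> (real \<Rightarrow> 'm) \<Rightarrow> (real \<times> 'm) set" where "graph K \<eta> = (\<lambda>t. (t, \<eta> t)) ` K" for K \<eta>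
  have graph_iff: "(t, y) \<in> graph K \<eta> \<longleftrightarrow> t \<in> K \<and> y = \<eta> t" for t y K \<eta> by (auto simp: graph_def)
  have fst_graph: "fst ` graph K \<eta> = K" for K \<eta> by (simp add: graph_def image_image)
  define \<A> where "\<A> = {G. \<exists>\<eta>. G = graph (fst ` G) \<eta> \<and> integral_curve T A X (fst ` G) \<eta> \<and> graph J \<gamma> \<subseteq> G}"
  have graph_in_\<A>: "graph K \<eta> \<in> \<A>" if "integral_curve T A X K \<eta>" "graph J \<gamma> \<subseteq> graph K \<eta>" for K \<eta>
    using that unfolding \<A>_def by (auto simp: fst_graph)
  have "\<exists>M\<in>\<A>. \<forall>G\<in>\<A>. M \<subseteq> G \<longrightarrow> G = M"
  proof (rule subset_Zorn_nonempty)
    show "\<A> \<noteq> {}" using graph_in_\<A>[OF \<gamma>] by blast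
    fix \<C> assume Cne: "\<C> \<noteq> {}" and ch: "subset.chain \<A> \<C>"
    have CA: "G \<in> \<A>" if "G \<in> \<C>" for G using ch that unfolding subset_chain_def by blast
    have lin: "G \<subseteq> H \<or> H \<subseteq> G" if "G \<in> \<C>" "H \<in> \<C>" for G H
      using ch that unfolding subset_chain_def by blast
    have unique: "y = y'" if y: "(t, y) \<in> \<Union>\<C>" and y': "(t, y') \<in> \<Union>\<C>" for t y y'
    proof -
      obtain G where G: "G \<in> \<C>" "(t, y) \<in> G" using y by (elim UnionE) (rule that)
      obtain H where H: "H \<in> \<C>" "(t, y') \<in> H" using y' by (elim UnionE) (rule that)
      have "\<exists>E\<in>\<C>. (t, y) \<in> E \<and> (t, y') \<in> E" using lin[OF G(1) H(1)] G H by auto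
      then obtain E where E: "E \<in> \<C>" "(t, y) \<in> E" "(t, y') \<in> E" by (elim bexE conjE) (rule that)
      obtain \<eta> where "E = graph (fst ` E) \<eta>" using CA[OF E(1)] unfolding \<A>_def by auto
      then show ?thesis using E graph_iff by metis
    qed
    define \<eta> where "\<eta> t = (THE y. (t, y) \<in> \<Union>\<C>)" for t
    have \<eta>eq: "\<eta> t = y" if "(t, y) \<in> \<Union>\<C>" for t y
      unfolding \<eta>_def
    proof (rule the_equality)
      show "(t, y) \<in> \<Union>\<C>" by (rule that)
      show "y' = y" if "(t, y') \<in> \<Union>\<C>" for y' by (rule unique[OF that \<open>(t, y) \<in> \<Union>\<C>\<close>])
    qed
    have piece: "G = graph (fst ` G) \<eta> \<and> integral_curve T A X (fst ` G) \<eta>" if G: "G \<in> \<C>" for G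
    proof -
      obtain \<eta>' where e: "G = graph (fst ` G) \<eta>'" "integral_curve T A X (fst ` G) \<eta>'"
        using CA[OF G] unfolding \<A>_def by auto
      have eq: "\<eta> t = \<eta>' t" if "t \<in> fst ` G" for t
      proof (rule \<eta>eq)
        have "(t, \<eta>' t) \<in> G" using that e(1) graph_iff by metis
        then show "(t, \<eta>' t) \<in> \<Union>\<C>" using G by blast
      qed
      have "graph (fst ` G) \<eta> = graph (fst ` G) \<eta>'" unfolding graph_def by (rule image_cong) (simp_all only: eq)
      then show ?thesis using e integral_curve_cong[OF X e(2) eq] by metis
    qed
    have graph_Union: "\<Union>\<C> = graph (\<Union>(image fst ` \<C>)) \<eta>"
    proof -
      have "\<Union>\<C> = (\<Union>G\<in>\<C>. graph (fst ` G) \<eta>)" using piece by auto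
      then show ?thesis unfolding graph_def by auto
    qed
    have "integral_curve T A X (\<Union>(image fst ` \<C>)) \<eta>"
    proof (rule integral_curve_Union_chain[OF X])
      show "image fst ` \<C> \<noteq> {}" using Cne by blast
      fix K assume "K \<in> image fst ` \<C>"
      then obtain G where G: "G \<in> \<C>" "K = fst ` G" by blast
      then show "integral_curve T A X K \<eta>" using piece by blast
      fix L assume "L \<in> image fst ` \<C>"
      then obtain H where H: "H \<in> \<C>" "L = fst ` H" by blast
      show "K \<subseteq> L \<or> L \<subseteq> K" unfolding G(2) H(2) using lin[OF G(1) H(1)] by blast
    qed
    moreover have "graph J \<gamma> \<subseteq> \<Union>\<C>" using Cne CA unfolding \<A>_def by blast
    ultimately show "\<Union>\<C> \<in> \<A>" using graph_in_\<A> graph_Union by metis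
  qed
  then obtain M where MA: "M \<in> \<A>" and max: "\<And>G. G \<in> \<A> \<Longrightarrow> M \<subseteq> G \<Longrightarrow> G = M" by blast
  obtain \<eta> where M: "M = graph (fst ` M) \<eta>" "integral_curve T A X (fst ` M) \<eta>" "graph J \<gamma> \<subseteq> M"
    using MA unfolding \<A>_def by auto
  have J: "t \<in> fst ` M \<and> \<gamma> t = \<eta> t" if "t \<in> J" for t
  proof -
    have "(t, \<gamma> t) \<in> M" using M(3) that graph_iff by blast
    then show ?thesis using M(1) graph_iff by metis
  qed
  show thesis
  proof (rule that[OF M(2)])
    show "J \<subseteq> fst ` M" using J by blast
    show "\<eta> t = \<gamma> t" if "t \<in> J" for t using J[OF that] by simp
    fix K' \<eta>' assume K': "integral_curve T A X K' \<eta>'" "fst ` M \<subseteq> K'" and e: "\<And>t. t \<in> fst ` M \<Longrightarrow> \<eta>' t = \<eta> t"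
    have "graph (fst ` M) \<eta> \<subseteq> graph K' \<eta>'"
    proof
      fix z assume "z \<in> graph (fst ` M) \<eta>"
      then obtain t where "t \<in> fst ` M" "z = (t, \<eta> t)" unfolding graph_def by auto
      then show "z \<in> graph K' \<eta>'" using e K'(2) graph_iff by auto
    qed
    then have "M \<subseteq> graph K' \<eta>'" using M(1) by simp
    moreover from this have "graph K' \<eta>' \<in> \<A>" using M(3) by (intro graph_in_\<A>[OF K'(1)]) blast
    ultimately have "graph K' \<eta>' = M" using max by blast
    then show "K' = fst ` M" using fst_graph by metis
  qed
qed

end

section \<open>Speed and length in a Finsler manifold\<close>

locale finsler_mfd = banach_mfd T A for T :: "'m topology" and A :: "('m, 'b::banach) chart set" +
  fixes F :: "'m \<Rightarrow> ('m, 'b) tangent \<Rightarrow> real"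
  assumes finsler: "finsler_metric T A F"
begin

lemma F_norm:
  assumes "p \<in> topspace T" "v \<in> tangent_space T A p"
  shows "0 \<le> F p v" "F p (\<lambda>c. r *\<^sub>R v c) = \<bar>r\<bar> * F p v"
    "w \<in> tangent_space T A p \<Longrightarrow> F p (\<lambda>c. v c + w c) \<le> F p v + F p w"
  using finsler assms unfolding finsler_metric_def norm_on_tangent_space_def by blast+

text \<open>
  One chart carries both conditions of the definition at \<open>p\<close>; the continuity condition is written
  symmetrically in the two norms.
\<close>
lemma finsler_chart:
  assumes "p \<in> topspace T"
  obtains c k K where "c \<in> charts_at T A p" "0 < k" "0 < K"
    "\<And>u. k * norm u \<le> F p (tangent_of_chart T A c p u)"
    "\<And>u. F p (tangent_of_chart T A c p u) \<le> K * norm u"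
    "\<And>\<epsilon>. 0 < \<epsilon> \<Longrightarrow> \<epsilon> < 1 \<Longrightarrow> \<exists>V. openin T V \<and> p \<in> V \<and> V \<subseteq> fst c \<and>
      (\<forall>q\<in>V. \<forall>u. \<epsilon> * F q (tangent_of_chart T A c q u) \<le> F p (tangent_of_chart T A c p u) \<and>
                 \<epsilon> * F p (tangent_of_chart T A c p u) \<le> F q (tangent_of_chart T A c q u))"
proof -
  obtain c where c: "c \<in> charts_at T A p"
    and e: "\<forall>q \<in> fst c. \<exists>k>0. \<exists>K>0. \<forall>u. k * norm u \<le> F q (tangent_of_chart T A c q u) \<and>
              F q (tangent_of_chart T A c q u) \<le> K * norm u"
    and V: "\<forall>\<epsilon>. 0 < \<epsilon> \<and> \<epsilon> < 1 \<longrightarrow> (\<exists>V. openin T V \<and> p \<in> V \<and> V \<subseteq> fst c \<and>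
      (\<forall>q\<in>V. \<forall>u. \<epsilon> * F q (tangent_of_chart T A c q u) \<le> F p (tangent_of_chart T A c p u) \<and>
         F p (tangent_of_chart T A c p u) \<le> inverse \<epsilon> * F q (tangent_of_chart T A c q u)))"
    using finsler assms unfolding finsler_metric_def Let_def by blast
  have inv: "\<epsilon> * x \<le> y" if "x \<le> inverse \<epsilon> * y" "0 < \<epsilon>" for \<epsilon> x y :: real
    using that by (simp add: field_simps)
  obtain k K where kK: "0 < k" "0 < K" "\<forall>u. k * norm u \<le> F p (tangent_of_chart T A c p u) \<and>
              F p (tangent_of_chart T A c p u) \<le> K * norm u"
    using e charts_atD(2)[OF c] by blast
  show thesis
  proof (rule that[OF c kK(1,2)])
    fix \<epsilon> :: real assume \<epsilon>: "0 < \<epsilon>" "\<epsilon> < 1"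
    obtain W where W: "openin T W" "p \<in> W" "W \<subseteq> fst c"
      and bd: "\<forall>q\<in>W. \<forall>u. \<epsilon> * F q (tangent_of_chart T A c q u) \<le> F p (tangent_of_chart T A c p u) \<and>
         F p (tangent_of_chart T A c p u) \<le> inverse \<epsilon> * F q (tangent_of_chart T A c q u)"
      using V[THEN spec, THEN mp, OF conjI[OF \<epsilon>]] by (elim exE conjE) (rule that)
    have "\<forall>q\<in>W. \<forall>u. \<epsilon> * F q (tangent_of_chart T A c q u) \<le> F p (tangent_of_chart T A c p u) \<and>
                 \<epsilon> * F p (tangent_of_chart T A c p u) \<le> F q (tangent_of_chart T A c q u)"
      using bd inv[OF _ \<epsilon>(1)] by blast
    with W show "\<exists>V. openin T V \<and> p \<in> V \<and> V \<subseteq> fst c \<and>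
      (\<forall>q\<in>V. \<forall>u. \<epsilon> * F q (tangent_of_chart T A c q u) \<le> F p (tangent_of_chart T A c p u) \<and>
                 \<epsilon> * F p (tangent_of_chart T A c p u) \<le> F q (tangent_of_chart T A c q u))"
      by (intro exI[of _ W] conjI)
  qed (use kK(3) in blast)+
qed

definition speed :: "real set \<Rightarrow> (real \<Rightarrow> 'm) \<Rightarrow> real \<Rightarrow> real" where
  "speed J \<gamma> t = F (\<gamma> t) (velocity T A J \<gamma> t)"

lemma finsler_length_eq: "finsler_length T A F a b \<gamma> = integral {a..b} (speed {a..b} \<gamma>)"
  by (simp add: finsler_length_def speed_def[abs_def])

lemma speed_nonneg:
  "C1_curve T A J \<gamma> \<Longrightarrow> t \<in> J \<Longrightarrow> at t within J \<noteq> bot \<Longrightarrow> 0 \<le> speed J \<gamma> t"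
  unfolding speed_def by (intro F_norm(1) C1_curve_in_topspace velocity_in_tangent_space)

lemma speed_in_chart:
  assumes "C1_curve T A J \<gamma>" "t \<in> J" "at t within J \<noteq> bot" "c \<in> charts_at T A (\<gamma> t)"
  shows "speed J \<gamma> t = F (\<gamma> t) (tangent_of_chart T A c (\<gamma> t) (velocity T A J \<gamma> t c))"
  unfolding speed_def
  using tangent_of_chart_rep[OF velocity_in_tangent_space[OF assms(1-3)] assms(4)] by simp

text \<open>
  The norms are comparable to the one at \<open>\<gamma> s\<close> only in a chart that depends on \<open>s\<close>, and continuity
  holds at the base point \<open>\<gamma> s\<close> alone. This suffices, because continuity of the speed is proved one
  \<open>s\<close> at a time: in such a chart the fixed norm at \<open>\<gamma> s\<close> of the velocity converges, and the ratio
  of the speed to it tends to one.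
\<close>
lemma speed_continuous:
  assumes \<gamma>: "C1_curve T A J \<gamma>" and J: "\<And>t. t \<in> J \<Longrightarrow> at t within J \<noteq> bot"
  shows "continuous_on J (speed J \<gamma>)"
  unfolding continuous_on_def
proof
  fix s assume s: "s \<in> J"
  define p where "p = \<gamma> s"
  have p: "p \<in> topspace T" unfolding p_def by (rule C1_curve_in_topspace[OF \<gamma> s])
  obtain c k K where c: "c \<in> charts_at T A p" and K: "0 < K"
    and NK: "\<And>u. F p (tangent_of_chart T A c p u) \<le> K * norm u"
    and V: "\<And>\<epsilon>. 0 < \<epsilon> \<Longrightarrow> \<epsilon> < 1 \<Longrightarrow> \<exists>V. openin T V \<and> p \<in> V \<and> V \<subseteq> fst c \<and>
      (\<forall>q\<in>V. \<forall>u. \<epsilon> * F q (tangent_of_chart T A c q u) \<le> F p (tangent_of_chart T A c p u) \<and>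
                 \<epsilon> * F p (tangent_of_chart T A c p u) \<le> F q (tangent_of_chart T A c q u))"
    by (rule finsler_chart[OF p]) blast
  note cc = charts_atD[OF c]
  define N where "N u = F p (tangent_of_chart T A c p u)" for u
  define v where "v t = velocity T A J \<gamma> t c" for t
  have lim\<gamma>: "limitin T \<gamma> p (at s within J)" using C1_curve_limitin[OF \<gamma> s] by (simp add: p_def)
  have inc: "eventually (\<lambda>t. \<gamma> t \<in> fst c) (at s within J)"
    by (rule limitin_eventually_in[OF lim\<gamma> charts_openin[OF cc(1)] cc(2)])
  have vlim: "(v \<longlongrightarrow> v s) (at s within J)"
  proof -
    have "continuous (at s within J \<inter> \<gamma> -` fst c) v"
      using velocity_continuous_in_chart[OF \<gamma> J cc(1)] s cc(2)
      unfolding v_def continuous_on_eq_continuous_within by (simp add: p_def)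
    moreover have "at s within J \<inter> \<gamma> -` fst c = at s within J"
    proof -
      obtain U where U: "open U" "s \<in> U" "\<And>t. t \<in> U \<Longrightarrow> t \<noteq> s \<Longrightarrow> t \<in> J \<Longrightarrow> \<gamma> t \<in> fst c"
        using inc unfolding eventually_at_topological by blast
      show ?thesis by (rule at_within_nhd[OF U(2,1)]) (use U(3) in auto)
    qed
    ultimately show ?thesis by (simp add: continuous_within)
  qed
  have Nsub: "\<bar>N u - N w\<bar> \<le> K * norm (u - w)" for u w
  proof -
    have tri: "N (x + y) \<le> N x + N y" for x y
      unfolding N_def tangent_of_chart_add[OF c]
      by (rule F_norm(3)[OF p]) (rule tangent_of_chart_in[OF c])+
    have "N u \<le> N w + K * norm (u - w)" for u w
      using tri[of w "u - w"] NK[of "u - w"] by (simp add: N_def)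
    from this[of u w] this[of w u] show ?thesis by (simp add: norm_minus_commute abs_le_iff)
  qed
  have Nlim: "((\<lambda>t. N (v t)) \<longlongrightarrow> N (v s)) (at s within J)"
  proof (rule LIM_zero_cancel, rule Lim_null_comparison)
    show "eventually (\<lambda>t. norm (N (v t) - N (v s)) \<le> K * norm (v t - v s)) (at s within J)"
      using Nsub by simp
    have "((\<lambda>t. K * norm (v t - v s)) \<longlongrightarrow> K * norm (v s - v s)) (at s within J)"
      by (intro tendsto_intros vlim)
    then show "((\<lambda>t. K * norm (v t - v s)) \<longlongrightarrow> 0) (at s within J)" by simp
  qed
  have "(speed J \<gamma> \<longlongrightarrow> N (v s)) (at s within J)"
  proof (rule tendsto_of_ratio_bounds[OF Nlim])
    fix \<epsilon> :: real assume \<epsilon>: "0 < \<epsilon>" "\<epsilon> < 1"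
    obtain V where VV: "openin T V" "p \<in> V" "V \<subseteq> fst c"
      and bd: "\<forall>q\<in>V. \<forall>u. \<epsilon> * F q (tangent_of_chart T A c q u) \<le> N u \<and>
                 \<epsilon> * N u \<le> F q (tangent_of_chart T A c q u)"
      using V[OF \<epsilon>, folded N_def] by (elim exE conjE) (rule that)
    have "eventually (\<lambda>t. \<gamma> t \<in> V) (at s within J)"
      by (rule limitin_eventually_in[OF lim\<gamma> VV(1,2)])
    moreover have "eventually (\<lambda>t. t \<in> J) (at s within J)" by (simp add: eventually_at_filter)
    ultimately show "eventually (\<lambda>t. \<epsilon> * N (v t) \<le> speed J \<gamma> t \<and> \<epsilon> * speed J \<gamma> t \<le> N (v t)) (at s within J)"
    proof eventually_elim
      case (elim t)
      have "c \<in> charts_at T A (\<gamma> t)" using elim(1) VV(3) cc(1) by (auto simp: charts_at_def)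
      from speed_in_chart[OF \<gamma> elim(2) J[OF elim(2)] this]
      show ?case using bd[rule_format, OF elim(1), of "v t"] by (simp add: v_def)
    qed
  qed
  moreover have "N (v s) = speed J \<gamma> s"
    using speed_in_chart[OF \<gamma> s J[OF s]] c by (simp add: N_def v_def p_def)
  ultimately show "(speed J \<gamma> \<longlongrightarrow> speed J \<gamma> s) (at s within J)" by simp
qed

lemma speed_continuous_Icc:
  "C1_curve T A {a..b} \<gamma> \<Longrightarrow> a < b \<Longrightarrow> continuous_on {a..b} (speed {a..b} \<gamma>)"
  by (rule speed_continuous) (assumption, rule at_within_Icc_nontrivial)

lemma length_has_integral:
  assumes "C1_curve T A {a..b} \<gamma>" "a < b"
  shows "(speed {a..b} \<gamma> has_integral finsler_length T A F a b \<gamma>) {a..b}"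
  unfolding finsler_length_eq
  using integrable_continuous_real[OF speed_continuous_Icc[OF assms]] by (rule integrable_integral)

lemma length_nonneg:
  assumes "C1_curve T A {a..b} \<gamma>" "a < b"
  shows "0 \<le> finsler_length T A F a b \<gamma>"
  by (rule has_integral_nonneg[OF length_has_integral[OF assms]])
     (rule speed_nonneg[OF assms(1) _ at_within_Icc_nontrivial[OF assms(2)]])

lemma length_cong:
  assumes "C1_curve T A {a..b} \<gamma>" "a < b" "\<And>t. t \<in> {a..b} \<Longrightarrow> \<eta> t = \<gamma> t"
  shows "finsler_length T A F a b \<eta> = finsler_length T A F a b \<gamma>"
  unfolding finsler_length_eq speed_def
  by (rule integral_cong) (use assms velocity_cong[of "{a..b}" \<gamma> \<eta>] at_within_Icc_nontrivial in auto)

text \<open>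
  The value \<open>m = 1\<close> gives translations and \<open>m = -1\<close> gives reversals. Lengths are preserved as the
  norms are symmetric.
\<close>
lemma length_affine:
  assumes \<gamma>: "C1_curve T A {a..b} \<gamma>" and ab: "a < b" "a' < b'" and m: "\<bar>m\<bar> = 1"
    and im: "(\<lambda>x. (1 / m) *\<^sub>R x + - ((1 / m) *\<^sub>R h)) ` {a..b} = {a'..b'}"
  shows "C1_curve T A {a'..b'} (\<lambda>s. \<gamma> (m * s + h))"
    and "finsler_length T A F a' b' (\<lambda>s. \<gamma> (m * s + h)) = finsler_length T A F a b \<gamma>"
proof -
  have m0: "m \<noteq> 0" using m by auto
  have K: "m * s + h \<in> {a..b}" if "s \<in> {a'..b'}" for s
  proof -
    obtain x where "x \<in> {a..b}" "s = (1 / m) *\<^sub>R x + - ((1 / m) *\<^sub>R h)"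
      using \<open>s \<in> {a'..b'}\<close> unfolding im[symmetric] by blast
    then show ?thesis using m0 by (simp add: field_simps)
  qed
  show C: "C1_curve T A {a'..b'} (\<lambda>s. \<gamma> (m * s + h))" by (rule C1_curve_affine[OF \<gamma> K])
  have sp: "speed {a'..b'} (\<lambda>s. \<gamma> (m * s + h)) s = speed {a..b} \<gamma> (m * s + h)" if s: "s \<in> {a'..b'}" for s
  proof -
    have nt: "at s within {a'..b'} \<noteq> bot" "at (m * s + h) within {a..b} \<noteq> bot"
      using at_within_Icc_nontrivial ab s K[OF s] by blast+
    have "velocity T A {a'..b'} (\<lambda>s. \<gamma> (m * s + h)) s = (\<lambda>c. m *\<^sub>R velocity T A {a..b} \<gamma> (m * s + h) c)"
      by (rule velocity_affine[OF \<gamma> K s nt])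
    then show ?thesis unfolding speed_def
      using F_norm(2)[OF C1_curve_in_topspace[OF \<gamma> K[OF s]] velocity_in_tangent_space[OF \<gamma> K[OF s] nt(2)]] m
      by simp
  qed
  have "((\<lambda>x. speed {a..b} \<gamma> (m *\<^sub>R x + h)) has_integral (1 / \<bar>m\<bar> ^ DIM(real)) *\<^sub>R finsler_length T A F a b \<gamma>)
     ((\<lambda>x. (1 / m) *\<^sub>R x + - ((1 / m) *\<^sub>R h)) ` cbox a b)"
    by (rule has_integral_affinity[OF _ m0]) (use length_has_integral[OF \<gamma> ab(1)] in simp)
  then have "((\<lambda>x. speed {a..b} \<gamma> (m * x + h)) has_integral finsler_length T A F a b \<gamma>) {a'..b'}"
    using im m by simp
  then have "(speed {a'..b'} (\<lambda>s. \<gamma> (m * s + h)) has_integral finsler_length T A F a b \<gamma>) {a'..b'}"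
    by (rule has_integral_eq[rotated]) (simp add: sp)
  with length_has_integral[OF C ab(2)]
  show "finsler_length T A F a' b' (\<lambda>s. \<gamma> (m * s + h)) = finsler_length T A F a b \<gamma>"
    by (rule has_integral_unique)
qed

section \<open>Lengths of piecewise curves between two points\<close>

text \<open>
  The lengths of the finite chains of \<open>C\<^sup>1\<close> curves from \<open>p\<close> to \<open>q\<close>. Consecutive curves keep their
  own parameter intervals, so that concatenation and reversal are inductions over chains; and the
  numbers \<open>L\<close> are exactly the lengths of the piecewise \<open>C\<^sup>1\<close> curves from \<open>p\<close> to \<open>q\<close>.
\<close>
inductive joins :: "'m \<Rightarrow> 'm \<Rightarrow> real \<Rightarrow> bool" where
  start: "p \<in> topspace T \<Longrightarrow> joins p p 0"
| extend: "joins p q L \<Longrightarrow> a < b \<Longrightarrow> C1_curve T A {a..b} \<gamma> \<Longrightarrow> \<gamma> a = q \<Longrightarrow>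
    joins p (\<gamma> b) (L + finsler_length T A F a b \<gamma>)"

lemma joins_single:
  assumes "a < b" "C1_curve T A {a..b} \<gamma>"
  shows "joins (\<gamma> a) (\<gamma> b) (finsler_length T A F a b \<gamma>)"
  using joins.extend[OF joins.start assms refl] C1_curve_in_topspace[OF assms(2), of a] assms(1) by auto

lemma joins_in_topspace: "joins p q L \<Longrightarrow> p \<in> topspace T \<and> q \<in> topspace T"
  by (induction rule: joins.induct) (auto intro: C1_curve_in_topspace)

lemma joins_nonneg: "joins p q L \<Longrightarrow> 0 \<le> L"
  by (induction rule: joins.induct) (auto intro: add_nonneg_nonneg length_nonneg)

lemma joins_trans: "joins q r L' \<Longrightarrow> joins p q L \<Longrightarrow> joins p r (L + L')"
  by (induction rule: joins.induct) (auto simp: add.assoc[symmetric] intro: joins.extend)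

lemma joins_sym: "joins p q L \<Longrightarrow> joins q p L"
proof (induction rule: joins.induct)
  case (extend p q L a b \<gamma>)
  have im: "(\<lambda>x. (1 / (-1)) *\<^sub>R x + - ((1 / (-1)) *\<^sub>R (a + b))) ` {a..b} = {a..b}"
    using image_affinity_atLeastAtMost[of "-1" "a + b" a b] extend.hyps by simp
  note aff = length_affine[OF extend.hyps(3,2,2) _ im]
  have "joins (\<gamma> b) (\<gamma> a) (finsler_length T A F a b \<gamma>)"
    using joins_single[OF extend.hyps(2) aff(1)] aff(2) by simp
  from joins_trans[OF extend.IH[folded extend.hyps(4)] this] extend.hyps(4) show ?case by (simp add: add.commute)
qed (rule joins.start)

text \<open>
  At a break point the velocity relative to the whole interval may be meaningless. In the interior
  of a piece the filters of the piece and of the whole interval coincide, and finitely many points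
  do not matter for an integral.
\<close>
lemma piece_speed_eq:
  assumes "a \<le> a'" "b' \<le> b" "t \<in> {a'<..<b'}"
  shows "speed {a..b} \<gamma> t = speed {a'..b'} \<gamma> t"
proof -
  have "at t within {a..b} = at t" "at t within {a'..b'} = at t"
    using assms by (auto intro!: at_within_interior)
  then show ?thesis unfolding speed_def velocity_def by (simp only:)
qed

lemma pieces_mono:
  fixes \<tau> :: "nat \<Rightarrow> real"
  assumes "\<And>i. i < n \<Longrightarrow> \<tau> i < \<tau> (Suc i)" "i \<le> j" "j \<le> n"
  shows "\<tau> i \<le> \<tau> j"
  using assms(2,3)
proof (induction j rule: dec_induct)
  case (step j)
  then show ?case using assms(1)[of j] by simp
qed simp

lemma pieces_length:
  fixes \<tau> :: "nat \<Rightarrow> real"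
  assumes \<tau>: "\<And>i. i < n \<Longrightarrow> \<tau> i < \<tau> (Suc i)"
    and \<gamma>: "\<And>i. i < n \<Longrightarrow> C1_curve T A {\<tau> i..\<tau> (Suc i)} \<gamma>"
  shows "finsler_length T A F (\<tau> 0) (\<tau> n) \<gamma> = (\<Sum>i<n. finsler_length T A F (\<tau> i) (\<tau> (Suc i)) \<gamma>)"
proof -
  have "(speed {\<tau> 0..\<tau> n} \<gamma> has_integral (\<Sum>i<j. finsler_length T A F (\<tau> i) (\<tau> (Suc i)) \<gamma>)) {\<tau> 0..\<tau> j}"
    if "j \<le> n" for j
    using that
  proof (induction j)
    case 0
    then show ?case using has_integral_null_real[of "\<tau> 0" "\<tau> 0"] by simp
  next
    case (Suc j)
    then have j: "j < n" by simp
    have le: "\<tau> 0 \<le> \<tau> j" "\<tau> (Suc j) \<le> \<tau> n" "\<tau> j \<le> \<tau> (Suc j)"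
      using pieces_mono[of n \<tau>, OF \<tau>] j by auto
    have "(speed {\<tau> 0..\<tau> n} \<gamma> has_integral finsler_length T A F (\<tau> j) (\<tau> (Suc j)) \<gamma>) (cbox (\<tau> j) (\<tau> (Suc j)))"
    proof (rule has_integral_spike_interior)
      show "(speed {\<tau> j..\<tau> (Suc j)} \<gamma> has_integral finsler_length T A F (\<tau> j) (\<tau> (Suc j)) \<gamma>) (cbox (\<tau> j) (\<tau> (Suc j)))"
        using length_has_integral[OF \<gamma>[OF j] \<tau>[OF j]] by simp
    qed (use le in \<open>auto intro!: piece_speed_eq\<close>)
    then show ?case
      using has_integral_combine[OF le(1,3) Suc.IH] j by simp
  qed
  from integral_unique[OF this[of n]] show ?thesis by (simp add: finsler_length_eq)
qed

lemma piecewise_imp_joins: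
  assumes "piecewise_C1_curve T A a b \<gamma>"
  shows "joins (\<gamma> a) (\<gamma> b) (finsler_length T A F a b \<gamma>)"
proof -
  obtain n :: nat and \<tau> :: "nat \<Rightarrow> real" where \<tau>: "\<tau> 0 = a" "\<tau> n = b" "\<And>i. i < n \<Longrightarrow> \<tau> i < \<tau> (Suc i)"
    and \<gamma>: "\<And>i. i < n \<Longrightarrow> C1_curve T A {\<tau> i..\<tau> (Suc i)} \<gamma>" and ab: "a < b"
    using assms unfolding piecewise_C1_curve_def by blast
  have n: "0 < n" using \<tau> ab by (cases n) auto
  have "joins (\<gamma> (\<tau> 0)) (\<gamma> (\<tau> j)) (\<Sum>i<j. finsler_length T A F (\<tau> i) (\<tau> (Suc i)) \<gamma>)" if "j \<le> n" for j
    using that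
  proof (induction j)
    case 0
    then show ?case
      using joins.start C1_curve_in_topspace[OF \<gamma>[OF n], of "\<tau> 0"] \<tau>(3)[OF n] by simp
  next
    case (Suc j)
    then show ?case
      using joins.extend[OF Suc.IH \<tau>(3) \<gamma>] by simp
  qed
  from this[of n] pieces_length[of n \<tau> \<gamma>, OF \<tau>(3) \<gamma>] \<tau>(1,2) show ?thesis by simp
qed

text \<open>
  A further \<open>C\<^sup>1\<close> piece is appended after a translation that makes it start at the time at which the
  curve constructed so far ends. The trivial chain is realized by a constant curve, as a
  piecewise \<open>C\<^sup>1\<close> curve has at least one piece.
\<close>
lemma joins_imp_piecewise:
  assumes "joins p q L"
  shows "\<exists>a b \<gamma>. piecewise_C1_curve T A a b \<gamma> \<and> \<gamma> a = p \<and> \<gamma> b = q \<and> finsler_length T A F a b \<gamma> = L"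
  using assms
proof (induction rule: joins.induct)
  case (start p)
  obtain c where c: "c \<in> charts_at T A p" using charts_at_nonempty[OF start] .
  note cc = charts_atD[OF c]
  have C: "C1_curve T A {0..1} (\<lambda>_. p)"
  proof (rule C1_curve_in_chart[OF cc(1), where D = "\<lambda>_. 0"])
    show "limitin T (\<lambda>_. p) p (at t within {0..1})" for t :: real
      using start by (simp add: limitin_def)
  qed (use cc in auto)
  have "speed {0..1} (\<lambda>_. p) t = 0" if t: "t \<in> {0..1}" for t :: real
  proof -
    have nt: "at t within {0..1} \<noteq> bot" by (rule at_within_Icc_nontrivial) (use t in auto)
    note v = velocity_in_tangent_space[OF C t nt]
    have "velocity T A {0..1} (\<lambda>_. p) t = (\<lambda>c. 0 *\<^sub>R velocity T A {0..1} (\<lambda>_. p) t c)"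
    proof (rule velocity_eqI[OF C1_curve_limitin[OF C t] t nt c tangent_space_scale[OF v]])
    qed simp
    then show ?thesis using F_norm(2)[OF start v, of 0] unfolding speed_def by simp
  qed
  then have "finsler_length T A F 0 1 (\<lambda>_. p) = integral {0..1::real} (\<lambda>_. 0)"
    unfolding finsler_length_eq by (intro integral_cong)
  then have "finsler_length T A F 0 1 (\<lambda>_. p) = 0" by simp
  moreover have "piecewise_C1_curve T A 0 1 (\<lambda>_. p)"
    unfolding piecewise_C1_curve_def using C by (auto intro!: exI[of _ "1::nat"] exI[of _ real])
  ultimately show ?case by (intro exI[of _ 0] exI[of _ 1] exI[of _ "\<lambda>_. p"]) simp
next
  case (extend p q L c d \<eta>)
  then obtain a b \<gamma> where pw: "piecewise_C1_curve T A a b \<gamma>" and \<gamma>ab: "\<gamma> a = p" "\<gamma> b = q"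
    and len: "finsler_length T A F a b \<gamma> = L" by blast
  obtain n :: nat and \<tau> :: "nat \<Rightarrow> real" where \<tau>: "\<tau> 0 = a" "\<tau> n = b" "\<And>i. i < n \<Longrightarrow> \<tau> i < \<tau> (Suc i)"
    and \<gamma>: "\<And>i. i < n \<Longrightarrow> C1_curve T A {\<tau> i..\<tau> (Suc i)} \<gamma>" and ab: "a < b"
    using pw unfolding piecewise_C1_curve_def by blast
  define h where "h = c - b"
  define e where "e = b + (d - c)"
  define \<zeta> where "\<zeta> t = (if t \<le> b then \<gamma> t else \<eta> (1 * t + h))" for t
  define \<sigma> where "\<sigma> i = (if i \<le> n then \<tau> i else e)" for i
  have be: "b < e" using extend.hyps(2) by (simp add: e_def)
  have im: "(\<lambda>x. (1 / 1) *\<^sub>R x + - ((1 / 1) *\<^sub>R h)) ` {c..d} = {b..e}"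
    using image_affinity_atLeastAtMost[of 1 "-h" c d] extend.hyps(2)
    by (simp add: h_def e_def algebra_simps)
  note aff = length_affine[OF extend.hyps(3,2) be _ im]
  have \<zeta>2: "\<zeta> t = \<eta> (1 * t + h)" if "t \<in> {b..e}" for t
    using that \<gamma>ab extend.hyps(4) by (cases "t = b") (auto simp: \<zeta>_def h_def)
  have C2: "C1_curve T A {b..e} \<zeta>"
    by (rule C1_curve_cong[OF aff(1)]) (use \<zeta>2 in auto)
  have L2: "finsler_length T A F b e \<zeta> = finsler_length T A F c d \<eta>"
    using length_cong[OF aff(1) be \<zeta>2] aff(2) by simp
  have le: "\<tau> (Suc i) \<le> b" if "i < n" for i
    using pieces_mono[of n \<tau> "Suc i" n, OF \<tau>(3)] that \<tau>(2) by simp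
  have \<zeta>1: "\<zeta> t = \<gamma> t" if "i < n" "t \<in> {\<tau> i..\<tau> (Suc i)}" for i t
    using le[OF that(1)] that(2) by (simp add: \<zeta>_def)
  have \<sigma>: "\<sigma> i < \<sigma> (Suc i)" "C1_curve T A {\<sigma> i..\<sigma> (Suc i)} \<zeta>" if i: "i < Suc n" for i
  proof -
    consider "i < n" | "i = n" using i by linarith
    then have "\<sigma> i < \<sigma> (Suc i) \<and> C1_curve T A {\<sigma> i..\<sigma> (Suc i)} \<zeta>"
    proof cases
      case 1
      then show ?thesis using \<tau>(3) C1_curve_cong[OF \<gamma>[OF 1] \<zeta>1[OF 1]] by (simp add: \<sigma>_def)
    next
      case 2
      then show ?thesis using \<tau>(2) be C2 by (simp add: \<sigma>_def)
    qed
    then show "\<sigma> i < \<sigma> (Suc i)" "C1_curve T A {\<sigma> i..\<sigma> (Suc i)} \<zeta>" by auto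
  qed
  have ends: "\<sigma> 0 = a" "\<sigma> (Suc n) = e" using \<tau>(1) by (simp_all add: \<sigma>_def)
  have ae: "a < e" using ab be by simp
  have "piecewise_C1_curve T A a e \<zeta>"
    unfolding piecewise_C1_curve_def
    by (intro conjI ae exI[of _ "Suc n"] exI[of _ \<sigma>] ends allI impI \<sigma>)
  moreover have "\<zeta> a = p" using ab \<gamma>ab(1) by (simp add: \<zeta>_def)
  moreover have "\<zeta> e = \<eta> d" using \<zeta>2[of e] be by (simp add: e_def h_def)
  moreover have "finsler_length T A F a e \<zeta> = L + finsler_length T A F c d \<eta>"
  proof -
    have "finsler_length T A F a e \<zeta> = (\<Sum>i<Suc n. finsler_length T A F (\<sigma> i) (\<sigma> (Suc i)) \<zeta>)"
      using pieces_length[of "Suc n" \<sigma> \<zeta>, OF \<sigma>] ends by simp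
    also have "\<dots> = (\<Sum>i<n. finsler_length T A F (\<sigma> i) (\<sigma> (Suc i)) \<zeta>) + finsler_length T A F b e \<zeta>"
      using \<tau>(2) by (simp add: \<sigma>_def)
    also have "(\<Sum>i<n. finsler_length T A F (\<sigma> i) (\<sigma> (Suc i)) \<zeta>)
        = (\<Sum>i<n. finsler_length T A F (\<tau> i) (\<tau> (Suc i)) \<gamma>)"
    proof (rule sum.cong)
      fix i assume "i \<in> {..<n}"
      then have i: "i < n" by simp
      show "finsler_length T A F (\<sigma> i) (\<sigma> (Suc i)) \<zeta> = finsler_length T A F (\<tau> i) (\<tau> (Suc i)) \<gamma>"
        using length_cong[OF \<gamma>[OF i] \<tau>(3)[OF i] \<zeta>1[OF i]] i by (simp add: \<sigma>_def)
    qed simp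
    also have "\<dots> = L" using pieces_length[of n \<tau> \<gamma>, OF \<tau>(3) \<gamma>] \<tau>(1,2) len by simp
    finally show ?thesis using L2 by simp
  qed
  ultimately show ?case by blast
qed

lemma finsler_dist_eq_Inf:
  assumes "p \<in> topspace T" "q \<in> topspace T"
  shows "finsler_dist T A F p q = Inf {L. joins p q L}"
proof -
  have "{finsler_length T A F a b \<gamma> | a b \<gamma>. piecewise_C1_curve T A a b \<gamma> \<and> \<gamma> a = p \<and> \<gamma> b = q} = {L. joins p q L}"
  proof (intro set_eqI iffI)
    fix L assume "L \<in> {finsler_length T A F a b \<gamma> | a b \<gamma>. piecewise_C1_curve T A a b \<gamma> \<and> \<gamma> a = p \<and> \<gamma> b = q}"
    then show "L \<in> {L. joins p q L}" using piecewise_imp_joins by auto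
  next
    fix L assume "L \<in> {L. joins p q L}"
    then obtain a b \<gamma> where "piecewise_C1_curve T A a b \<gamma>" "\<gamma> a = p" "\<gamma> b = q" "finsler_length T A F a b \<gamma> = L"
      using joins_imp_piecewise[of p q L] by auto
    then show "L \<in> {finsler_length T A F a b \<gamma> | a b \<gamma>. piecewise_C1_curve T A a b \<gamma> \<and> \<gamma> a = p \<and> \<gamma> b = q}"
      by auto
  qed
  then show ?thesis using assms by (simp add: finsler_dist_def)
qed

text \<open>
  Points of a chart ball are joined to its centre by segments.
\<close>
lemma joins_nearby:
  assumes p: "p \<in> topspace T"
  shows "\<exists>U. openin T U \<and> p \<in> U \<and> (\<forall>q\<in>U. \<exists>L. joins p q L)"
proof -
  obtain c where c: "c \<in> charts_at T A p" using charts_at_nonempty[OF p] .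
  note cc = charts_atD[OF c]
  define x where "x = snd c p"
  obtain r where r: "0 < r" "ball x r \<subseteq> snd c ` fst c"
    using open_contains_ball[THEN iffD1, OF charts_open[OF cc(1)]] cc(2) unfolding x_def by blast
  have "\<exists>L. joins p q L" if q: "q \<in> fst c" "snd c q \<in> ball x r" for q
  proof -
    let ?\<gamma> = "\<lambda>t. chart_inv c (x + t *\<^sub>R (snd c q - x))"
    have "x + t *\<^sub>R (snd c q - x) \<in> ball x r" if t: "t \<in> {0..1}" for t
    proof -
      have "norm (t *\<^sub>R (snd c q - x)) \<le> 1 * norm (snd c q - x)"
        unfolding norm_scaleR using t by (intro mult_right_mono) auto
      then show ?thesis using q(2) by (simp add: dist_norm norm_minus_commute)
    qed
    then have "C1_curve T A {0..1} ?\<gamma>" using r(2) by (intro C1_curve_segment[OF cc(1)]) blast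
    from joins_single[OF _ this] show ?thesis
      using chart_inv_left[OF cc(3)] cc(2) q(1) by (auto simp: x_def)
  qed
  moreover have "openin T {q \<in> fst c. snd c q \<in> ball x r}"
    by (rule chart_vimage_open[OF cc(3)]) simp
  ultimately show ?thesis
    using cc(2) r(1) by (intro exI[of _ "{q \<in> fst c. snd c q \<in> ball x r}"]) (auto simp: x_def)
qed

text \<open>
  The points that can be reached from \<open>p\<close> form a set that is open and closed.
\<close>
lemma joins_exists:
  assumes p: "p \<in> topspace T" and q: "q \<in> topspace T"
  shows "\<exists>L. joins p q L"
proof -
  define R where "R = {q. \<exists>L. joins p q L}"
  have RT: "R \<subseteq> topspace T" unfolding R_def using joins_in_topspace by blast
  have "openin T R"
    unfolding openin_subopen[of T R]
  proof
    fix x assume "x \<in> R"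
    then obtain U where U: "openin T U" "x \<in> U" "\<forall>y\<in>U. \<exists>L. joins x y L" using joins_nearby RT by blast
    have "U \<subseteq> R" using U(3) \<open>x \<in> R\<close> joins_trans unfolding R_def by blast
    then show "\<exists>V. openin T V \<and> x \<in> V \<and> V \<subseteq> R" using U by blast
  qed
  moreover have "openin T (topspace T - R)"
    unfolding openin_subopen[of T "topspace T - R"]
  proof
    fix x assume x: "x \<in> topspace T - R"
    then obtain U where U: "openin T U" "x \<in> U" "\<forall>y\<in>U. \<exists>L. joins x y L" using joins_nearby by blast
    have "U \<inter> R = {}" using U(3) x joins_trans joins_sym unfolding R_def by blast
    then show "\<exists>V. openin T V \<and> x \<in> V \<and> V \<subseteq> topspace T - R" using U openin_subset by blast
  qed
  then have "closedin T R" using RT by (simp add: closedin_def)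
  moreover have "p \<in> R" using joins.start[OF p] unfolding R_def by blast
  moreover have "connected_space T" using mfd by (simp add: banach_manifold_def)
  ultimately have "R = topspace T" unfolding connected_space_clopen_in by blast
  then show ?thesis using q unfolding R_def by blast
qed

lemma dist_le_joins:
  assumes "joins p q L" shows "finsler_dist T A F p q \<le> L"
proof -
  have "bdd_below {L. joins p q L}" using joins_nonneg by (auto intro!: bdd_belowI[of _ 0])
  then have "Inf {L. joins p q L} \<le> L" using assms by (intro cInf_lower) auto
  then show ?thesis using joins_in_topspace[OF assms] by (simp add: finsler_dist_eq_Inf)
qed

lemma dist_less_joins:
  assumes "p \<in> topspace T" "q \<in> topspace T" "finsler_dist T A F p q < e"
  obtains L where "joins p q L" "L < e"
  using cInf_lessD[of "{L. joins p q L}" e] joins_exists assms that by (auto simp: finsler_dist_eq_Inf)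

lemma dist_nonneg: "0 \<le> finsler_dist T A F p q"
proof (cases "p \<in> topspace T \<and> q \<in> topspace T")
  case True
  then have "0 \<le> Inf {L. joins p q L}" using joins_exists joins_nonneg by (intro cInf_greatest) auto
  then show ?thesis using True by (simp add: finsler_dist_eq_Inf)
qed (auto simp: finsler_dist_def)

lemma dist_le_length:
  assumes "C1_curve T A {a..b} \<gamma>" "a < b"
  shows "finsler_dist T A F (\<gamma> a) (\<gamma> b) \<le> finsler_length T A F a b \<gamma>"
  by (rule dist_le_joins[OF joins_single[OF assms(2,1)]])

section \<open>The Finsler distance is a metric whose convergence implies convergence in the manifold\<close>

text \<open>
  The displacement in the chart is the integral of the derivative, whose norm is at most
  \<open>1 / k\<close> times the speed.
\<close>
lemma displacement_le_length:
  assumes \<gamma>: "C1_curve T A {a..b} \<gamma>" and ab: "a < b" and c: "c \<in> charts T A" and k: "0 < k"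
    and inB: "\<And>t. t \<in> {a..b} \<Longrightarrow> \<gamma> t \<in> fst c"
    and low: "\<And>t u. t \<in> {a..b} \<Longrightarrow> k * norm u \<le> F (\<gamma> t) (tangent_of_chart T A c (\<gamma> t) u)"
  shows "k * norm (snd c (\<gamma> b) - snd c (\<gamma> a)) \<le> finsler_length T A F a b \<gamma>"
proof -
  let ?D = "\<lambda>t. velocity T A {a..b} \<gamma> t c"
  have nt: "at t within {a..b} \<noteq> bot" if "t \<in> {a..b}" for t
    using at_within_Icc_nontrivial[OF ab that] .
  have cat: "c \<in> charts_at T A (\<gamma> t)" if "t \<in> {a..b}" for t
    using inB[OF that] c by (simp add: charts_at_def)
  have hi: "(?D has_integral (snd c (\<gamma> b) - snd c (\<gamma> a))) {a..b}"
    using ab velocity_in_chart[OF \<gamma> _ nt cat] by (intro fundamental_theorem_of_calculus) auto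
  have si: "(speed {a..b} \<gamma> has_integral finsler_length T A F a b \<gamma>) {a..b}"
    by (rule length_has_integral[OF \<gamma> ab])
  have "norm (integral {a..b} ?D) \<le> integral {a..b} (\<lambda>t. speed {a..b} \<gamma> t / k)"
  proof (rule integral_norm_bound_integral)
    show "?D integrable_on {a..b}" using hi by (rule has_integral_integrable)
    show "(\<lambda>t. speed {a..b} \<gamma> t / k) integrable_on {a..b}"
      using si integrable_on_divide has_integral_integrable by blast
    fix t assume t: "t \<in> {a..b}"
    show "norm (?D t) \<le> speed {a..b} \<gamma> t / k"
      using low[OF t, of "?D t"] k speed_in_chart[OF \<gamma> t nt[OF t] cat[OF t]] by (simp add: field_simps)
  qed
  also have "\<dots> = finsler_length T A F a b \<gamma> / k"
    using integral_unique[OF si] by simp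
  finally show ?thesis using integral_unique[OF hi] k by (simp add: field_simps)
qed

text \<open>
  The continuity condition of a Finsler metric with ratio \<open>1/2\<close> transfers the lower bound for the norm at \<open>p\<close>
  to the nearby norms.
\<close>
lemma uniform_lower_bound:
  assumes p: "p \<in> topspace T"
  obtains c k r where "c \<in> charts_at T A p" "0 < k" "0 < r" "ball (snd c p) r \<subseteq> snd c ` fst c"
    "\<And>q u. q \<in> fst c \<Longrightarrow> snd c q \<in> ball (snd c p) r \<Longrightarrow> k * norm u \<le> F q (tangent_of_chart T A c q u)"
proof -
  obtain c k where c: "c \<in> charts_at T A p" and k: "0 < k"
    and Nk: "\<And>u. k * norm u \<le> F p (tangent_of_chart T A c p u)"
    and V: "\<And>\<epsilon>. 0 < \<epsilon> \<Longrightarrow> \<epsilon> < 1 \<Longrightarrow> \<exists>V. openin T V \<and> p \<in> V \<and> V \<subseteq> fst c \<and>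
      (\<forall>q\<in>V. \<forall>u. \<epsilon> * F q (tangent_of_chart T A c q u) \<le> F p (tangent_of_chart T A c p u) \<and>
                 \<epsilon> * F p (tangent_of_chart T A c p u) \<le> F q (tangent_of_chart T A c q u))"
    by (rule finsler_chart[OF p]) blast
  note cc = charts_atD[OF c]
  have half: "0 < (1/2::real)" "(1/2::real) < 1" by auto
  obtain V where VV: "openin T V" "p \<in> V" "V \<subseteq> fst c"
    and bd: "\<forall>q\<in>V. \<forall>u. 1/2 * F q (tangent_of_chart T A c q u) \<le> F p (tangent_of_chart T A c p u) \<and>
                 1/2 * F p (tangent_of_chart T A c p u) \<le> F q (tangent_of_chart T A c q u)"
    using V[OF half] by (elim exE conjE) (rule that)
  have "open (snd c ` V)" by (rule is_chart_homeo(4)[OF cc(3) VV(1,3)])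
  then obtain r where r: "0 < r" "ball (snd c p) r \<subseteq> snd c ` V"
    using VV(2) open_contains_ball by blast
  show thesis
  proof (rule that[OF c _ r(1)])
    show "0 < k / 2" using k by simp
    show "ball (snd c p) r \<subseteq> snd c ` fst c" using r(2) VV(3) by blast
    fix q u assume q: "q \<in> fst c" "snd c q \<in> ball (snd c p) r"
    then obtain q' where "q' \<in> V" "snd c q = snd c q'" using r(2) by blast
    then have "q \<in> V" using inj_onD[OF is_chart_homeo(1)[OF cc(3)]] q(1) VV(3) by blast
    from bd[rule_format, OF this, of u] Nk[of u]
    show "k / 2 * norm u \<le> F q (tangent_of_chart T A c q u)" by linarith
  qed
qed

lemma subcurve_length:
  assumes \<gamma>: "C1_curve T A {a..b} \<gamma>" and st: "a \<le> s" "s < t" "t \<le> b"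
  shows "C1_curve T A {s..t} \<gamma>"
    and "finsler_length T A F s t \<gamma> = integral {s..t} (speed {a..b} \<gamma>)"
    and "finsler_length T A F s t \<gamma> \<le> finsler_length T A F a b \<gamma>"
proof -
  have sub: "{s..t} \<subseteq> {a..b}" using st by auto
  show C: "C1_curve T A {s..t} \<gamma>" by (rule C1_curve_subset[OF \<gamma> sub])
  have ab: "a < b" using st by simp
  have eq: "speed {s..t} \<gamma> x = speed {a..b} \<gamma> x" if "x \<in> {s..t}" for x
    unfolding speed_def velocity_subset[OF \<gamma> sub that at_within_Icc_nontrivial[OF st(2) that]] ..
  show l: "finsler_length T A F s t \<gamma> = integral {s..t} (speed {a..b} \<gamma>)"
    unfolding finsler_length_eq by (rule integral_cong) (rule eq)
  have ci: "continuous_on {a..b} (speed {a..b} \<gamma>)" by (rule speed_continuous_Icc[OF \<gamma> ab])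
  have "integral {s..t} (speed {a..b} \<gamma>) \<le> integral {a..b} (speed {a..b} \<gamma>)"
  proof (rule integral_subset_le[OF sub])
    show "speed {a..b} \<gamma> integrable_on {s..t}"
      by (rule integrable_continuous_real[OF continuous_on_subset[OF ci sub]])
    show "speed {a..b} \<gamma> integrable_on {a..b}" by (rule integrable_continuous_real[OF ci])
    show "\<forall>x\<in>{a..b}. 0 \<le> speed {a..b} \<gamma> x"
      using speed_nonneg[OF \<gamma> _ at_within_Icc_nontrivial[OF ab]] by blast
  qed
  then show "finsler_length T A F s t \<gamma> \<le> finsler_length T A F a b \<gamma>"
    unfolding l by (simp only: finsler_length_eq)
qed

text \<open>
  Suppose that the curve leaves the ball, first at time \<open>e\<close>. Before \<open>e\<close> its representative in the
  chart is Lipschitz, so by completeness of the model space it converges to some \<open>y\<close> as time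
  tends to \<open>e\<close>. As the curve is short, its representative stays in a closed ball of radius \<open>R < r\<close>,
  and \<open>y\<close> lies in it. Limits in a Hausdorff space being unique, \<open>\<gamma> e\<close> is the point with coordinate
  \<open>y\<close> and has not left the ball.
\<close>
lemma short_curve_stays_in_chart_ball:
  assumes c: "c \<in> charts T A" and k: "0 < k" and img: "ball x r \<subseteq> snd c ` fst c"
    and low: "\<And>q u. q \<in> fst c \<Longrightarrow> snd c q \<in> ball x r \<Longrightarrow> k * norm u \<le> F q (tangent_of_chart T A c q u)"
    and \<gamma>: "C1_curve T A {a..b} \<gamma>" and ab: "a < b"
    and start: "\<gamma> a \<in> fst c" "snd c (\<gamma> a) \<in> ball x r"
    and short: "finsler_length T A F a b \<gamma> < k * (r - norm (snd c (\<gamma> a) - x))"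
  shows "\<gamma> b \<in> fst c \<and> snd c (\<gamma> b) \<in> ball x r \<and>
    k * norm (snd c (\<gamma> b) - snd c (\<gamma> a)) \<le> finsler_length T A F a b \<gamma>"
proof -
  define B where "B = {q \<in> fst c. snd c q \<in> ball x r}"
  note cc = charts_is_chart[OF c]
  have oB: "openin T B" unfolding B_def by (rule chart_vimage_open[OF cc]) simp
  have disp: "k * norm (snd c (\<gamma> t) - snd c (\<gamma> s)) \<le> finsler_length T A F s t \<gamma>"
    if st: "a \<le> s" "s < t" "t \<le> b" and "\<And>\<tau>. \<tau> \<in> {s..t} \<Longrightarrow> \<gamma> \<tau> \<in> B" for s t
    by (rule displacement_le_length[OF subcurve_length(1)[OF \<gamma> st] st(2) c k]) (use that(4) low in \<open>auto simp: B_def\<close>)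
  have all: "\<gamma> t \<in> B" if "t \<in> {a..b}" for t
  proof (rule ccontr)
    assume nB: "\<gamma> t \<notin> B"
    define E where "E = {t \<in> {a..b}. \<gamma> t \<notin> B}"
    have "closedin (top_of_set {a..b}) E"
    proof -
      have "continuous_map (top_of_set {a..b}) T \<gamma>" using \<gamma> by (simp add: C1_curve_def)
      from openin_continuous_map_preimage[OF this oB]
      have "openin (top_of_set {a..b}) {t \<in> {a..b}. \<gamma> t \<in> B}" by simp
      moreover have "E = {a..b} - {t \<in> {a..b}. \<gamma> t \<in> B}" by (auto simp: E_def)
      ultimately show ?thesis using closedin_diff[OF closedin_topspace, of "top_of_set {a..b}"] by simp
    qed
    then have clE: "closed E" by (rule closedin_closed_trans) simp
    have Ene: "E \<noteq> {}" "bdd_below E" using nB that by (auto simp: E_def intro!: bdd_belowI[of _ a])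
    define e where "e = Inf E"
    \<comment> \<open>The exit time \<open>e\<close> is attained, because the ball is open in the manifold.\<close>
    have eE: "e \<in> E" unfolding e_def by (rule closed_contains_Inf[OF Ene clE])
    then have e: "e \<in> {a..b}" "\<gamma> e \<notin> B" by (auto simp: E_def)
    have "\<gamma> a \<in> B" using start by (simp add: B_def)
    then have ae: "a < e" using e by (cases "e = a") auto
    have before: "\<gamma> t \<in> B" if "a \<le> t" "t < e" for t
      using that e(1) cInf_lower[OF _ Ene(2), of t] unfolding e_def[symmetric] by (force simp: E_def)
    have ci: "continuous_on {a..b} (speed {a..b} \<gamma>)" by (rule speed_continuous_Icc[OF \<gamma> ab])
    obtain S where S: "\<And>t. t \<in> {a..b} \<Longrightarrow> norm (speed {a..b} \<gamma> t) \<le> S"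
      using compact_imp_bounded[OF compact_continuous_image[OF ci compact_Icc]]
      unfolding bounded_iff by blast
    have S0: "0 \<le> S" using S[of a] ab norm_ge_zero order_trans by (metis atLeastAtMost_iff less_imp_le order_refl)
    let ?f = "\<lambda>t. snd c (\<gamma> t)"
    have lip: "norm (?f t - ?f s) \<le> S / k * (t - s)" if "a \<le> s" "s < t" "t < e" for s t
    proof -
      have st: "a \<le> s" "s < t" "t \<le> b" using that e(1) by auto
      have "k * norm (?f t - ?f s) \<le> finsler_length T A F s t \<gamma>"
        by (rule disp[OF st]) (use that before in auto)
      also have "\<dots> \<le> norm (integral {s..t} (speed {a..b} \<gamma>))"
        unfolding subcurve_length(2)[OF \<gamma> st] by simp
      also have "\<dots> \<le> S * (t - s)"
        by (rule integral_bound) (use st S in \<open>auto intro: continuous_on_subset[OF ci]\<close>)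
      finally show ?thesis using k by (simp add: field_simps)
    qed
    have "(S / k)-lipschitz_on {a..<e} ?f"
    proof (rule lipschitz_onI)
      fix s t assume st: "s \<in> {a..<e}" "t \<in> {a..<e}"
      show "dist (?f s) (?f t) \<le> S / k * dist s t"
        using lip[of s t] lip[of t s] st by (cases s t rule: linorder_cases) (auto simp: dist_norm norm_minus_commute)
    qed (use S0 k in simp)
    then have "uniformly_continuous_on {a..<e} ?f" by (rule lipschitz_on_uniformly_continuous)
    moreover have "e \<in> closure {a..<e}" using ae by (simp add: closure_atLeastLessThan)
    ultimately obtain y where y: "(?f \<longlongrightarrow> y) (at e within {a..<e})"
      by (rule uniformly_continuous_on_extension_at_closure)
    have nt: "at e within {a..<e} \<noteq> bot"
      using ae by (simp add: trivial_limit_within islimpt_Ico)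
    \<comment> \<open>Before time \<open>e\<close> the curve gets no further from the centre than \<open>R\<close>.\<close>
    define R where "R = norm (?f a - x) + finsler_length T A F a b \<gamma> / k"
    have Rr: "R < r" using short k by (simp add: R_def field_simps)
    have "y \<in> cball x R"
    proof (rule Lim_in_closed_set[OF closed_cball _ nt y])
      have "?f t \<in> cball x R" if "a < t" "t < e" for t
      proof -
        have st: "a \<le> a" "a < t" "t \<le> b" using that e(1) by auto
        have "k * norm (?f t - ?f a) \<le> finsler_length T A F a t \<gamma>"
          by (rule disp[OF st]) (use that before in auto)
        also have "\<dots> \<le> finsler_length T A F a b \<gamma>" by (rule subcurve_length(3)[OF \<gamma> st])
        finally have "norm (?f t - ?f a) \<le> finsler_length T A F a b \<gamma> / k" using k by (simp add: field_simps)
        then show ?thesis using norm_triangle_ineq[of "?f t - ?f a" "?f a - x"]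
          by (simp add: R_def dist_norm norm_minus_commute)
      qed
      moreover have "eventually (\<lambda>t. t \<in> {a<..<e}) (at e within {a..<e})"
        unfolding eventually_at by (rule exI[of _ "e - a"]) (use ae in \<open>auto simp: dist_real_def\<close>)
      ultimately show "eventually (\<lambda>t. ?f t \<in> cball x R) (at e within {a..<e})"
        by (auto elim: eventually_mono)
    qed
    then have yb: "y \<in> ball x r" using Rr by simp
    then have yi: "y \<in> snd c ` fst c" using img by blast
    have "limitin T (\<lambda>s. chart_inv c (?f s)) (chart_inv c y) (at e within {a..<e})"
      by (rule limitin_chart_inv[OF c y yi])
    moreover have "eventually (\<lambda>s. chart_inv c (?f s) = \<gamma> s) (at e within {a..<e})"
      using before by (auto simp: eventually_at_filter B_def chart_inv_left[OF cc])
    ultimately have l1: "limitin T \<gamma> (chart_inv c y) (at e within {a..<e})"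
      by (rule limitin_transform_eventually[rotated])
    have "limitin T \<gamma> (\<gamma> e) (at e within {a..b})" by (rule C1_curve_limitin[OF \<gamma> e(1)])
    then have l2: "limitin T \<gamma> (\<gamma> e) (at e within {a..<e})"
      by (rule limitin_mono) (use e(1) in \<open>auto intro: at_le\<close>)
    have "chart_inv c y = \<gamma> e"
      using limitin_Hausdorff_unique[OF l1 l2 nt] mfd by (simp add: banach_manifold_def)
    then have "\<gamma> e \<in> B" using chart_inv_in[OF yi] chart_inv_right[OF yi] yb by (auto simp: B_def)
    then show False using e(2) by blast
  qed
  have "\<gamma> b \<in> B" by (rule all) (use ab in auto)
  moreover have "k * norm (snd c (\<gamma> b) - snd c (\<gamma> a)) \<le> finsler_length T A F a b \<gamma>"
    by (rule disp) (use ab all in auto)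
  ultimately show ?thesis by (simp add: B_def)
qed

text \<open>
  Along a chain of \<open>C\<^sup>1\<close> curves, the length already spent bounds the distance from the centre, and
  what is left of \<open>k * r\<close> is not enough for the next curve to leave the ball.
\<close>
lemma joins_lower_bound:
  assumes c: "c \<in> charts T A" and k: "0 < k" and img: "ball x r \<subseteq> snd c ` fst c"
    and low: "\<And>q u. q \<in> fst c \<Longrightarrow> snd c q \<in> ball x r \<Longrightarrow> k * norm u \<le> F q (tangent_of_chart T A c q u)"
    and "joins p q L" and p: "p \<in> fst c" "snd c p = x" and "L < k * r"
  shows "q \<in> fst c \<and> snd c q \<in> ball x r \<and> k * norm (snd c q - x) \<le> L"
  using assms(5) p assms(8)
proof (induction rule: joins.induct)
  case (start p)
  then show ?case using k by (simp add: zero_less_mult_iff)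
next
  case (extend p q L a b \<gamma>)
  let ?l = "finsler_length T A F a b \<gamma>"
  have l0: "0 \<le> ?l" by (rule length_nonneg[OF extend.hyps(3,2)])
  have IH: "q \<in> fst c" "snd c q \<in> ball x r" "k * norm (snd c q - x) \<le> L"
    using extend l0 by auto
  have "?l < k * (r - norm (snd c q - x))"
    using IH(3) extend.prems(3) by (simp add: algebra_simps)
  then have *: "\<gamma> b \<in> fst c \<and> snd c (\<gamma> b) \<in> ball x r \<and> k * norm (snd c (\<gamma> b) - snd c q) \<le> ?l"
    using short_curve_stays_in_chart_ball[OF c k img low extend.hyps(3,2)] IH(1,2) extend.hyps(4) by simp
  have "norm (snd c (\<gamma> b) - x) \<le> norm (snd c (\<gamma> b) - snd c q) + norm (snd c q - x)"
    using norm_triangle_ineq[of "snd c (\<gamma> b) - snd c q" "snd c q - x"] by simp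
  then have "k * norm (snd c (\<gamma> b) - x) \<le> k * (norm (snd c (\<gamma> b) - snd c q) + norm (snd c q - x))"
    using k by (intro mult_left_mono) auto
  then show ?case using * IH(3) by (simp add: distrib_left)
qed

text \<open>
  The lower bound for lengths, passed to the infimum over all chains.
\<close>
lemma dist_lower_bound:
  assumes p: "p \<in> topspace T"
  obtains c k r where "c \<in> charts_at T A p" "0 < k" "0 < r"
    "\<And>q. q \<in> topspace T \<Longrightarrow> finsler_dist T A F p q < k * r \<Longrightarrow>
       q \<in> fst c \<and> k * norm (snd c q - snd c p) \<le> finsler_dist T A F p q"
proof -
  obtain c k r where c: "c \<in> charts_at T A p" and kr: "0 < k" "0 < r"
    and img: "ball (snd c p) r \<subseteq> snd c ` fst c"
    and low: "\<And>q u. q \<in> fst c \<Longrightarrow> snd c q \<in> ball (snd c p) r \<Longrightarrow> k * norm u \<le> F q (tangent_of_chart T A c q u)"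
    by (rule uniform_lower_bound[OF p]) blast
  note cc = charts_atD[OF c]
  show thesis
  proof (rule that[OF c kr])
    fix q assume q: "q \<in> topspace T" and d: "finsler_dist T A F p q < k * r"
    have bound: "q \<in> fst c \<and> k * norm (snd c q - snd c p) < e"
      if de: "finsler_dist T A F p q < e" "e \<le> k * r" for e
    proof -
      obtain L where L: "joins p q L" "L < e" using dist_less_joins[OF p q de(1)] .
      then have "L < k * r" using de by simp
      from joins_lower_bound[OF cc(1) kr(1) img low L(1) cc(2) _ this] L(2) show ?thesis by simp
    qed
    have "k * norm (snd c q - snd c p) \<le> finsler_dist T A F p q"
    proof (rule ccontr)
      assume "\<not> ?thesis"
      then show False
        using bound[of "min (k * r) (k * norm (snd c q - snd c p))"] d by auto
    qed
    then show "q \<in> fst c \<and> k * norm (snd c q - snd c p) \<le> finsler_dist T A F p q"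
      using bound[OF d] by simp
  qed
qed

text \<open>
  Distinct points have positive distance by the lower bound in a chart; the other properties come
  from reversing and concatenating chains.
\<close>
lemma Metric_space_finsler: "Metric_space (topspace T) (finsler_dist T A F)"
proof
  let ?d = "finsler_dist T A F"
  fix x y z
  show "0 \<le> ?d x y" by (rule dist_nonneg)
  show "?d x y = ?d y x"
  proof (cases "x \<in> topspace T \<and> y \<in> topspace T")
    case True
    moreover have "{L. joins x y L} = {L. joins y x L}" using joins_sym by blast
    ultimately show ?thesis by (simp add: finsler_dist_eq_Inf)
  qed (auto simp: finsler_dist_def)
  assume x: "x \<in> topspace T" and y: "y \<in> topspace T"
  show "?d x y = 0 \<longleftrightarrow> x = y"
  proof
    assume "?d x y = 0"
    obtain c k r where c: "c \<in> charts_at T A x" and kr: "0 < k" "0 < r"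
      and low: "\<And>q. q \<in> topspace T \<Longrightarrow> ?d x q < k * r \<Longrightarrow>
         q \<in> fst c \<and> k * norm (snd c q - snd c x) \<le> ?d x q"
      by (rule dist_lower_bound[OF x]) blast
    from low[OF y] \<open>?d x y = 0\<close> kr have "y \<in> fst c" "snd c y = snd c x"
      by (auto simp: mult_le_0_iff)
    then show "x = y" using inj_onD[OF is_chart_homeo(1)[OF charts_atD(3)[OF c]]] charts_atD(2)[OF c] by metis
  next
    assume "x = y"
    then show "?d x y = 0" using dist_le_joins[OF joins.start[OF x]] dist_nonneg[of x x] by simp
  qed
  assume z: "z \<in> topspace T"
  show "?d x z \<le> ?d x y + ?d y z"
  proof (rule field_le_epsilon)
    fix e :: real assume e: "0 < e"
    obtain L where L: "joins x y L" "L < ?d x y + e / 2" using dist_less_joins[OF x y, of "?d x y + e / 2"] e by auto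
    obtain L' where L': "joins y z L'" "L' < ?d y z + e / 2" using dist_less_joins[OF y z, of "?d y z + e / 2"] e by auto
    show "?d x z \<le> ?d x y + ?d y z + e"
      using dist_le_joins[OF joins_trans[OF L'(1) L(1)]] L(2) L'(2) by simp
  qed
qed

text \<open>
  Points that are close to \<open>p\<close> for the Finsler distance have close coordinates in a chart at \<open>p\<close>.
\<close>
lemma dist_tendsto_imp_limitin:
  assumes p: "p \<in> topspace T" and \<gamma>: "eventually (\<lambda>s. \<gamma> s \<in> topspace T) Fl"
    and lim: "((\<lambda>s. finsler_dist T A F p (\<gamma> s)) \<longlongrightarrow> 0) Fl"
  shows "limitin T \<gamma> p Fl"
proof -
  obtain c k r where c: "c \<in> charts_at T A p" and kr: "0 < k" "0 < r"
    and low: "\<And>q. q \<in> topspace T \<Longrightarrow> finsler_dist T A F p q < k * r \<Longrightarrow>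
       q \<in> fst c \<and> k * norm (snd c q - snd c p) \<le> finsler_dist T A F p q"
    by (rule dist_lower_bound[OF p]) blast
  note cc = charts_atD[OF c]
  have "eventually (\<lambda>s. finsler_dist T A F p (\<gamma> s) < k * r) Fl"
    using order_tendstoD(2)[OF lim, of "k * r"] kr by simp
  with \<gamma> have ev: "eventually (\<lambda>s. \<gamma> s \<in> fst c \<and> k * norm (snd c (\<gamma> s) - snd c p) \<le> finsler_dist T A F p (\<gamma> s)) Fl"
    by eventually_elim (rule low)
  have "((\<lambda>s. snd c (\<gamma> s) - snd c p) \<longlongrightarrow> 0) Fl"
  proof (rule Lim_null_comparison)
    show "eventually (\<lambda>s. norm (snd c (\<gamma> s) - snd c p) \<le> finsler_dist T A F p (\<gamma> s) / k) Fl"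
      using ev by eventually_elim (use kr in \<open>auto simp: field_simps\<close>)
    show "((\<lambda>s. finsler_dist T A F p (\<gamma> s) / k) \<longlongrightarrow> 0) Fl" using tendsto_divide_zero[OF lim] .
  qed
  then have "((\<lambda>s. snd c (\<gamma> s)) \<longlongrightarrow> snd c p) Fl" by (rule LIM_zero_cancel)
  from limitin_chart_inv[OF cc(1) this] cc
  have "limitin T (\<lambda>s. chart_inv c (snd c (\<gamma> s))) p Fl" by simp
  moreover have "eventually (\<lambda>s. chart_inv c (snd c (\<gamma> s)) = \<gamma> s) Fl"
    using ev by eventually_elim (simp add: chart_inv_left[OF cc(3)])
  ultimately show ?thesis by (rule limitin_transform_eventually[rotated])
qed

section \<open>Completeness of primarily bounded vector fields\<close>

text \<open>
  The speed of an integral curve is the norm of the vector field along it.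
\<close>
lemma integral_curve_dist_le:
  assumes \<gamma>: "integral_curve T A X J \<gamma>" and st: "s \<in> J" "t \<in> J" "s \<le> t"
  shows "continuous_on {s..t} (\<lambda>x. F (\<gamma> x) (X (\<gamma> x)))"
    and "\<And>x. x \<in> {s..t} \<Longrightarrow> 0 \<le> F (\<gamma> x) (X (\<gamma> x))"
    and "finsler_dist T A F (\<gamma> s) (\<gamma> t) \<le> integral {s..t} (\<lambda>x. F (\<gamma> x) (X (\<gamma> x)))"
proof -
  have J: "is_interval J" "interior J \<noteq> {}" and C: "C1_curve T A J \<gamma>"
    and v: "\<And>t. t \<in> J \<Longrightarrow> velocity T A J \<gamma> t = X (\<gamma> t)"
    using \<gamma> by (auto simp: integral_curve_def)
  have sub: "{s..t} \<subseteq> J" using mem_is_interval_1_I[OF J(1) st(1,2)] by auto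
  have nt: "at x within J \<noteq> bot" if "x \<in> J" for x by (rule at_within_interval_nontrivial[OF J that])
  have sp: "speed J \<gamma> x = F (\<gamma> x) (X (\<gamma> x))" if "x \<in> J" for x by (simp add: speed_def v[OF that])
  show c: "continuous_on {s..t} (\<lambda>x. F (\<gamma> x) (X (\<gamma> x)))"
    by (rule continuous_on_eq[OF continuous_on_subset[OF speed_continuous[OF C nt] sub]]) (use sp sub in auto)
  show "0 \<le> F (\<gamma> x) (X (\<gamma> x))" if "x \<in> {s..t}" for x
    using speed_nonneg[OF C _ nt, of x] sp[of x] sub that by auto
  show "finsler_dist T A F (\<gamma> s) (\<gamma> t) \<le> integral {s..t} (\<lambda>x. F (\<gamma> x) (X (\<gamma> x)))"
  proof (cases "s = t")
    case True
    then show ?thesis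
      using dist_le_joins[OF joins.start[OF C1_curve_in_topspace[OF C st(1)]]] by simp
  next
    case False
    then have lt: "s < t" using st(3) by simp
    have "finsler_length T A F s t \<gamma> = integral {s..t} (\<lambda>x. F (\<gamma> x) (X (\<gamma> x)))"
      unfolding finsler_length_eq
    proof (rule integral_cong)
      fix x assume x: "x \<in> {s..t}"
      have "speed {s..t} \<gamma> x = speed J \<gamma> x"
        unfolding speed_def velocity_subset[OF C sub x at_within_Icc_nontrivial[OF lt x]] ..
      then show "speed {s..t} \<gamma> x = F (\<gamma> x) (X (\<gamma> x))" using sp sub x by auto
    qed
    then show ?thesis using dist_le_length[OF C1_curve_subset[OF C sub] lt] by simp
  qed
qed

text \<open>
  The arc length from \<open>a\<close>, increased by the distance \<open>\<rho>\<close> of \<open>\<gamma> a\<close> from the base point, dominates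
  the distance from the base point. It therefore satisfies the differential inequality of
  \<open>primarily_complete_bound\<close> and stays below some \<open>R\<close>, which bounds the speed by \<open>\<alpha> R\<close>.
\<close>
lemma integral_curve_Lipschitz:
  assumes p0: "p0 \<in> topspace T" and bd: "primarily_bounded T A F p0 X"
    and \<gamma>: "integral_curve T A X J \<gamma>" and a: "a \<in> J" and b: "\<And>t. t \<in> J \<Longrightarrow> t < b"
  obtains K where "0 \<le> K"
    "\<And>s t. s \<in> J \<Longrightarrow> t \<in> J \<Longrightarrow> a \<le> s \<Longrightarrow> s \<le> t \<Longrightarrow> finsler_dist T A F (\<gamma> s) (\<gamma> t) \<le> K * (t - s)"
proof -
  interpret M: Metric_space "topspace T" "finsler_dist T A F" by (rule Metric_space_finsler)
  obtain \<alpha> where \<alpha>: "primarily_complete \<alpha>"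
    and F\<alpha>: "\<And>p. p \<in> topspace T \<Longrightarrow> F p (X p) < \<alpha> (finsler_dist T A F p p0)"
    using bd unfolding primarily_bounded_def by blast
  have mono: "\<alpha> x \<le> \<alpha> y" if "0 \<le> x" "x \<le> y" for x y
    using \<alpha> that unfolding primarily_complete_def mono_on_def by auto
  have iv: "is_interval J" and C: "C1_curve T A J \<gamma>" using \<gamma> by (auto simp: integral_curve_def)
  have top: "\<gamma> t \<in> topspace T" if "t \<in> J" for t by (rule C1_curve_in_topspace[OF C that])
  define g where "g = (\<lambda>x. F (\<gamma> x) (X (\<gamma> x)))"
  define \<rho> where "\<rho> = finsler_dist T A F (\<gamma> a) p0"
  have \<rho>: "0 \<le> \<rho>" by (simp add: \<rho>_def)
  obtain R where R: "\<And>s t g. \<lbrakk>s \<le> t; t \<le> s + (b - a); continuous_on {s..t} g;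
      \<And>x. x \<in> {s..t} \<Longrightarrow> 0 \<le> g x; \<And>x. x \<in> {s..t} \<Longrightarrow> g x \<le> \<alpha> (\<rho> + integral {s..x} g)\<rbrakk>
    \<Longrightarrow> \<rho> + integral {s..t} g \<le> R"
    using primarily_complete_bound[OF \<alpha> \<rho>, of "b - a"] by blast
  have between: "x \<in> J" if "t \<in> J" "x \<in> {a..t}" for x t
    using mem_is_interval_1_I[OF iv a that(1), of x] that(2) by simp
  have g0: "0 \<le> g x" if "x \<in> J" for x
    using integral_curve_dist_le(2)[OF \<gamma> that that, of x] by (simp add: g_def)
  have gi: "0 \<le> integral {a..t} g" if t: "t \<in> J" "a \<le> t" for t
    using integral_curve_dist_le(1)[OF \<gamma> a t] g0 between[OF t(1)]
    by (intro integral_nonneg integrable_continuous_real) (auto simp: g_def)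
  have g\<alpha>: "g x \<le> \<alpha> (\<rho> + integral {a..x} g)" if x: "x \<in> J" "a \<le> x" for x
  proof -
    have "finsler_dist T A F (\<gamma> x) p0 \<le> finsler_dist T A F (\<gamma> a) (\<gamma> x) + \<rho>"
      using M.triangle[OF top[OF x(1)] top[OF a] p0] M.commute[of "\<gamma> a" "\<gamma> x"] by (simp add: \<rho>_def)
    also have "\<dots> \<le> \<rho> + integral {a..x} g"
      using integral_curve_dist_le(3)[OF \<gamma> a x] by (simp add: g_def)
    finally have "\<alpha> (finsler_dist T A F (\<gamma> x) p0) \<le> \<alpha> (\<rho> + integral {a..x} g)"
      by (intro mono) auto
    then show ?thesis using F\<alpha>[OF top[OF x(1)]] by (simp add: g_def)
  qed
  have uR: "\<rho> + integral {a..t} g \<le> R" if t: "t \<in> J" "a \<le> t" for t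
  proof (rule R)
    show "t \<le> a + (b - a)" using b[OF t(1)] by simp
    show "continuous_on {a..t} g" using integral_curve_dist_le(1)[OF \<gamma> a t] by (simp add: g_def)
  qed (use t g0 g\<alpha> between[OF t(1)] in auto)
  have gK: "g x \<le> \<alpha> R" if x: "x \<in> J" "a \<le> x" for x
    using g\<alpha>[OF x] mono[of "\<rho> + integral {a..x} g" R] uR[OF x] gi[OF x] \<rho> by simp
  show thesis
  proof (rule that[of "\<alpha> R"])
    show "0 \<le> \<alpha> R" using gK[OF a] g0[OF a] by simp
    fix s t assume st: "s \<in> J" "t \<in> J" "a \<le> s" "s \<le> t"
    have "finsler_dist T A F (\<gamma> s) (\<gamma> t) \<le> integral {s..t} g"
      using integral_curve_dist_le(3)[OF \<gamma> st(1,2,4)] by (simp add: g_def)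
    also have "\<dots> \<le> norm (integral {s..t} g)" by simp
    also have "\<dots> \<le> \<alpha> R * (t - s)"
    proof (rule integral_bound[OF st(4)])
      show "continuous_on {s..t} g" using integral_curve_dist_le(1)[OF \<gamma> st(1,2,4)] by (simp add: g_def)
      fix x assume "x \<in> {s..t}"
      then have "x \<in> J" "a \<le> x" using between[OF st(2), of x] st(3) by auto
      then show "norm (g x) \<le> \<alpha> R" using gK g0 by simp
    qed
    finally show "finsler_dist T A F (\<gamma> s) (\<gamma> t) \<le> \<alpha> R * (t - s)" .
  qed
qed

text \<open>
  The curve is Lipschitz for a complete metric, so it is Cauchy as time tends to \<open>b\<close>.
\<close>
lemma limit_at_finite_endpoint:
  assumes complete: "finsler_complete T A F" and iv: "is_interval J"
    and top: "\<And>t. t \<in> J \<Longrightarrow> \<gamma> t \<in> topspace T"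
    and a: "a \<in> J" and b: "b = Sup J" "\<And>t. t \<in> J \<Longrightarrow> t < b" and K: "0 \<le> K"
    and lip: "\<And>s t. s \<in> J \<Longrightarrow> t \<in> J \<Longrightarrow> a \<le> s \<Longrightarrow> s \<le> t \<Longrightarrow> finsler_dist T A F (\<gamma> s) (\<gamma> t) \<le> K * (t - s)"
  obtains p where "limitin T \<gamma> p (at b within J)"
proof -
  let ?d = "finsler_dist T A F"
  interpret M: Metric_space "topspace T" ?d by (rule Metric_space_finsler)
  have ab: "a < b" by (rule b(2)[OF a])
  have above: "\<exists>t\<in>J. x < t" if "x < b" for x
    using less_cSupD[of J x] a that b(1) by blast
  have inJ: "t \<in> J" if "a \<le> t" "t < b" for t
    using above[OF that(2)] that(1) a iv unfolding is_interval_1 by (meson less_imp_le)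
  \<comment> \<open>Any sequence in \<open>{a..<b}\<close> that tends to \<open>b\<close> would do.\<close>
  define \<tau> where "\<tau> n = b - (b - a) / real (Suc n)" for n
  have \<tau>: "a \<le> \<tau> n" "\<tau> n < b" for n
  proof -
    have "(b - a) / real (Suc n) \<le> (b - a) / 1" using ab by (intro divide_left_mono) auto
    then show "a \<le> \<tau> n" by (simp add: \<tau>_def)
    show "\<tau> n < b" using ab by (simp add: \<tau>_def)
  qed
  have \<tau>lim: "\<tau> \<longlonglongrightarrow> b"
  proof -
    have "(\<lambda>n. b - (b - a) * inverse (real (Suc n))) \<longlonglongrightarrow> b - (b - a) * 0"
      by (intro tendsto_intros LIMSEQ_inverse_real_of_nat)
    then show ?thesis by (simp add: \<tau>_def[abs_def] divide_inverse)
  qed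
  have dle: "?d (\<gamma> s) (\<gamma> t) \<le> K * \<bar>t - s\<bar>" if "a \<le> s" "s < b" "a \<le> t" "t < b" for s t
  proof (cases "s \<le> t")
    case True
    then show ?thesis using lip[OF inJ inJ, of s t] that by simp
  next
    case False
    then show ?thesis using lip[OF inJ inJ, of t s] that M.commute[of "\<gamma> s" "\<gamma> t"] by simp
  qed
  have "M.MCauchy (\<lambda>n. \<gamma> (\<tau> n))"
    unfolding M.MCauchy_def
  proof (intro conjI allI impI)
    show "range (\<lambda>n. \<gamma> (\<tau> n)) \<subseteq> topspace T" using top inJ \<tau> by blast
    fix \<epsilon> :: real assume \<epsilon>: "0 < \<epsilon>"
    have "Cauchy \<tau>" using \<tau>lim by (rule LIMSEQ_imp_Cauchy)
    then obtain N where N: "\<And>m n. m \<ge> N \<Longrightarrow> n \<ge> N \<Longrightarrow> dist (\<tau> m) (\<tau> n) < \<epsilon> / (K + 1)"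
      unfolding Cauchy_def using \<epsilon> K by (metis add_nonneg_pos divide_pos_pos zero_less_one)
    show "\<exists>N. \<forall>n n'. N \<le> n \<longrightarrow> N \<le> n' \<longrightarrow> ?d (\<gamma> (\<tau> n)) (\<gamma> (\<tau> n')) < \<epsilon>"
    proof (intro exI[of _ N] allI impI)
      fix n n' assume n: "N \<le> n" "N \<le> n'"
      have "?d (\<gamma> (\<tau> n)) (\<gamma> (\<tau> n')) \<le> K * \<bar>\<tau> n' - \<tau> n\<bar>" by (rule dle) (rule \<tau>)+
      also have "\<dots> \<le> (K + 1) * \<bar>\<tau> n' - \<tau> n\<bar>" by (intro mult_right_mono) auto
      also have "\<dots> < \<epsilon>" using N[OF n(2,1)] K by (simp add: dist_real_def field_simps)
      finally show "?d (\<gamma> (\<tau> n)) (\<gamma> (\<tau> n')) < \<epsilon>" .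
    qed
  qed
  then obtain p where "limitin M.mtopology (\<lambda>n. \<gamma> (\<tau> n)) p sequentially"
    using complete unfolding finsler_complete_def M.mcomplete_def by blast
  then have p: "p \<in> topspace T"
    and plim: "\<forall>\<epsilon>>0. \<exists>N. \<forall>n\<ge>N. \<gamma> (\<tau> n) \<in> topspace T \<and> ?d (\<gamma> (\<tau> n)) p < \<epsilon>"
    unfolding M.limit_metric_sequentially by simp_all
  have dp: "?d p (\<gamma> t) \<le> K * (b - t)" if t: "a \<le> t" "t < b" for t
  proof (rule field_le_epsilon)
    fix \<epsilon> :: real assume \<epsilon>: "0 < \<epsilon>"
    obtain N where N: "\<And>n. n \<ge> N \<Longrightarrow> ?d (\<gamma> (\<tau> n)) p < \<epsilon>" using plim \<epsilon> by blast
    have "eventually (\<lambda>n. t < \<tau> n) sequentially" using order_tendstoD(1)[OF \<tau>lim t(2)] .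
    then obtain N' where N': "\<And>n. n \<ge> N' \<Longrightarrow> t < \<tau> n" unfolding eventually_sequentially by blast
    define n where "n = max N N'"
    have n: "?d (\<gamma> (\<tau> n)) p < \<epsilon>" "t < \<tau> n" using N[of n] N'[of n] by (auto simp: n_def)
    have "?d p (\<gamma> t) \<le> ?d p (\<gamma> (\<tau> n)) + ?d (\<gamma> (\<tau> n)) (\<gamma> t)"
      by (rule M.triangle) (use p top inJ \<tau> t in auto)
    also have "?d (\<gamma> (\<tau> n)) (\<gamma> t) \<le> K * \<bar>t - \<tau> n\<bar>" by (rule dle) (use \<tau> t in auto)
    also have "\<dots> \<le> K * (b - t)" using n(2) \<tau>(2)[of n] K by (intro mult_left_mono) auto
    finally show "?d p (\<gamma> t) \<le> K * (b - t) + \<epsilon>" using n(1) M.commute[of p "\<gamma> (\<tau> n)"] by simp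
  qed
  have near: "eventually (\<lambda>t. a \<le> t \<and> t < b) (at b within J)"
    unfolding eventually_at
    by (rule exI[of _ "b - a"]) (use ab b(2) in \<open>auto simp: dist_real_def\<close>)
  have "((\<lambda>t. ?d p (\<gamma> t)) \<longlongrightarrow> 0) (at b within J)"
  proof (rule Lim_null_comparison)
    show "eventually (\<lambda>t. norm (?d p (\<gamma> t)) \<le> K * (b - t)) (at b within J)"
      using near by eventually_elim (use dp in auto)
    have "((\<lambda>t. K * (b - t)) \<longlongrightarrow> K * (b - b)) (at b within J)" by (intro tendsto_intros)
    then show "((\<lambda>t. K * (b - t)) \<longlongrightarrow> 0) (at b within J)" by simp
  qed
  moreover have "eventually (\<lambda>t. \<gamma> t \<in> topspace T) (at b within J)"
    using near by eventually_elim (use top inJ in auto)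
  ultimately have "limitin T \<gamma> p (at b within J)" using dist_tendsto_imp_limitin[OF p] by blast
  then show thesis by (rule that)
qed

lemma extend_right:
  assumes complete: "finsler_complete T A F" and p0: "p0 \<in> topspace T"
    and X: "C1_vector_field T A X" and bd: "primarily_bounded T A F p0 X"
    and \<gamma>: "integral_curve T A X J \<gamma>" and above: "J \<subseteq> {..y}"
  shows "\<exists>K \<eta>. integral_curve T A X K \<eta> \<and> J \<subset> K \<and> (\<forall>t\<in>J. \<eta> t = \<gamma> t)"
proof -
  have iv: "is_interval J" "interior J \<noteq> {}" and C: "C1_curve T A J \<gamma>"
    using \<gamma> by (auto simp: integral_curve_def)
  then obtain a where a: "a \<in> J" by fastforce
  define b where "b = Sup J"
  have Jb: "J \<subseteq> {..b}"
    unfolding b_def using above by (auto intro!: cSup_upper bdd_above.I2)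
  show ?thesis
  proof (cases "b \<in> J")
    case True
    then show ?thesis by (rule extend_beyond_maximum[OF X \<gamma> _ Jb])
  next
    case False
    have lt: "t < b" if "t \<in> J" for t using that Jb False by (metis atMost_iff order_le_less subsetD)
    show ?thesis
    proof (rule integral_curve_Lipschitz[OF p0 bd \<gamma> a lt])
      fix K :: real
      assume K: "0 \<le> K" "\<And>s t. s \<in> J \<Longrightarrow> t \<in> J \<Longrightarrow> a \<le> s \<Longrightarrow> s \<le> t \<Longrightarrow>
        finsler_dist T A F (\<gamma> s) (\<gamma> t) \<le> K * (t - s)"
      obtain p where "limitin T \<gamma> p (at b within J)"
        by (rule limit_at_finite_endpoint[OF complete iv(1) C1_curve_in_topspace[OF C] a b_def lt K])
      then show ?thesis by (rule extend_to_limit[OF X \<gamma> False Jb b_def])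
    qed
  qed
qed

lemma primarily_bounded_uminus:
  assumes X: "C1_vector_field T A X" and bd: "primarily_bounded T A F p0 X"
  shows "primarily_bounded T A F p0 (\<lambda>p c. - X p c)"
proof -
  have "F p (\<lambda>c. - X p c) = F p (X p)" if "p \<in> topspace T" for p
    using F_norm(2)[OF that vector_field_tangent[OF X that], of "-1"] by simp
  then show ?thesis using bd unfolding primarily_bounded_def by metis
qed

theorem primarily_bounded_imp_complete:
  assumes complete: "finsler_complete T A F" and p0: "p0 \<in> topspace T"
    and X: "C1_vector_field T A X" and bd: "primarily_bounded T A F p0 X"
  shows "complete_vector_field T A X"
  unfolding complete_vector_field_def
proof (intro allI impI)
  fix J \<gamma> assume \<gamma>: "integral_curve T A X J \<gamma>"
  obtain K \<eta> where K: "integral_curve T A X K \<eta>" "J \<subseteq> K" "\<And>t. t \<in> J \<Longrightarrow> \<eta> t = \<gamma> t"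
    and max: "\<And>K' \<eta>'. integral_curve T A X K' \<eta>' \<Longrightarrow> K \<subseteq> K' \<Longrightarrow> (\<And>t. t \<in> K \<Longrightarrow> \<eta>' t = \<eta> t) \<Longrightarrow> K' = K"
    by (rule maximal_integral_curve_exists[OF X \<gamma>]) blast
  have "K = UNIV"
  proof (rule ccontr)
    assume "K \<noteq> UNIV"
    then obtain y where y: "y \<notin> K" by blast
    have "is_interval K" using K(1) by (simp add: integral_curve_def)
    then have "K \<subseteq> {..y} \<or> K \<subseteq> {y..}"
      using y unfolding is_interval_1 by (meson atLeast_iff atMost_iff linear subsetI)
    then show False
    proof
      assume "K \<subseteq> {..y}"
      from extend_right[OF complete p0 X bd K(1) this] max show False by blast
    next
      assume "K \<subseteq> {y..}"
      then have "uminus ` K \<subseteq> {..- y}" by auto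
      from extend_right[OF complete p0 vector_field_uminus[OF X] primarily_bounded_uminus[OF X bd]
          integral_curve_reverse[OF K(1)] this]
      obtain K' \<eta>' where K': "integral_curve T A (\<lambda>p c. - X p c) K' \<eta>'" "uminus ` K \<subset> K'"
        "\<forall>t\<in>uminus ` K. \<eta>' t = \<eta> (- t)" by blast
      have "integral_curve T A X (uminus ` K') (\<lambda>t. \<eta>' (- t))"
        using integral_curve_reverse[OF K'(1)] by simp
      moreover have "K \<subseteq> uminus ` K'"
        using image_mono[OF psubset_imp_subset[OF K'(2)], of uminus] by (simp add: image_image)
      moreover have "\<eta>' (- t) = \<eta> t" if "t \<in> K" for t using K'(3) that by auto
      ultimately have "uminus ` K' = K" by (rule max)
      then have "uminus ` uminus ` K' = uminus ` K" by simp
      then show False using K'(2) by (simp add: image_image)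
    qed
  qed
  then show "\<exists>\<Gamma>. integral_curve T A X UNIV \<Gamma> \<and> (\<forall>t\<in>J. \<Gamma> t = \<gamma> t)" using K by blast
qed

end

theorem theorem1:
  fixes T :: "'m topology"
    and A :: "('m, 'b::banach) chart set"
    and F :: "'m \<Rightarrow> ('m, 'b) tangent \<Rightarrow> real"
    and X :: "'m \<Rightarrow> ('m, 'b) tangent"
    and p\<^sub>0 :: 'm
  assumes "banach_manifold T A"
    and "finsler_metric T A F"
    and "finsler_complete T A F"
    and "p\<^sub>0 \<in> topspace T"
    and "C1_vector_field T A X"
    and "primarily_bounded T A F p\<^sub>0 X"
  shows "complete_vector_field T A X"
proof -
  interpret finsler_mfd T A F using assms by unfold_locales
  show ?thesis using assms by (intro primarily_bounded_imp_complete)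
qed

end
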